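(* For each $d\ge 2$, the language $BT_d(h,k)$ is in $\mathbf{LogDCFL}$; this remains true even when $d$ is given as an additional input parameter.
   Context: $T^h_d$ is the balanced rooted $d$-ary tree with $h$ levels. An instance with parameter $k$ assigns to each internal node $i$ a function $f_i:[k]^d\to[k]$ and to each leaf an element of $[k]=\{1,\dots,k\}$; $v_i$ is the leaf label for a leaf and $v_i=f_i(v_{j_1},\dots,v_{j_d})$ for an internal node with children $j_1,\dots,j_d$. In $BT_d(h,k)$ the input is a binary string encoding $h$ and $k$, each node function $f_i$ as a sequence of $k^d$ binary numbers in $[k]$, and each leaf value as a binary number in $[k]$ (so the input length is $\Theta(d^hk^d\log k)$); the instance is accepted iff the root value is $1$. $\mathbf{LogDCFL}$ is the class of languages logspace reducible to a deterministic context-free language. *)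

theory Defs
  imports Complex_Main "HOL-Library.Landau_Symbols" "HOL-Library.Log_Nat"
begin

section \<open>Deterministic context-free languages\<close>

text \<open>The transition function maps a state, an input letter (or \<open>None\<close> for a move that reads
  no input) and the topmost stack symbol to a new state and the word that replaces that symbol.
  The head of a stack word is the top of the stack.\<close>

record ('q, 'a, 's) dpda =
  dpda_states :: "'q set"
  dpda_input :: "'a set"
  dpda_stack :: "'s set"
  dpda_trans :: "'q \<Rightarrow> 'a option \<Rightarrow> 's \<Rightarrow> ('q \<times> 's list) option"
  dpda_init :: 'q
  dpda_bottom :: 's
  dpda_final :: "'q set"

definition wf_dpda :: "('q, 'a, 's) dpda \<Rightarrow> bool" where
  "wf_dpda M \<longleftrightarrow>
     finite (dpda_states M) \<and> finite (dpda_input M) \<and> finite (dpda_stack M) \<and>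
     dpda_init M \<in> dpda_states M \<and> dpda_bottom M \<in> dpda_stack M \<and>
     dpda_final M \<subseteq> dpda_states M \<and>
     (\<forall>q\<in>dpda_states M. \<forall>x\<in>insert None (Some ` dpda_input M). \<forall>s\<in>dpda_stack M. \<forall>p \<gamma>.
        dpda_trans M q x s = Some (p, \<gamma>) \<longrightarrow> p \<in> dpda_states M \<and> set \<gamma> \<subseteq> dpda_stack M) \<and>
     (\<forall>q\<in>dpda_states M. \<forall>s\<in>dpda_stack M.
        dpda_trans M q None s \<noteq> None \<longrightarrow>
        (\<forall>a\<in>dpda_input M. dpda_trans M q (Some a) s = None))"

inductive dpda_step ::
  "('q, 'a, 's) dpda \<Rightarrow> 'q \<times> 'a list \<times> 's list \<Rightarrow> 'q \<times> 'a list \<times> 's list \<Rightarrow> bool"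
  for M where
  read: "dpda_trans M q (Some a) s = Some (p, \<gamma>) \<Longrightarrow>
           dpda_step M (q, a # w, s # \<beta>) (p, w, \<gamma> @ \<beta>)"
| silent: "dpda_trans M q None s = Some (p, \<gamma>) \<Longrightarrow>
           dpda_step M (q, w, s # \<beta>) (p, w, \<gamma> @ \<beta>)"

definition dpda_language :: "('q, 'a, 's) dpda \<Rightarrow> 'a list set" where
  "dpda_language M =
     {w \<in> lists (dpda_input M). \<exists>q\<in>dpda_final M. \<exists>\<beta>.
        (dpda_step M)\<^sup>*\<^sup>* (dpda_init M, w, [dpda_bottom M]) (q, [], \<beta>)}"

definition dcfl :: "'a list set \<Rightarrow> bool" where
  "dcfl L \<longleftrightarrow> (\<exists>M :: (nat, 'a, nat) dpda. wf_dpda M \<and> dpda_language M = L)"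


section \<open>Logarithmic-space computable functions\<close>

text \<open>Deterministic Turing transducers have a two-way read-only input tape delimited by
  end-markers, a fixed number of work tapes with cells indexed by the natural numbers, and a
  write-only output tape. A machine halts when its transition function yields \<open>None\<close>.\<close>

datatype 'a cell = Left_End | Letter 'a | Right_End

datatype dir = Go_Left | Stay | Go_Right

record ('q, 'a, 'g, 'b) transducer =
  tt_states :: "'q set"
  tt_work :: "'g set"
  tt_blank :: 'g
  tt_tapes :: nat
  tt_init :: 'q
  tt_trans :: "'q \<Rightarrow> 'a cell \<Rightarrow> 'g list \<Rightarrow> ('q \<times> dir \<times> ('g \<times> dir) list \<times> 'b option) option"

definition wf_transducer :: "('q, 'a, 'g, 'b) transducer \<Rightarrow> bool" where
  "wf_transducer M \<longleftrightarrow>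
     finite (tt_states M) \<and> finite (tt_work M) \<and>
     tt_init M \<in> tt_states M \<and> tt_blank M \<in> tt_work M \<and>
     (\<forall>q\<in>tt_states M. \<forall>c. \<forall>gs\<in>lists (tt_work M). \<forall>p d acts out.
        length gs = tt_tapes M \<and> tt_trans M q c gs = Some (p, d, acts, out) \<longrightarrow>
        p \<in> tt_states M \<and> length acts = tt_tapes M \<and> fst ` set acts \<subseteq> tt_work M)"

text \<open>In a configuration, input position \<open>0\<close> is the left end-marker and position \<open>length w + 1\<close>
  is the right one; every work tape is given by its contents and its head position; the last
  component is the output written so far. A move to the left of cell \<open>0\<close> of a tape, or beyond the
  right end-marker, leaves the head where it is.\<close>

type_synonym ('q, 'g, 'b) tt_config = "'q \<times> nat \<times> ((nat \<Rightarrow> 'g) \<times> nat) list \<times> 'b list"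

definition input_cell :: "'a list \<Rightarrow> nat \<Rightarrow> 'a cell" where
  "input_cell w p =
     (if p = 0 then Left_End else if p \<le> length w then Letter (w ! (p - 1)) else Right_End)"

fun move_head :: "dir \<Rightarrow> nat \<Rightarrow> nat" where
  "move_head Go_Left p = p - 1"
| "move_head Stay p = p"
| "move_head Go_Right p = Suc p"

fun work_act :: "(nat \<Rightarrow> 'g) \<times> nat \<Rightarrow> 'g \<times> dir \<Rightarrow> (nat \<Rightarrow> 'g) \<times> nat" where
  "work_act (t, p) (g, d) = (t(p := g), move_head d p)"

definition tt_start :: "('q, 'a, 'g, 'b) transducer \<Rightarrow> ('q, 'g, 'b) tt_config" where
  "tt_start M = (tt_init M, 0, replicate (tt_tapes M) (\<lambda>_. tt_blank M, 0), [])"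

inductive tt_step ::
  "('q, 'a, 'g, 'b) transducer \<Rightarrow> 'a list \<Rightarrow>
   ('q, 'g, 'b) tt_config \<Rightarrow> ('q, 'g, 'b) tt_config \<Rightarrow> bool"
  for M w where
  "tt_trans M q (input_cell w i) (map (\<lambda>(t, p). t p) ts) = Some (q', d, acts, out) \<Longrightarrow>
   tt_step M w (q, i, ts, u)
     (q', min (move_head d i) (length w + 1), map2 work_act ts acts,
      u @ (case out of None \<Rightarrow> [] | Some b \<Rightarrow> [b]))"

definition tt_computes :: "('q, 'a, 'g, 'b) transducer \<Rightarrow> ('a list \<Rightarrow> 'b list) \<Rightarrow> bool" where
  "tt_computes M f \<longleftrightarrow>
     (\<forall>w. \<exists>q i ts. (tt_step M w)\<^sup>*\<^sup>* (tt_start M) (q, i, ts, f w) \<and>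
        (\<nexists>c. tt_step M w (q, i, ts, f w) c))"

text \<open>Only the work tapes count towards the space: on inputs of length \<open>n\<close> the machine may use
  the first \<open>s n\<close> cells of each of them.\<close>

definition tt_space :: "('q, 'a, 'g, 'b) transducer \<Rightarrow> (nat \<Rightarrow> nat) \<Rightarrow> bool" where
  "tt_space M s \<longleftrightarrow>
     (\<forall>w q i ts u. (tt_step M w)\<^sup>*\<^sup>* (tt_start M) (q, i, ts, u) \<longrightarrow>
        (\<forall>(t, p)\<in>set ts. p < s (length w)))"

definition logspace_computable :: "('a::finite list \<Rightarrow> 'b list) \<Rightarrow> bool" where
  "logspace_computable f \<longleftrightarrow>
     (\<exists>(M :: (nat, 'a, nat, 'b) transducer) s.
        wf_transducer M \<and> tt_computes M f \<and> tt_space M s \<and>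
        (\<lambda>n. real (s n)) \<in> O(\<lambda>n. ln (real n)))"

definition LogDCFL :: "'a::finite list set set" where
  "LogDCFL =
     {A. \<exists>(f :: 'a list \<Rightarrow> nat list) L.
        dcfl L \<and> logspace_computable f \<and> (\<forall>w. w \<in> A \<longleftrightarrow> f w \<in> L)}"


section \<open>The tree evaluation problem\<close>

text \<open>The nodes of the balanced \<open>d\<close>-ary tree with \<open>h\<close> levels are numbered level by level and from
  left to right, starting with \<open>1\<close> at the root (as in a heap), so that the children of node \<open>i\<close>
  are \<open>d * (i - 1) + 2, \<dots>, d * (i - 1) + d + 1\<close>. The internal nodes come first, then the leaves.\<close>

definition child :: "nat \<Rightarrow> nat \<Rightarrow> nat \<Rightarrow> nat" where
  "child d i j = d * (i - 1) + 2 + j"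

definition num_internal :: "nat \<Rightarrow> nat \<Rightarrow> nat" where
  "num_internal d h = (\<Sum>l<h - 1. d ^ l)"

definition internal_nodes :: "nat \<Rightarrow> nat \<Rightarrow> nat list" where
  "internal_nodes d h = [1..<num_internal d h + 1]"

definition leaves :: "nat \<Rightarrow> nat \<Rightarrow> nat list" where
  "leaves d h = [num_internal d h + 1..<num_internal d h + d ^ (h - 1) + 1]"

text \<open>The argument tuples \<open>[k]\<^sup>d\<close>, in lexicographic order.\<close>

definition tuples :: "nat \<Rightarrow> nat \<Rightarrow> nat list list" where
  "tuples d k = product_lists (replicate d [1..<k + 1])"

definition tree_instance ::
  "nat \<Rightarrow> nat \<Rightarrow> nat \<Rightarrow> (nat \<Rightarrow> nat list \<Rightarrow> nat) \<Rightarrow> (nat \<Rightarrow> nat) \<Rightarrow> bool" where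
  "tree_instance d h k f leaf \<longleftrightarrow>
     h \<ge> 1 \<and> k \<ge> 1 \<and>
     (\<forall>i\<in>set (internal_nodes d h). \<forall>x\<in>set (tuples d k). f i x \<in> {1..k}) \<and>
     (\<forall>i\<in>set (leaves d h). leaf i \<in> {1..k})"

text \<open>\<open>node_value d f leaf m i\<close> is the value of node \<open>i\<close> if \<open>i\<close> is \<open>m\<close> levels above the leaves.\<close>

fun node_value ::
  "nat \<Rightarrow> (nat \<Rightarrow> nat list \<Rightarrow> nat) \<Rightarrow> (nat \<Rightarrow> nat) \<Rightarrow> nat \<Rightarrow> nat \<Rightarrow> nat" where
  "node_value d f leaf 0 i = leaf i"
| "node_value d f leaf (Suc m) i = f i (map (\<lambda>j. node_value d f leaf m (child d i j)) [0..<d])"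

definition root_value ::
  "nat \<Rightarrow> nat \<Rightarrow> (nat \<Rightarrow> nat list \<Rightarrow> nat) \<Rightarrow> (nat \<Rightarrow> nat) \<Rightarrow> nat" where
  "root_value d h f leaf = node_value d f leaf (h - 1) 1"

text \<open>Binary numbers have their most significant bit first. The parameters are written without
  leading zeros and made self-delimiting by a \<open>True\<close> in front of every bit and a final \<open>False\<close>.
  Elements of \<open>[k]\<close> are written with as many bits as \<open>k\<close> itself.\<close>

definition binary :: "nat \<Rightarrow> nat \<Rightarrow> bool list" where
  "binary b n = map (bit n) (rev [0..<b])"

definition encode_parameter :: "nat \<Rightarrow> bool list" where
  "encode_parameter n = concat (map (\<lambda>b. [True, b]) (binary (floorlog 2 n) n)) @ [False]"

definition encode_element :: "nat \<Rightarrow> nat \<Rightarrow> bool list" where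
  "encode_element k x = binary (floorlog 2 k) x"

definition encode_tree ::
  "nat \<Rightarrow> nat \<Rightarrow> nat \<Rightarrow> (nat \<Rightarrow> nat list \<Rightarrow> nat) \<Rightarrow> (nat \<Rightarrow> nat) \<Rightarrow> bool list" where
  "encode_tree d h k f leaf =
     encode_parameter h @ encode_parameter k @
     concat (map (\<lambda>i. concat (map (\<lambda>x. encode_element k (f i x)) (tuples d k)))
       (internal_nodes d h)) @
     concat (map (\<lambda>i. encode_element k (leaf i)) (leaves d h))"

definition BT :: "nat \<Rightarrow> bool list set" where
  "BT d = {encode_tree d h k f leaf | h k f leaf.
     tree_instance d h k f leaf \<and> root_value d h f leaf = 1}"

definition BT_degree :: "bool list set" where
  "BT_degree = {encode_parameter d @ encode_tree d h k f leaf | d h k f leaf.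
     d \<ge> 2 \<and> tree_instance d h k f leaf \<and> root_value d h f leaf = 1}"

end

theory Submission
  imports Defs
begin

text \<open>The transducer turns a tree into a table of stack operations, repeated once for every step of the
  depth-first evaluation. A state of the evaluation is a node \<open>i\<close>, the number \<open>j\<close> of its children
  that have been evaluated, and the index \<open>y\<close> of their values in the table of \<open>f\<^sub>i\<close>; there
  are polynomially many, so they can be numbered in unary on the stack. The automaton pops one digit
  per table entry and thus finds the entry of the current state; this entry is a word that it pushes. To
  call a child it pushes the number of its own next state less the value to be returned, and then
  the number of the initial state of the child; as numbers are unary, pushing the value \<open>v\<close> on return
  completes that number.

  Logarithmic space is shown for a small language of arithmetic expressions and output loops over the
  input. Iteration in this language saturates at the input length, so all values are polynomially bounded
  and can be kept in binary counters. The node functions determine the length of the input, except for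
  trees that consist of a leaf only, where \<open>d\<close> and \<open>k\<close> may be exponentially large; there the saturated
  values still decide whether the leaf has value \<open>1\<close>.

  A fixed degree \<open>d\<close> is handled by running the program for variable degree on the input with the encoding
  of \<open>d\<close> in front.\<close>

section \<open>Structured programs for Turing transducers\<close>

text \<open>The table is repeated because a pushdown automaton reads its input once, from left to
  right: every lookup uses up one copy. Numbers on the stack are unary because a single automaton,
  with fixed states and letters, has to serve all \<open>d\<close>, \<open>h\<close> and
  \<open>k\<close>; comparing stack and input is then mere counting, and adding a returned value to
  a pending number is concatenation. The index \<open>y\<close> has \<open>k ^ d\<close> possible
  values, which is affordable because the table of one node function already puts that many elements
  into the input. Heap numbering from \<open>1\<close> leaves the rows of node \<open>0\<close>
  free: the value of the root is returned onto the bottom symbol and looked up there as an entry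
  number, and only entry \<open>1\<close> accepts.

  A reduction is total, so ill-formed words need an image too: \<open>reduce\<close> checks the
  syntax and yields the empty word on failure, which the automaton rejects. As only truncated
  parameters can be stored, truncation must be shown not to mislead the length test.\<close>

datatype sym = Blank | Mark | One | Two

fun code :: "sym \<Rightarrow> nat" where
  "code Blank = 0" | "code Mark = 1" | "code One = 2" | "code Two = 3"

lemma code_eq_iff [simp]: "code a = code b \<longleftrightarrow> a = b"
  by (cases a; cases b) auto

lemma code_le: "code g \<le> 3"
  by (cases g) auto

type_synonym test = "bool cell \<Rightarrow> nat list \<Rightarrow> bool"

datatype com =
    Skip
  | Input dir
  | Work nat "sym option" dir
  | Out nat
  | Seq com com
  | Cond test com com
  | While test com

definition idle :: "nat list \<Rightarrow> (nat \<times> dir) list" where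
  "idle gs = map (\<lambda>g. (g, Stay)) gs"

lemma idle_simps [simp]: "length (idle gs) = length gs" "fst ` set (idle gs) = set gs"
  by (auto simp: idle_def image_image)

text \<open>A state of the compiled machine is the list of programs that remain to be executed.\<close>

fun ctrans :: "com list \<Rightarrow> bool cell \<Rightarrow> nat list \<Rightarrow>
    (com list \<times> dir \<times> (nat \<times> dir) list \<times> nat option) option" where
  "ctrans [] c gs = None"
| "ctrans (Skip # k) c gs = Some (k, Stay, idle gs, None)"
| "ctrans (Input d # k) c gs = Some (k, d, idle gs, None)"
| "ctrans (Work r g d # k) c gs =
     Some (k, Stay, (idle gs)[r := (case g of None \<Rightarrow> gs ! r | Some g \<Rightarrow> code g, d)], None)"
| "ctrans (Out b # k) c gs = Some (k, Stay, idle gs, Some b)"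
| "ctrans (Seq a b # k) c gs = Some (a # b # k, Stay, idle gs, None)"
| "ctrans (Cond t a b # k) c gs = Some ((if t c gs then a else b) # k, Stay, idle gs, None)"
| "ctrans (While t a # k) c gs =
     Some (if t c gs then a # While t a # k else k, Stay, idle gs, None)"

text \<open>The pending lists that can occur while \<open>c\<close> runs in front of
  \<open>k\<close>. The set is finite because the body of a loop is followed by the loop itself, so
  each round returns to the same list. Together with \<open>conts_closed\<close> this gives compiled
  machines a finite state set.\<close>

fun conts :: "com \<Rightarrow> com list \<Rightarrow> com list set" where
  "conts (Seq a b) k = insert (Seq a b # k) (conts a (b # k) \<union> conts b k)"
| "conts (Cond t a b) k = insert (Cond t a b # k) (conts a k \<union> conts b k)"
| "conts (While t a) k = insert (While t a # k) (conts a (While t a # k))"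
| "conts c k = {c # k}"

lemma finite_conts: "finite (conts c k)"
  by (induction c arbitrary: k) auto

lemma head_in_conts: "c # k \<in> conts c k"
  by (cases c) auto

lemma conts_closed:
  "l \<in> conts c k \<Longrightarrow> ctrans l x gs = Some (p, r) \<Longrightarrow> p \<in> insert k (conts c k)"
proof (induction c arbitrary: k)
  case (Seq a b)
  then show ?case using head_in_conts[of a "b # k"] head_in_conts[of b k] by fastforce
next
  case (Cond t a b)
  then show ?case using head_in_conts[of a k] head_in_conts[of b k] by (fastforce split: if_splits)
next
  case (While t a)
  then show ?case using head_in_conts[of a "While t a # k"] by (fastforce split: if_splits)
qed auto

section \<open>Compiled machines and renaming of their states\<close>

definition machine :: "nat \<Rightarrow> com \<Rightarrow> (com list, bool, nat, nat) transducer" where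
  "machine m c = \<lparr>tt_states = insert [] (conts c []), tt_work = {..3}, tt_blank = 0,
     tt_tapes = m, tt_init = [c], tt_trans = ctrans\<rparr>"

lemma wf_transducerI:
  assumes "finite (tt_states M)" "finite (tt_work M)" "tt_init M \<in> tt_states M" "tt_blank M \<in> tt_work M"
    and "\<And>q c gs p d acts out. q \<in> tt_states M \<Longrightarrow> set gs \<subseteq> tt_work M \<Longrightarrow> length gs = tt_tapes M \<Longrightarrow>
      tt_trans M q c gs = Some (p, d, acts, out) \<Longrightarrow>
      p \<in> tt_states M \<and> length acts = tt_tapes M \<and> fst ` set acts \<subseteq> tt_work M"
  shows "wf_transducer M"
  unfolding wf_transducer_def
  by (intro conjI ballI allI impI assms(1-4))
    (auto dest!: assms(5)[rotated 3] simp: subset_iff)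

lemma wf_machine: "wf_transducer (machine m c)"
proof (rule wf_transducerI)
  fix q x gs p d acts out
  assume q: "q \<in> tt_states (machine m c)" and gs: "set gs \<subseteq> tt_work (machine m c)"
    and len: "length gs = tt_tapes (machine m c)"
    and tr: "tt_trans (machine m c) q x gs = Some (p, d, acts, out)"
  have tr: "ctrans q x gs = Some (p, d, acts, out)" using tr by (simp add: machine_def)
  have gs: "set gs \<subseteq> {..3}" using gs by (simp add: machine_def)
  have p: "p \<in> tt_states (machine m c)"
    using q tr conts_closed[of q c "[]" x gs p] by (cases "q = []") (auto simp: machine_def)
  have acts: "length acts = length gs \<and> fst ` set acts \<subseteq> {..3}"
  proof (cases "\<exists>r g e k. q = Work r g e # k")
    case True
    then obtain r g e k where "q = Work r g e # k" by blast
    define a where "a = (case g of None \<Rightarrow> gs ! r | Some g \<Rightarrow> code g)"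
    have acts: "acts = (idle gs)[r := (a, e)]"
      using tr \<open>q = _\<close> by (auto simp: a_def)
    have "fst ` set acts \<subseteq> {..3}"
    proof (cases "r < length gs")
      case True
      then have "a \<le> 3"
        using gs code_le nth_mem[of r gs] by (auto split: option.split simp: a_def subset_iff)
      moreover have "fst ` set (idle gs) \<subseteq> {..3}"
        using gs by auto
      ultimately show ?thesis
        unfolding acts using set_update_subset_insert[of "idle gs" r "(a, e)"] by fastforce
    next
      case False
      \<comment> \<open>Updating a list beyond its end changes nothing, so a tape number out of
        range is harmless.\<close>
      then have "acts = idle gs" unfolding acts by (simp add: list_update_beyond)
      then show ?thesis using gs by simp
    qed
    then show ?thesis by (simp add: acts)
  next
    case False
    then have "acts = idle gs"
      using tr by (cases "(q, x, gs)" rule: ctrans.cases) auto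
    then show ?thesis using gs by auto
  qed
  show "p \<in> tt_states (machine m c) \<and> length acts = tt_tapes (machine m c) \<and>
      fst ` set acts \<subseteq> tt_work (machine m c)"
    using p acts len by (simp add: machine_def)
qed (simp_all add: machine_def finite_conts head_in_conts)

lemma tt_step_deterministic: "tt_step M w a b \<Longrightarrow> tt_step M w a c \<Longrightarrow> b = c"
  by (auto elim!: tt_step.cases)

text \<open>\<open>logspace_computable\<close> asks for states of type \<open>nat\<close>, whereas
  compiled machines have lists of programs as states; a finite set of states embeds into
  \<open>nat\<close>. The premise \<open>closed\<close> covers arbitrary scanned symbols, so the
  simulation needs no invariant about the contents of the tapes.\<close>

lemma nat_transducer:
  fixes M :: "('q, 'a::finite, nat, 'b) transducer"
  assumes wf: "wf_transducer M"
    and closed: "\<And>q c gs p r. q \<in> tt_states M \<Longrightarrow> tt_trans M q c gs = Some (p, r) \<Longrightarrow> p \<in> tt_states M"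
    and comp: "tt_computes M f" and space: "tt_space M s"
    and bigo: "(\<lambda>n. real (s n)) \<in> O(\<lambda>n. ln (real n))"
  shows "logspace_computable f"
proof -
  let ?Q = "tt_states M"
  have "finite ?Q" using wf by (simp add: wf_transducer_def)
  then obtain e :: "'q \<Rightarrow> nat" where e: "inj_on e ?Q"
    using finite_imp_inj_to_nat_seg by blast
  define d where "d = inv_into ?Q e"
  have d: "d (e q) = q" if "q \<in> ?Q" for q using that e by (simp add: d_def)
  define N :: "(nat, 'a, nat, 'b) transducer" where
    "N = \<lparr>tt_states = e ` ?Q, tt_work = tt_work M, tt_blank = tt_blank M, tt_tapes = tt_tapes M,
       tt_init = e (tt_init M),
       tt_trans = (\<lambda>q c gs. map_option (\<lambda>(p, r). (e p, r)) (tt_trans M (d q) c gs))\<rparr>"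
  have init: "tt_init M \<in> ?Q" using wf by (simp add: wf_transducer_def)
  have wfN: "wf_transducer N"
  proof (rule wf_transducerI)
    fix x c gs y dd acts out
    assume x: "x \<in> tt_states N" and gs: "set gs \<subseteq> tt_work N" "length gs = tt_tapes N"
      and tr: "tt_trans N x c gs = Some (y, dd, acts, out)"
    obtain q where q: "q \<in> ?Q" "x = e q" using x by (auto simp: N_def)
    obtain p where p: "y = e p" "tt_trans M q c gs = Some (p, dd, acts, out)"
      using tr by (auto simp: N_def d[OF q(1)] q(2))
    show "y \<in> tt_states N \<and> length acts = tt_tapes N \<and> fst ` set acts \<subseteq> tt_work N"
    proof -
      have "gs \<in> lists (tt_work M)" "length gs = tt_tapes M"
        using gs by (auto simp: N_def)
      then have "p \<in> ?Q \<and> length acts = tt_tapes M \<and> fst ` set acts \<subseteq> tt_work M"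
        using wf q(1) p(2) unfolding wf_transducer_def by blast
      then show ?thesis by (simp add: N_def p(1))
    qed
  qed (use wf in \<open>simp_all add: N_def wf_transducer_def\<close>)
  have trN: "tt_trans N (e q) c gs = map_option (\<lambda>(p, r). (e p, r)) (tt_trans M q c gs)"
    if "q \<in> ?Q" for q c gs
    using that by (simp add: N_def d)
  have fwd: "p \<in> ?Q \<and> tt_step N w (e q, i, ts, u) (e p, i', ts', u')"
    if st: "tt_step M w (q, i, ts, u) (p, i', ts', u')" and q: "q \<in> ?Q" for w q i ts u p i' ts' u'
    using st
  proof cases
    case (1 d acts out)
    have "tt_trans N (e q) (input_cell w i) (map (\<lambda>(t, p). t p) ts) = Some (e p, d, acts, out)"
      using 1 by (simp add: trN[OF q])
    then show ?thesis using closed[OF q] 1 tt_step.intros[of N "e q" w i ts] by blast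
  qed
  \<comment> \<open>Halting and the space bound speak about all steps of \<open>N\<close>, hence
    this converse simulation.\<close>
  have bwd: "\<exists>p. p \<in> ?Q \<and> x = e p \<and> tt_step M w (q, i, ts, u) (p, i', ts', u')"
    if st: "tt_step N w (e q, i, ts, u) (x, i', ts', u')" and q: "q \<in> ?Q" for w q i ts u x i' ts' u'
    using st
  proof cases
    case (1 d acts out)
    then obtain p where "tt_trans M q (input_cell w i) (map (\<lambda>(t, p). t p) ts) = Some (p, d, acts, out)"
      "x = e p" by (auto simp: trN[OF q])
    then show ?thesis using closed[OF q] 1 tt_step.intros[of M q w i ts] by blast
  qed
  have start: "tt_start N = (e (fst (tt_start M)), snd (tt_start M))"
    by (simp add: tt_start_def N_def)
  have fwds: "q \<in> ?Q \<and> (tt_step N w)\<^sup>*\<^sup>* (tt_start N) (e q, r)"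
    if "(tt_step M w)\<^sup>*\<^sup>* (tt_start M) (q, r)" for w q r
    using that
  proof (induction "(q, r)" arbitrary: q r rule: rtranclp_induct)
    case base
    then show ?case using start init by (auto simp: tt_start_def)
  next
    case (step y)
    obtain q' i' ts' u' where y: "y = (q', i', ts', u')" by (cases y)
    obtain i ts u where r: "r = (i, ts, u)" by (cases r)
    show ?case using step(3)[OF y] step(2) fwd unfolding y r
      by (meson rtranclp.rtrancl_into_rtrancl)
  qed
  have bwds: "\<exists>q \<in> ?Q. x = e q \<and> (tt_step M w)\<^sup>*\<^sup>* (tt_start M) (q, r)"
    if "(tt_step N w)\<^sup>*\<^sup>* (tt_start N) (x, r)" for w x r
    using that
  proof (induction "(x, r)" arbitrary: x r rule: rtranclp_induct)
    case base
    then show ?case using start init by (auto simp: tt_start_def)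
  next
    case (step y)
    obtain x' i' ts' u' where y: "y = (x', i', ts', u')" by (cases y)
    obtain i ts u where r: "r = (i, ts, u)" by (cases r)
    obtain q where q: "q \<in> ?Q" "x' = e q" "(tt_step M w)\<^sup>*\<^sup>* (tt_start M) (q, i', ts', u')"
      using step(3)[OF y] by blast
    obtain p where "p \<in> ?Q" "x = e p" "tt_step M w (q, i', ts', u') (p, i, ts, u)"
      using bwd[OF step(2)[unfolded y r q(2)] q(1)] by blast
    moreover from this(3) have "(tt_step M w)\<^sup>*\<^sup>* (tt_start M) (p, r)"
      using q(3) unfolding r by (rule rtranclp.rtrancl_into_rtrancl[rotated])
    ultimately show ?case by blast
  qed
  have "tt_computes N f"
    unfolding tt_computes_def
  proof
    fix w
    obtain q i ts where q: "(tt_step M w)\<^sup>*\<^sup>* (tt_start M) (q, i, ts, f w)"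
      "\<nexists>c. tt_step M w (q, i, ts, f w) c"
      using comp unfolding tt_computes_def by blast
    have "\<nexists>c. tt_step N w (e q, i, ts, f w) c"
      using bwd q(2) fwds[OF q(1)] by (metis prod_cases4)
    then show "\<exists>q i ts. (tt_step N w)\<^sup>*\<^sup>* (tt_start N) (q, i, ts, f w) \<and>
        (\<nexists>c. tt_step N w (q, i, ts, f w) c)"
      using fwds[OF q(1)] by blast
  qed
  moreover have "tt_space N s"
    using space bwds unfolding tt_space_def by blast
  ultimately show ?thesis
    unfolding logspace_computable_def using wfN bigo by blast
qed

section \<open>Runs of programs within a space bound\<close>

definition heads_below :: "nat \<Rightarrow> ((nat \<Rightarrow> nat) \<times> nat) list \<Rightarrow> bool" where
  "heads_below S ts \<longleftrightarrow> (\<forall>(t, p)\<in>set ts. p < S)"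

text \<open>Steps depend on the transition function \<open>ctrans\<close> alone, which all compiled
  machines share (\<open>tt_step_machine\<close>), so \<open>machine 0 Skip\<close> represents every
  one of them. The head bound is required at both ends of a step; a path thereby certifies its own
  space.\<close>

definition cstep :: "bool list \<Rightarrow> nat \<Rightarrow>
    (com list, nat, nat) tt_config \<Rightarrow> (com list, nat, nat) tt_config \<Rightarrow> bool" where
  "cstep w S a b \<longleftrightarrow> tt_step (machine 0 Skip) w a b \<and>
     heads_below S (fst (snd (snd a))) \<and> heads_below S (fst (snd (snd b)))"

text \<open>Quantifying over the continuation \<open>k\<close> makes the relation compositional: a
  run of \<open>c\<close> can be embedded in any larger program.\<close>

definition runs :: "bool list \<Rightarrow> nat \<Rightarrow> com \<Rightarrow>
    nat \<times> ((nat \<Rightarrow> nat) \<times> nat) list \<times> nat list \<Rightarrow>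
    nat \<times> ((nat \<Rightarrow> nat) \<times> nat) list \<times> nat list \<Rightarrow> bool" where
  "runs w S c x y \<longleftrightarrow> (\<forall>k. (cstep w S)\<^sup>*\<^sup>* (c # k, x) (k, y))"

abbreviation scan :: "((nat \<Rightarrow> nat) \<times> nat) list \<Rightarrow> nat list" where
  "scan ts \<equiv> map (\<lambda>(t, p). t p) ts"

lemma map2_idle [simp]: "map2 work_act ts (idle (scan ts)) = ts"
  by (induction ts) (auto simp: idle_def)

lemma map2_idle_update:
  "map2 work_act ts ((idle (scan ts))[r := a]) = (if r < length ts then ts[r := work_act (ts ! r) a] else ts)"
proof (cases "r < length ts")
  case True
  then have "map2 work_act ts ((idle (scan ts))[r := a]) =
      (map2 work_act ts (idle (scan ts)))[r := work_act (ts ! r) a]"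
    by (intro nth_equalityI) (auto simp: nth_list_update idle_def split: prod.splits)
  then show ?thesis using True by simp
qed (simp add: list_update_beyond)

lemma cstepI:
  assumes "ctrans q (input_cell w i) (scan ts) = Some (q', d, acts, out)"
    and "heads_below S ts" "heads_below S (map2 work_act ts acts)"
  shows "cstep w S (q, i, ts, u) (q', min (move_head d i) (length w + 1), map2 work_act ts acts,
    u @ (case out of None \<Rightarrow> [] | Some b \<Rightarrow> [b]))"
proof -
  have "tt_trans (machine 0 Skip) = ctrans" by (simp add: machine_def)
  then show ?thesis
    using assms tt_step.intros[of "machine 0 Skip" q w i ts q' d acts out u] unfolding cstep_def by simp
qed

lemma cstep_silent:
  assumes "ctrans q (input_cell w i) (scan ts) = Some (q', Stay, idle (scan ts), None)"
    and "heads_below S ts" "i \<le> length w + 1"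
  shows "cstep w S (q, i, ts, u) (q', i, ts, u)"
  using cstepI[OF assms(1,2)] assms(2,3) by simp

lemma runs_Skip: "heads_below S ts \<Longrightarrow> i \<le> length w + 1 \<Longrightarrow> runs w S Skip (i, ts, u) (i, ts, u)"
  unfolding runs_def by (auto intro!: r_into_rtranclp cstep_silent)

lemma runs_Input:
  assumes "heads_below S ts"
  shows "runs w S (Input d) (i, ts, u) (min (move_head d i) (length w + 1), ts, u)"
  unfolding runs_def
proof
  fix k
  show "(cstep w S)\<^sup>*\<^sup>* (Input d # k, i, ts, u) (k, min (move_head d i) (length w + 1), ts, u)"
    using cstepI[of "Input d # k" w i ts k d "idle (scan ts)" None S u] assms by auto
qed

lemma runs_Out:
  assumes "heads_below S ts" "i \<le> length w + 1"
  shows "runs w S (Out b) (i, ts, u) (i, ts, u @ [b])"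
  unfolding runs_def
proof
  fix k
  show "(cstep w S)\<^sup>*\<^sup>* (Out b # k, i, ts, u) (k, i, ts, u @ [b])"
    using cstepI[of "Out b # k" w i ts k Stay "idle (scan ts)" "Some b" S u] assms by auto
qed

lemma runs_Work:
  assumes "heads_below S ts" "i \<le> length w + 1" "r < length ts"
    and "ts ! r = (t, p)" "t' = (case g of None \<Rightarrow> t | Some g \<Rightarrow> t(p := code g))" "move_head d p < S"
  shows "runs w S (Work r g d) (i, ts, u) (i, ts[r := (t', move_head d p)], u)"
  unfolding runs_def
proof
  fix k
  let ?a = "(case g of None \<Rightarrow> scan ts ! r | Some g \<Rightarrow> code g, d)"
  have t: "work_act (ts ! r) ?a = (t', move_head d p)"
    using assms by (auto split: option.split)
  have "heads_below S (ts[r := (t', move_head d p)])"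
    using assms unfolding heads_below_def by (auto dest!: set_update_subset_insert[THEN subsetD])
  then show "(cstep w S)\<^sup>*\<^sup>* (Work r g d # k, i, ts, u) (k, i, ts[r := (t', move_head d p)], u)"
    using cstepI[of "Work r g d # k" w i ts k Stay "(idle (scan ts))[r := ?a]" None S u]
      assms(1-3) unfolding map2_idle_update t by auto
qed

lemma runs_Seq:
  assumes "runs w S a (i, ts, u) y" "runs w S b y z" "heads_below S ts" "i \<le> length w + 1"
  shows "runs w S (Seq a b) (i, ts, u) z"
  unfolding runs_def
proof
  fix k
  have "cstep w S (Seq a b # k, i, ts, u) (a # b # k, i, ts, u)"
    by (rule cstep_silent) (use assms in auto)
  moreover have "(cstep w S)\<^sup>*\<^sup>* (a # b # k, i, ts, u) (b # k, y)" "(cstep w S)\<^sup>*\<^sup>* (b # k, y) (k, z)"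
    using assms unfolding runs_def by auto
  ultimately show "(cstep w S)\<^sup>*\<^sup>* (Seq a b # k, i, ts, u) (k, z)"
    by (meson converse_rtranclp_into_rtranclp rtranclp_trans)
qed

lemma runs_Cond:
  assumes "runs w S (if t (input_cell w i) (scan ts) then a else b) (i, ts, u) z"
    "heads_below S ts" "i \<le> length w + 1"
  shows "runs w S (Cond t a b) (i, ts, u) z"
  unfolding runs_def
proof
  fix k
  let ?c = "if t (input_cell w i) (scan ts) then a else b"
  have "cstep w S (Cond t a b # k, i, ts, u) (?c # k, i, ts, u)"
    by (rule cstep_silent) (use assms in auto)
  moreover have "(cstep w S)\<^sup>*\<^sup>* (?c # k, i, ts, u) (k, z)"
    using assms unfolding runs_def by auto
  ultimately show "(cstep w S)\<^sup>*\<^sup>* (Cond t a b # k, i, ts, u) (k, z)"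
    by (meson converse_rtranclp_into_rtranclp)
qed

lemma runs_While_False:
  assumes "\<not> t (input_cell w i) (scan ts)" "heads_below S ts" "i \<le> length w + 1"
  shows "runs w S (While t a) (i, ts, u) (i, ts, u)"
  unfolding runs_def using assms by (auto intro!: r_into_rtranclp cstep_silent)

lemma runs_While_True:
  assumes "t (input_cell w i) (scan ts)" "runs w S a (i, ts, u) y" "runs w S (While t a) y z"
    "heads_below S ts" "i \<le> length w + 1"
  shows "runs w S (While t a) (i, ts, u) z"
  unfolding runs_def
proof
  fix k
  have "cstep w S (While t a # k, i, ts, u) (a # While t a # k, i, ts, u)"
    by (rule cstep_silent) (use assms in auto)
  moreover have "(cstep w S)\<^sup>*\<^sup>* (a # While t a # k, i, ts, u) (While t a # k, y)"
    "(cstep w S)\<^sup>*\<^sup>* (While t a # k, y) (k, z)"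
    using assms unfolding runs_def by auto
  ultimately show "(cstep w S)\<^sup>*\<^sup>* (While t a # k, i, ts, u) (k, z)"
    by (meson converse_rtranclp_into_rtranclp rtranclp_trans)
qed

lemma tt_step_machine: "tt_step (machine m c) w a b \<longleftrightarrow> tt_step (machine m' c') w a b"
  by (simp add: tt_step.simps machine_def)

text \<open>The machine is deterministic, so every reachable configuration lies on the one halting
  run that is exhibited; that run alone settles both the output and the space.\<close>

lemma logspace_program:
  assumes run: "\<And>w. \<exists>i ts. runs w (s (length w)) c (0, replicate m (\<lambda>_. 0, 0), []) (i, ts, f w)"
    and bigo: "(\<lambda>n. real (s n)) \<in> O(\<lambda>n. ln (real n))"
  shows "logspace_computable f"
proof (rule nat_transducer[OF wf_machine[where m = m and c = c]])
  let ?M = "machine m c"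
  have start: "tt_start ?M = ([c], 0, replicate m (\<lambda>_. 0, 0), [])"
    by (simp add: tt_start_def machine_def)
  show "p \<in> tt_states ?M" if "q \<in> tt_states ?M" "tt_trans ?M q x gs = Some (p, r)" for q x gs p r
    using that conts_closed[of q c "[]" x gs p r] by (cases "q = []") (auto simp: machine_def)
  have path: "\<exists>i ts. (cstep w (s (length w)))\<^sup>*\<^sup>* (tt_start ?M) ([], i, ts, f w)" for w
    using run[of w] unfolding runs_def start by blast
  have cst: "tt_step ?M w a b" if "cstep w S a b" for w S a b
    using that unfolding cstep_def using tt_step_machine by metis
  have stuck: "\<nexists>x. tt_step ?M w ([], r) x" for w r
    by (auto elim!: tt_step.cases simp: machine_def)
  show "tt_computes ?M f"
    unfolding tt_computes_def
  proof
    fix w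
    obtain i ts where "(cstep w (s (length w)))\<^sup>*\<^sup>* (tt_start ?M) ([], i, ts, f w)"
      using path by blast
    then have "(tt_step ?M w)\<^sup>*\<^sup>* (tt_start ?M) ([], i, ts, f w)"
      by (rule rtranclp_mono[THEN predicate2D, rotated]) (use cst in blast)
    then show "\<exists>q i ts. (tt_step ?M w)\<^sup>*\<^sup>* (tt_start ?M) (q, i, ts, f w) \<and>
        (\<nexists>x. tt_step ?M w (q, i, ts, f w) x)"
      using stuck by blast
  qed
  show "tt_space ?M s"
    unfolding tt_space_def
  proof (intro allI impI)
    fix w q i ts u
    assume reach: "(tt_step ?M w)\<^sup>*\<^sup>* (tt_start ?M) (q, i, ts, u)"
    let ?S = "s (length w)"
    obtain j ts' where "(cstep w ?S)\<^sup>*\<^sup>* (tt_start ?M) ([], j, ts', f w)"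
      using path by blast
    then have path: "(cstep w ?S)\<^sup>*\<^sup>* (tt_start ?M) ([], j, ts', f w)" .
    have "z = ([], j, ts', f w) \<or> heads_below ?S (fst (snd (snd z)))"
      if "(tt_step ?M w)\<^sup>*\<^sup>* (tt_start ?M) z" for z
      using path that
    proof (induction rule: converse_rtranclp_induct)
      case base
      then show ?case using stuck by (metis converse_rtranclpE)
    next
      case (step a b)
      from step(4) show ?case
      proof (cases rule: converse_rtranclpE)
        case base
        then show ?thesis using step(1) unfolding cstep_def by blast
      next
        case (step y)
        then have "y = b" using cst[OF \<open>cstep w ?S a b\<close>] tt_step_deterministic by blast
        then show ?thesis using step \<open>(tt_step ?M w)\<^sup>*\<^sup>* b z \<Longrightarrow> _\<close> by blast
      qed
    qed
    moreover have "heads_below ?S ts'"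
      using path
    proof (cases rule: rtranclp.cases)
      case (rtrancl_into_rtrancl b)
      then show ?thesis unfolding cstep_def by simp
    qed (simp add: start)
    ultimately have "heads_below ?S ts" using reach by fastforce
    then show "\<forall>(t, p)\<in>set ts. p < ?S" unfolding heads_below_def .
  qed
qed (fact bigo)

section \<open>Counters on work tapes\<close>

declare code.simps [simp del]

text \<open>Counters are stored in bijective base two (digits one and two, least significant digit
  first), so that zero is the empty word and can be recognised locally. Cell \<open>0\<close> holds a mark, and
  the head rests on cell \<open>1\<close>.\<close>

fun binc :: "bool list \<Rightarrow> bool list" where
  "binc [] = [False]"
| "binc (False # ds) = True # ds"
| "binc (True # ds) = False # binc ds"

lemma length_binc: "length ds \<le> length (binc ds)" "length (binc ds) \<le> Suc (length ds)"
  by (induction ds rule: binc.induct) auto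

definition digits :: "nat \<Rightarrow> bool list" where
  "digits n = (binc ^^ n) []"

definition tape :: "bool list \<Rightarrow> nat \<Rightarrow> nat" where
  "tape ds p = code (if p = 0 then Mark else if p \<le> length ds then (if ds ! (p - 1) then Two else One)
     else Blank)"

lemma tape_simps [simp]:
  "tape ds 0 = code Mark"
  "p > length ds \<Longrightarrow> tape ds p = code Blank"
  "tape (pre @ d # ds) (Suc (length pre)) = code (if d then Two else One)"
  "(tape (pre @ d # ds)) (Suc (length pre) := code One) = tape (pre @ False # ds)"
  "(tape (pre @ d # ds)) (Suc (length pre) := code Two) = tape (pre @ True # ds)"
  "(tape pre) (Suc (length pre) := code One) = tape (pre @ [False])"
  "(tape (pre @ [d])) (Suc (length pre) := code Blank) = tape pre"
  by (auto simp: tape_def fun_eq_iff nth_append nth_Cons')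

lemma tape_Mark_iff [simp]: "tape ds p = code Mark \<longleftrightarrow> p = 0"
  by (auto simp: tape_def)

lemma tape_Blank_iff [simp]: "tape ds p = code Blank \<longleftrightarrow> p > length ds"
  by (auto simp: tape_def)

definition under :: "nat \<Rightarrow> sym \<Rightarrow> test" where
  "under r g = (\<lambda>_ gs. gs ! r = code g)"

definition home :: "nat \<Rightarrow> com" where
  "home r = Seq (While (\<lambda>c gs. \<not> under r Mark c gs) (Work r None Go_Left)) (Work r None Go_Right)"

definition Inc :: "nat \<Rightarrow> com" where
  "Inc r = Seq (While (under r Two) (Work r (Some One) Go_Right))
     (Seq (Cond (under r One) (Work r (Some Two) Stay) (Work r (Some One) Stay)) (home r))"

text \<open>A borrow turns ones into twos as it passes. If it meets a blank, the most significant
  digit was a one and has to vanish; the sweep has already made it a two, so the head steps back and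
  blanks it.\<close>

definition Dec :: "nat \<Rightarrow> com" where
  "Dec r = Seq (While (under r One) (Work r (Some Two) Go_Right))
     (Seq (Cond (under r Blank) (Seq (Work r None Go_Left) (Work r (Some Blank) Stay))
        (Work r (Some One) Stay)) (home r))"

lemma heads_below_update: "heads_below S ts \<Longrightarrow> p < S \<Longrightarrow> heads_below S (ts[r := (t, p)])"
  unfolding heads_below_def by (auto dest!: set_update_subset_insert[THEN subsetD])

context
  fixes w :: "bool list" and S i r :: nat and ts :: "((nat \<Rightarrow> nat) \<times> nat) list" and u :: "nat list"
  assumes ts: "heads_below S ts" "r < length ts" and i: "i \<le> length w + 1"
begin

abbreviation "cfg t p \<equiv> (i, ts[r := (t, p)], u)"

lemma under_cfg [simp]: "under r g c (scan (ts[r := (t, p)])) \<longleftrightarrow> t p = code g"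
  using ts by (simp add: under_def)

lemma runs_Work_cfg:
  assumes "p < S" "t' = (case g of None \<Rightarrow> t | Some g \<Rightarrow> t(p := code g))" "p' = move_head d p" "p' < S"
  shows "runs w S (Work r g d) (cfg t p) (cfg t' p')"
  using runs_Work[where ts = "ts[r := (t, p)]" and r = r, OF heads_below_update i] assms ts by simp

lemma while_cfg:
  assumes "b (input_cell w i) (scan (ts[r := (t, p)]))" "p < S"
    and "runs w S a (cfg t p) (cfg t' p')" "runs w S (While b a) (cfg t' p') z"
  shows "runs w S (While b a) (cfg t p) z"
  using assms ts i by (intro runs_While_True[OF assms(1,3,4)] heads_below_update) auto

lemma while_false_cfg:
  "\<not> b (input_cell w i) (scan (ts[r := (t, p)])) \<Longrightarrow> p < S \<Longrightarrow> runs w S (While b a) (cfg t p) (cfg t p)"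
  using ts i by (intro runs_While_False heads_below_update) auto

lemma cond_cfg:
  assumes "p < S" "runs w S (if b (input_cell w i) (scan (ts[r := (t, p)])) then a else a') (cfg t p) z"
  shows "runs w S (Cond b a a') (cfg t p) z"
  using assms ts i by (intro runs_Cond heads_below_update) auto

lemma runs_home:
  assumes "p \<le> Suc (length ds)" "Suc (length ds) < S"
  shows "runs w S (home r) (cfg (tape ds) p) (cfg (tape ds) 1)"
proof -
  have "runs w S (While (\<lambda>c gs. \<not> under r Mark c gs) (Work r None Go_Left)) (cfg (tape ds) p) (cfg (tape ds) 0)"
    using assms
  proof (induction p)
    case 0
    then show ?case using ts i by (intro runs_While_False heads_below_update) auto
  next
    case (Suc p)
    have "runs w S (Work r None Go_Left) (cfg (tape ds) (Suc p)) (cfg (tape ds) p)"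
      using Suc.prems by (intro runs_Work_cfg) auto
    then show ?case
      using Suc by - (rule while_cfg[where t' = "tape ds" and p' = p], auto)
  qed
  moreover have "runs w S (Work r None Go_Right) (cfg (tape ds) 0) (cfg (tape ds) 1)"
    using assms by (intro runs_Work_cfg) auto
  ultimately show ?thesis
    unfolding home_def using ts i assms by (intro runs_Seq heads_below_update) auto
qed

text \<open>\<open>pre\<close> holds the digits that the carry has passed. The tape and position
  between the two commands are existential because the sweep stops at a different cell in each case
  of \<open>binc\<close>.\<close>

lemma runs_Inc_sweep:
  assumes "Suc (length pre + length ds) < S"
  shows "\<exists>t p. p \<le> Suc (length pre + length ds) \<and>
    runs w S (While (under r Two) (Work r (Some One) Go_Right))
      (cfg (tape (pre @ ds)) (Suc (length pre))) (cfg t p) \<and>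
    runs w S (Cond (under r One) (Work r (Some Two) Stay) (Work r (Some One) Stay))
      (cfg t p) (cfg (tape (pre @ binc ds)) p)"
  using assms
proof (induction ds arbitrary: pre rule: binc.induct)
  case 1
  then show ?case
    unfolding binc.simps append_Nil2 using ts i by (intro exI[of _ "tape pre"] exI[of _ "Suc (length pre)"] conjI while_false_cfg cond_cfg) (auto intro!: runs_Work_cfg)
next
  case (2 ds)
  then show ?case
    using ts i by (intro exI[of _ "tape (pre @ False # ds)"] exI[of _ "Suc (length pre)"] conjI while_false_cfg cond_cfg) (auto intro!: runs_Work_cfg)
next
  case (3 ds)
  have "runs w S (Work r (Some One) Go_Right) (cfg (tape (pre @ True # ds)) (Suc (length pre)))
    (cfg (tape (pre @ False # ds)) (Suc (Suc (length pre))))"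
    using 3 by (intro runs_Work_cfg) auto
  moreover obtain t p where "p \<le> Suc (Suc (length pre + length ds))"
    "runs w S (While (under r Two) (Work r (Some One) Go_Right))
      (cfg (tape (pre @ False # ds)) (Suc (Suc (length pre)))) (cfg t p)"
    "runs w S (Cond (under r One) (Work r (Some Two) Stay) (Work r (Some One) Stay))
      (cfg t p) (cfg (tape (pre @ False # binc ds)) p)"
    using "3.IH"[of "pre @ [False]"] "3.prems" by auto
  moreover from calculation(1,3) have "runs w S (While (under r Two) (Work r (Some One) Go_Right))
      (cfg (tape (pre @ True # ds)) (Suc (length pre))) (cfg t p)"
    by (rule while_cfg[rotated 2]) (use 3 in auto)
  ultimately show ?case
    by (intro exI[of _ t] exI[of _ p]) auto
qed

lemma runs_Dec_sweep:
  assumes "Suc (length pre + length (binc ds)) < S"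
  shows "\<exists>t p q. p < S \<and> q \<le> Suc (length pre + length ds) \<and>
    runs w S (While (under r One) (Work r (Some Two) Go_Right))
      (cfg (tape (pre @ binc ds)) (Suc (length pre))) (cfg t p) \<and>
    runs w S (Cond (under r Blank) (Seq (Work r None Go_Left) (Work r (Some Blank) Stay))
        (Work r (Some One) Stay))
      (cfg t p) (cfg (tape (pre @ ds)) q)"
  using assms
proof (induction ds arbitrary: pre rule: binc.induct)
  case 1
  let ?t = "tape (pre @ [True])" and ?p = "Suc (Suc (length pre))"
  have "runs w S (Work r (Some Two) Go_Right) (cfg (tape (pre @ [False])) (Suc (length pre))) (cfg ?t ?p)"
    using 1 by (intro runs_Work_cfg) auto
  then have "runs w S (While (under r One) (Work r (Some Two) Go_Right))
      (cfg (tape (pre @ [False])) (Suc (length pre))) (cfg ?t ?p)"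
    by (rule while_cfg[rotated 2]) (use ts i 1 in \<open>auto intro!: runs_While_False heads_below_update\<close>)
  moreover have "runs w S (Seq (Work r None Go_Left) (Work r (Some Blank) Stay))
      (cfg ?t ?p) (cfg (tape pre) (Suc (length pre)))"
    using ts i 1 by (intro runs_Seq[where y = "cfg ?t (Suc (length pre))"] heads_below_update)
      (auto intro!: runs_Work_cfg)
  ultimately show ?case
    using ts i 1 by (intro exI[of _ ?t] exI[of _ ?p] exI[of _ "Suc (length pre)"] conjI
        cond_cfg) auto
next
  case (2 ds)
  then show ?case
    unfolding binc.simps append_Nil2 using ts i by (intro exI[of _ "tape (pre @ True # ds)"] exI[of _ "Suc (length pre)"] conjI while_false_cfg cond_cfg) (auto intro!: runs_Work_cfg)
next
  case (3 ds)
  have "runs w S (Work r (Some Two) Go_Right) (cfg (tape (pre @ False # binc ds)) (Suc (length pre)))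
    (cfg (tape (pre @ True # binc ds)) (Suc (Suc (length pre))))"
    using 3 by (intro runs_Work_cfg) auto
  moreover obtain t p q where "p < S" "q \<le> Suc (Suc (length pre + length ds))"
    "runs w S (While (under r One) (Work r (Some Two) Go_Right))
      (cfg (tape (pre @ True # binc ds)) (Suc (Suc (length pre)))) (cfg t p)"
    "runs w S (Cond (under r Blank) (Seq (Work r None Go_Left) (Work r (Some Blank) Stay))
        (Work r (Some One) Stay))
      (cfg t p) (cfg (tape (pre @ True # ds)) q)"
    using "3.IH"[of "pre @ [True]"] "3.prems" by auto
  moreover from calculation(1,4) have "runs w S (While (under r One) (Work r (Some Two) Go_Right))
      (cfg (tape (pre @ False # binc ds)) (Suc (length pre))) (cfg t p)"
    by (rule while_cfg[rotated 2]) (use 3 in auto)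
  ultimately show ?case
    by (intro exI[of _ t] exI[of _ p] exI[of _ q]) auto
qed

lemma runs_Inc:
  assumes "Suc (length (binc ds)) < S"
  shows "runs w S (Inc r) (cfg (tape ds) 1) (cfg (tape (binc ds)) 1)"
proof -
  obtain t p where p: "p \<le> Suc (length ds)"
    "runs w S (While (under r Two) (Work r (Some One) Go_Right)) (cfg (tape ds) 1) (cfg t p)"
    "runs w S (Cond (under r One) (Work r (Some Two) Stay) (Work r (Some One) Stay))
      (cfg t p) (cfg (tape (binc ds)) p)"
    using runs_Inc_sweep[of "[]" ds] length_binc[of ds] assms by auto
  show ?thesis
    unfolding Inc_def
    by (intro runs_Seq[OF p(2)] runs_Seq[OF p(3)] runs_home heads_below_update)
      (use ts i p length_binc[of ds] assms in auto)
qed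

lemma runs_Dec:
  assumes "Suc (length (binc ds)) < S"
  shows "runs w S (Dec r) (cfg (tape (binc ds)) 1) (cfg (tape ds) 1)"
proof -
  obtain t p q where p: "p < S" "q \<le> Suc (length ds)"
    "runs w S (While (under r One) (Work r (Some Two) Go_Right)) (cfg (tape (binc ds)) 1) (cfg t p)"
    "runs w S (Cond (under r Blank) (Seq (Work r None Go_Left) (Work r (Some Blank) Stay))
        (Work r (Some One) Stay))
      (cfg t p) (cfg (tape ds) q)"
    using runs_Dec_sweep[of "[]" ds] assms by auto
  show ?thesis
    unfolding Dec_def
    by (intro runs_Seq[OF p(3)] runs_Seq[OF p(4)] runs_home heads_below_update)
      (use ts i p length_binc[of ds] assms in auto)
qed

end

section \<open>Tapes as registers holding numbers\<close>

lemma digits_simps [simp]: "digits 0 = []" "digits (Suc n) = binc (digits n)"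
  by (simp_all add: digits_def)

lemma digits_mono: "x \<le> y \<Longrightarrow> length (digits x) \<le> length (digits y)"
  by (rule lift_Suc_mono_le[of "\<lambda>n. length (digits n)"]) (auto intro: length_binc)

lemma digits_eq_Nil [simp]: "digits x = [] \<longleftrightarrow> x = 0"
proof (cases x)
  case (Suc n)
  then show ?thesis by (cases "digits n" rule: binc.cases) auto
qed simp

fun bival :: "bool list \<Rightarrow> nat" where
  "bival [] = 0"
| "bival (d # ds) = (if d then 2 else 1) + 2 * bival ds"

text \<open>All digits are at least one, so a word of length \<open>l\<close> has value at least
  \<open>2 ^ l - 1\<close>; counters therefore have logarithmic length.\<close>

lemma power_length_digits: "2 ^ length (digits x) \<le> Suc x"
proof -
  have "bival (binc ds) = Suc (bival ds)" for ds
    by (induction ds rule: binc.induct) auto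
  then have "bival (digits x) = x" by (induction x) auto
  moreover have "2 ^ length ds \<le> Suc (bival ds)" for ds
    by (induction ds) auto
  ultimately show ?thesis by metis
qed

definition rep :: "nat \<Rightarrow> (nat \<Rightarrow> nat) \<Rightarrow> ((nat \<Rightarrow> nat) \<times> nat) list" where
  "rep m s = map (\<lambda>r. (tape (digits (s r)), 1)) [0..<m]"

lemma length_rep [simp]: "length (rep m s) = m"
  by (simp add: rep_def)

lemma rep_update: "r < m \<Longrightarrow> rep m (s(r := x)) = (rep m s)[r := (tape (digits x), 1)]"
  by (intro nth_equalityI) (auto simp: rep_def nth_list_update)

lemma heads_below_rep: "1 < S \<Longrightarrow> heads_below S (rep m s)"
  by (auto simp: heads_below_def rep_def)

text \<open>Besides the digits: the mark in cell \<open>0\<close> and the blank at which a sweep may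
  end, with one cell to spare.\<close>

definition spc :: "nat \<Rightarrow> nat" where
  "spc B = length (digits B) + 3"

type_synonym cstate = "(nat \<Rightarrow> nat) \<times> nat \<times> nat list"

text \<open>The invariant on the input head is built into the relation and the space is hidden in
  \<open>B\<close>. From here on programs act on registers, and the only trace of space is the side
  condition that the counters involved are at most \<open>B\<close>.\<close>

fun exec :: "nat \<Rightarrow> bool list \<Rightarrow> nat \<Rightarrow> com \<Rightarrow> cstate \<Rightarrow> cstate \<Rightarrow> bool" where
  "exec m w B c (s, i, u) (s', i', u') \<longleftrightarrow>
     (i \<le> length w + 1 \<longrightarrow> i' \<le> length w + 1 \<and> runs w (spc B) c (i, rep m s, u) (i', rep m s', u'))"

lemma rep_spc: "heads_below (spc B) (rep m s)"
  by (simp add: heads_below_rep spc_def)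

lemma exec_Skip: "exec m w B Skip x x"
  by (cases x) (auto intro!: runs_Skip rep_spc)

lemma exec_Input: "exec m w B (Input d) (s, i, u) (s, min (move_head d i) (length w + 1), u)"
  using runs_Input[OF rep_spc] by simp

lemma exec_Out: "exec m w B (Out b) (s, i, u) (s, i, u @ [b])"
  using runs_Out[OF rep_spc] by simp

lemma exec_Seq: "exec m w B a x y \<Longrightarrow> exec m w B b y z \<Longrightarrow> exec m w B (Seq a b) x z"
  by (cases x; cases y; cases z) (auto intro!: runs_Seq rep_spc)

lemma exec_Inc:
  assumes "r < m" "Suc (s r) \<le> B"
  shows "exec m w B (Inc r) (s, i, u) (s(r := Suc (s r)), i, u)"
proof -
  have "Suc (length (binc (digits (s r)))) < spc B"
    using digits_mono[OF assms(2)] by (simp add: spc_def)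
  from runs_Inc[OF rep_spc _ _ this, of r m s i w u] show ?thesis
    using assms rep_update[of r m s "s r"] rep_update[of r m s "Suc (s r)"] by simp
qed

lemma exec_Dec:
  assumes "r < m" "s r = Suc x" "s r \<le> B"
  shows "exec m w B (Dec r) (s, i, u) (s(r := x), i, u)"
proof -
  have "Suc (length (binc (digits x))) < spc B"
    using digits_mono[OF assms(3)] assms(2) by (simp add: spc_def)
  from runs_Dec[OF rep_spc _ _ this, of r m s i w u] show ?thesis
    using rep_update[OF assms(1), of s "Suc x"] rep_update[OF assms(1), of s x] assms(1)
    by (simp add: fun_upd_idem[of s r "Suc x", OF assms(2)])
qed

definition nz :: "nat \<Rightarrow> test" where
  "nz r = (\<lambda>_ gs. gs ! r \<noteq> code Blank)"

definition reads :: "(bool cell \<Rightarrow> bool) \<Rightarrow> test" where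
  "reads P = (\<lambda>c _. P c)"

lemma nz_rep [simp]: "r < m \<Longrightarrow> nz r c (scan (rep m s)) \<longleftrightarrow> s r \<noteq> 0"
  unfolding nz_def by (simp add: rep_def Suc_le_eq del: code.simps)

lemma exec_Cond_nz:
  assumes "r < m" "exec m w B (if s r \<noteq> 0 then a else b) (s, i, u) y"
  shows "exec m w B (Cond (nz r) a b) (s, i, u) y"
  using assms by (cases y) (auto intro!: runs_Cond rep_spc)

lemma exec_Cond_reads:
  assumes "exec m w B (if P (input_cell w i) then a else b) (s, i, u) y"
  shows "exec m w B (Cond (reads P) a b) (s, i, u) y"
  using assms by (cases y) (auto intro!: runs_Cond rep_spc simp: reads_def)

lemma exec_While_reads_False:
  "\<not> P (input_cell w i) \<Longrightarrow> exec m w B (While (reads P) a) (s, i, u) (s, i, u)"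
  by (auto intro!: runs_While_False rep_spc simp: reads_def)

lemma exec_While_reads_True:
  "P (input_cell w i) \<Longrightarrow> exec m w B a (s, i, u) y \<Longrightarrow> exec m w B (While (reads P) a) y z \<Longrightarrow>
   exec m w B (While (reads P) a) (s, i, u) z"
  by (cases y; cases z) (auto intro!: runs_While_True rep_spc simp: reads_def)

definition loop :: "nat \<Rightarrow> com \<Rightarrow> com" where
  "loop r c = While (nz r) (Seq (Dec r) c)"

lemma exec_loop_0: "r < m \<Longrightarrow> s r = 0 \<Longrightarrow> exec m w B (loop r c) (s, i, u) (s, i, u)"
  unfolding loop_def by (auto intro!: runs_While_False rep_spc)

lemma exec_loop_Suc:
  assumes "r < m" "s r = Suc x" "s r \<le> B" "exec m w B c (s(r := x), i, u) y" "exec m w B (loop r c) y z"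
  shows "exec m w B (loop r c) (s, i, u) z"
proof -
  have "exec m w B (Seq (Dec r) c) (s, i, u) y"
    using assms by (intro exec_Seq[OF exec_Dec])
  then show ?thesis
    using assms unfolding loop_def by (cases y; cases z) (auto intro!: runs_While_True rep_spc)
qed

declare exec.simps [simp del]

text \<open>Invariant rule: \<open>f j\<close>, \<open>p j\<close> and \<open>g j\<close> are store,
  input head and output after \<open>j\<close> rounds. Since \<open>loop\<close> decrements before
  it runs the body, round \<open>j\<close> finds \<open>x - Suc j\<close> in \<open>r\<close>;
  whatever \<open>f\<close> says about \<open>r\<close> is overridden.\<close>

lemma exec_loop:
  assumes r: "r < m" and x: "x \<le> B"
    and step: "\<And>j. j < x \<Longrightarrow> exec m w B c ((f j)(r := x - Suc j), p j, g j)
      ((f (Suc j))(r := x - Suc j), p (Suc j), g (Suc j))"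
  shows "exec m w B (loop r c) ((f 0)(r := x), p 0, g 0) ((f x)(r := 0), p x, g x)"
proof -
  \<comment> \<open>Induction on the number \<open>j\<close> of rounds still to come.\<close>
  have "exec m w B (loop r c) ((f (x - j))(r := j), p (x - j), g (x - j)) ((f x)(r := 0), p x, g x)"
    if "j \<le> x" for j
    using that
  proof (induction j)
    case 0
    have "exec m w B (loop r c) ((f x)(r := 0), p x, g x) ((f x)(r := 0), p x, g x)"
      by (rule exec_loop_0) (use r in auto)
    then show ?case by (simp only: diff_zero)
  next
    case (Suc j)
    then have "Suc (x - Suc j) = x - j" "x - Suc (x - Suc j) = j" "x - Suc j < x" by auto
    then have body: "exec m w B c (((f (x - Suc j))(r := Suc j))(r := j), p (x - Suc j), g (x - Suc j))
        ((f (x - j))(r := j), p (x - j), g (x - j))"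
      using step[of "x - Suc j"] by (simp only: fun_upd_upd)
    have "exec m w B (loop r c) ((f (x - j))(r := j), p (x - j), g (x - j)) ((f x)(r := 0), p x, g x)"
      using Suc by (simp only: Suc_leD)
    from exec_loop_Suc[OF r _ _ body this]
    have "exec m w B (loop r c) ((f (x - Suc j))(r := Suc j), p (x - Suc j), g (x - Suc j))
        ((f x)(r := 0), p x, g x)"
      using Suc.prems x by simp
    then show ?case .
  qed
  from this[of x] show ?thesis by simp
qed

section \<open>A language of logspace functions\<close>

lemma exec_state: "exec m w B c x (s, i, u) \<Longrightarrow> s = s' \<Longrightarrow> exec m w B c x (s', i, u)"
  by simp

definition move :: "nat \<Rightarrow> nat \<Rightarrow> com" where
  "move b a = loop b (Inc a)"

lemma exec_move:
  assumes "a < m" "b < m" "a \<noteq> b" "s a + s b \<le> B"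
  shows "exec m w B (move b a) (s, i, u) (s(a := s a + s b, b := 0), i, u)"
proof -
  have "exec m w B (Inc a) ((s(a := s a + j))(b := s b - Suc j), i, u)
      ((s(a := s a + Suc j))(b := s b - Suc j), i, u)" if "j < s b" for j
    by (rule exec_state, rule exec_Inc) (use assms that in auto)
  from exec_loop[where f = "\<lambda>j. s(a := s a + j)" and x = "s b" and p = "\<lambda>_. i" and g = "\<lambda>_. u", OF assms(2) _ this]
  show ?thesis using assms unfolding move_def by (simp add: fun_upd_idem)
qed

definition clear :: "nat \<Rightarrow> com" where
  "clear a = loop a Skip"

lemma exec_clear:
  assumes "a < m" "s a \<le> B"
  shows "exec m w B (clear a) (s, i, u) (s(a := 0), i, u)"
  using exec_loop[where f = "\<lambda>j. s" and r = a and x = "s a" and p = "\<lambda>_. i" and g = "\<lambda>_. u" and c = Skip] assms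
  unfolding clear_def by (simp add: exec_Skip)

text \<open>A loop consumes its counter; \<open>t\<close> collects a second copy from which
  \<open>x\<close> is restored.\<close>

definition addcopy :: "nat \<Rightarrow> nat \<Rightarrow> nat \<Rightarrow> com" where
  "addcopy x a t = Seq (loop x (Seq (Inc a) (Inc t))) (move t x)"

lemma exec_addcopy:
  assumes "x < m" "a < m" "t < m" "x \<noteq> a" "x \<noteq> t" "a \<noteq> t" "s t = 0" "s a + s x \<le> B"
  shows "exec m w B (addcopy x a t) (s, i, u) (s(a := s a + s x), i, u)"
proof -
  let ?f = "\<lambda>j. s(a := s a + j, t := j)"
  have "exec m w B (Seq (Inc a) (Inc t)) ((?f j)(x := s x - Suc j), i, u)
      ((?f (Suc j))(x := s x - Suc j), i, u)" if "j < s x" for j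
    by (rule exec_Seq[OF exec_Inc exec_state[OF exec_Inc]]) (use assms that in auto)
  from exec_loop[where f = ?f and x = "s x" and p = "\<lambda>_. i" and g = "\<lambda>_. u", OF assms(1) _ this]
  have "exec m w B (loop x (Seq (Inc a) (Inc t))) (s, i, u) ((?f (s x))(x := 0), i, u)"
    using assms by (simp add: fun_upd_idem)
  then show ?thesis
    unfolding addcopy_def
    by (rule exec_Seq) (rule exec_state, rule exec_move, use assms in auto)
qed

section \<open>Arithmetic on registers\<close>

datatype binop = Plus | Minus | Times | Min

fun appop :: "binop \<Rightarrow> nat \<Rightarrow> nat \<Rightarrow> nat" where
  "appop Plus a b = a + b"
| "appop Minus a b = a - b"
| "appop Times a b = a * b"
| "appop Min a b = min a b"

text \<open>Registers from \<open>v\<close> upwards serve as an evaluation stack: operands in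
  \<open>v\<close> and \<open>v + 1\<close>, scratch in the two registers above, the result in
  \<open>v\<close>, and everything used above \<open>v\<close> zero again at the end.\<close>

fun opcom :: "binop \<Rightarrow> nat \<Rightarrow> com" where
  "opcom Plus v = move (v + 1) v"
| "opcom Minus v = loop (v + 1) (Cond (nz v) (Dec v) Skip)"
| "opcom Times v = Seq (move v (v + 2)) (Seq (loop (v + 2) (addcopy (v + 1) v (v + 3))) (clear (v + 1)))"
| "opcom Min v = Seq (move v (v + 2))
     (Seq (loop (v + 2) (Cond (nz (v + 1)) (Seq (Dec (v + 1)) (Inc v)) Skip)) (clear (v + 1)))"

lemma exec_opcom:
  assumes "v + 3 < m" "s (v + 2) = 0" "s (v + 3) = 0" "s v \<le> B" "s (v + 1) \<le> B"
    "appop f (s v) (s (v + 1)) \<le> B"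
  shows "exec m w B (opcom f v) (s, i, u) (s(v := appop f (s v) (s (v + 1)), v + 1 := 0), i, u)"
proof (cases f)
  case Plus
  then show ?thesis using assms exec_move[of v m "v + 1" s B w i u] by simp
next
  case Minus
  let ?f = "\<lambda>j. s(v := s v - j)"
  let ?c = "Cond (nz v) (Dec v) Skip"
  have "exec m w B ?c ((?f j)(v + 1 := s (v + 1) - Suc j), i, u)
      ((?f (Suc j))(v + 1 := s (v + 1) - Suc j), i, u)" if "j < s (v + 1)" for j
  proof (rule exec_Cond_nz)
    show "exec m w B (if ((?f j)(v + 1 := s (v + 1) - Suc j)) v \<noteq> 0 then Dec v else Skip)
      ((?f j)(v + 1 := s (v + 1) - Suc j), i, u) ((?f (Suc j))(v + 1 := s (v + 1) - Suc j), i, u)"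
    proof (cases "s v - j")
      case 0
      then show ?thesis using exec_Skip[of m w B] by (simp add: diff_Suc)
    next
      case (Suc x)
      have "exec m w B (Dec v) ((?f j)(v + 1 := s (v + 1) - Suc j), i, u)
          ((?f (Suc j))(v + 1 := s (v + 1) - Suc j), i, u)"
        by (rule exec_state, rule exec_Dec[of _ _ _ x]) (use assms Suc in \<open>auto simp: fun_eq_iff\<close>)
      then show ?thesis using Suc by simp
    qed
  qed (use assms in simp)
  from exec_loop[where f = ?f and x = "s (v + 1)" and p = "\<lambda>_. i" and g = "\<lambda>_. u", OF _ _ this]
  show ?thesis using assms Minus by (simp add: fun_upd_idem)
next
  case Times
  let ?x = "s v" and ?y = "s (v + 1)"
  let ?f = "\<lambda>j. s(v := j * ?y)"
  have b: "?x * ?y \<le> B" using assms Times by simp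
  have step: "exec m w B (addcopy (v + 1) v (v + 3)) ((?f j)(v + 2 := ?x - Suc j), i, u)
      ((?f (Suc j))(v + 2 := ?x - Suc j), i, u)" if "j < ?x" for j
  proof -
    have "j * ?y + ?y \<le> B"
      using mult_le_mono1[of "Suc j" ?x ?y] that b by simp
    then show ?thesis
      by (intro exec_state[OF exec_addcopy]) (use assms in auto)
  qed
  have "exec m w B (move v (v + 2)) (s, i, u) ((?f 0)(v + 2 := ?x), i, u)"
    by (rule exec_state, rule exec_move) (use assms in \<open>auto simp: fun_eq_iff\<close>)
  moreover have "exec m w B (loop (v + 2) (addcopy (v + 1) v (v + 3))) ((?f 0)(v + 2 := ?x), i, u)
      ((?f ?x)(v + 2 := 0), i, u)"
    using assms by (intro exec_loop[where f = ?f and p = "\<lambda>_. i" and g = "\<lambda>_. u"] step) auto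
  moreover have "exec m w B (clear (v + 1)) ((?f ?x)(v + 2 := 0), i, u) (s(v := ?x * ?y, v + 1 := 0), i, u)"
    by (rule exec_state, rule exec_clear) (use assms in \<open>auto simp: fun_eq_iff\<close>)
  ultimately show ?thesis using Times by (auto intro: exec_Seq)
next
  case Min
  let ?x = "s v" and ?y = "s (v + 1)"
  let ?f = "\<lambda>j. s(v := min j ?y, v + 1 := ?y - j)"
  let ?c = "Cond (nz (v + 1)) (Seq (Dec (v + 1)) (Inc v)) Skip"
  have step: "exec m w B ?c ((?f j)(v + 2 := ?x - Suc j), i, u)
      ((?f (Suc j))(v + 2 := ?x - Suc j), i, u)" if "j < ?x" for j
  proof (rule exec_Cond_nz)
    show "exec m w B (if ((?f j)(v + 2 := ?x - Suc j)) (v + 1) \<noteq> 0 then Seq (Dec (v + 1)) (Inc v) else Skip)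
      ((?f j)(v + 2 := ?x - Suc j), i, u) ((?f (Suc j))(v + 2 := ?x - Suc j), i, u)"
    proof (cases "?y - j")
      case 0
      then show ?thesis using exec_Skip[of m w B] by (simp add: diff_Suc min_def)
    next
      case (Suc z)
      have "exec m w B (Seq (Dec (v + 1)) (Inc v)) ((?f j)(v + 2 := ?x - Suc j), i, u)
          ((?f (Suc j))(v + 2 := ?x - Suc j), i, u)"
        by (rule exec_Seq[OF exec_Dec[of _ _ _ z] exec_state[OF exec_Inc]])
          (use assms Suc that in \<open>auto simp: fun_eq_iff\<close>)
      then show ?thesis using Suc by simp
    qed
  qed (use assms in simp)
  have "exec m w B (move v (v + 2)) (s, i, u) ((?f 0)(v + 2 := ?x), i, u)"
    by (rule exec_state, rule exec_move) (use assms in \<open>auto simp: fun_eq_iff\<close>)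
  moreover have "exec m w B (loop (v + 2) ?c) ((?f 0)(v + 2 := ?x), i, u)
      ((?f ?x)(v + 2 := 0), i, u)"
    using assms by (intro exec_loop[where f = ?f and p = "\<lambda>_. i" and g = "\<lambda>_. u"] step) auto
  moreover have "exec m w B (clear (v + 1)) ((?f ?x)(v + 2 := 0), i, u) (s(v := min ?x ?y, v + 1 := 0), i, u)"
    by (rule exec_state, rule exec_clear) (use assms in \<open>auto simp: fun_eq_iff\<close>)
  ultimately show ?thesis using Min by (auto intro: exec_Seq)
qed

fun incs :: "nat \<Rightarrow> nat \<Rightarrow> com" where
  "incs 0 r = Skip"
| "incs (Suc n) r = Seq (incs n r) (Inc r)"

lemma exec_incs:
  assumes "r < m" "s r + n \<le> B"
  shows "exec m w B (incs n r) (s, i, u) (s(r := s r + n), i, u)"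
  using assms(2)
proof (induction n)
  case 0
  then show ?case using exec_Skip by simp
next
  case (Suc n)
  have inc: "exec m w B (Inc r) (s(r := s r + n), i, u) (s(r := s r + Suc n), i, u)"
    by (rule exec_state, rule exec_Inc) (use assms(1) Suc.prems in auto)
  have "s r + n \<le> B" using Suc.prems by simp
  then show ?case unfolding incs.simps by (rule exec_Seq[OF Suc.IH inc])
qed

section \<open>Access to the input word\<close>

definition rewind :: com where
  "rewind = While (reads (\<lambda>c. c \<noteq> Left_End)) (Input Go_Left)"

lemma exec_rewind: "i \<le> length w + 1 \<Longrightarrow> exec m w B rewind (s, i, u) (s, 0, u)"
proof (induction i)
  case 0
  show ?case unfolding rewind_def by (rule exec_While_reads_False) (simp add: input_cell_def)
next
  case (Suc i)
  have "exec m w B (Input Go_Left) (s, Suc i, u) (s, i, u)"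
    using exec_Input[of m w B Go_Left s "Suc i" u] Suc.prems by (simp add: min_def)
  then show ?case
    using Suc unfolding rewind_def by - (rule exec_While_reads_True, auto simp: input_cell_def)
qed

definition readbit :: "nat \<Rightarrow> com" where
  "readbit r = Seq (Input Go_Right) (Seq (loop r (Input Go_Right))
     (Seq (Cond (reads (\<lambda>c. c = Letter True)) (Inc r) Skip) rewind))"

definition bitval :: "bool list \<Rightarrow> nat \<Rightarrow> nat" where
  "bitval w n = (if n < length w \<and> w ! n then 1 else 0)"

text \<open>The first move makes position \<open>0\<close> the first letter. A position that is too
  large ends at the right end-marker, where the head stays; this matches the default
  \<open>0\<close> of \<open>bitval\<close>.\<close>

lemma exec_readbit:
  assumes "r < m" "s r \<le> B" "1 \<le> B"
  shows "exec m w B (readbit r) (s, 0, u) (s(r := bitval w (s r)), 0, u)"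
proof -
  let ?p = "\<lambda>j. min (Suc j) (length w + 1)"
  have "exec m w B (Input Go_Right) (s, 0, u) (s(r := s r), ?p 0, u)"
    using exec_Input[of m w B Go_Right s 0 u] by simp
  moreover have "exec m w B (loop r (Input Go_Right)) (s(r := s r), ?p 0, u) (s(r := 0), ?p (s r), u)"
  proof (rule exec_loop[where p = ?p and f = "\<lambda>_. s" and g = "\<lambda>_. u"])
    fix j
    show "exec m w B (Input Go_Right) (s(r := s r - Suc j), ?p j, u) (s(r := s r - Suc j), ?p (Suc j), u)"
    proof -
      have "min (move_head Go_Right (?p j)) (length w + 1) = ?p (Suc j)" by auto
      then show ?thesis
        using exec_Input[of m w B Go_Right "s(r := s r - Suc j)" "?p j" u] by (simp only:)
    qed
  qed (use assms in auto)
  moreover have "exec m w B (Cond (reads (\<lambda>c. c = Letter True)) (Inc r) Skip) (s(r := 0), ?p (s r), u)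
      (s(r := bitval w (s r)), ?p (s r), u)"
  proof (rule exec_Cond_reads)
    have cell: "input_cell w (?p (s r)) = Letter True \<longleftrightarrow> bitval w (s r) = 1"
      by (auto simp: input_cell_def bitval_def)
    show "exec m w B (if input_cell w (?p (s r)) = Letter True then Inc r else Skip) (s(r := 0), ?p (s r), u)
      (s(r := bitval w (s r)), ?p (s r), u)"
    proof (cases "bitval w (s r) = 1")
      case True
      then show ?thesis unfolding cell
        using exec_Inc[of r m "s(r := 0)" B w "?p (s r)" u] assms by simp
    next
      case False
      then have "bitval w (s r) = 0" by (auto simp: bitval_def split: if_splits)
      then show ?thesis unfolding cell using exec_Skip by simp
    qed
  qed
  moreover have "exec m w B rewind (s(r := bitval w (s r)), ?p (s r), u) (s(r := bitval w (s r)), 0, u)"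
    by (rule exec_rewind) simp
  ultimately show ?thesis unfolding readbit_def by (auto intro: exec_Seq)
qed

text \<open>The prefix \<open>pre\<close> is stored in the program rather than on the tape. It will
  be the encoding of a fixed degree, placed in front of the actual input.\<close>

fun readbit_pre :: "bool list \<Rightarrow> nat \<Rightarrow> com" where
  "readbit_pre [] r = readbit r"
| "readbit_pre (b # pre) r = Cond (nz r) (Seq (Dec r) (readbit_pre pre r)) (if b then Inc r else Skip)"

lemma exec_readbit_pre:
  assumes "r < m" "s r \<le> B" "1 \<le> B"
  shows "exec m w B (readbit_pre pre r) (s, 0, u) (s(r := bitval (pre @ w) (s r)), 0, u)"
  using assms(2)
proof (induction pre arbitrary: s)
  case Nil
  then show ?case using exec_readbit[of r m s B w u, OF assms(1) Nil assms(3)] by (simp only: readbit_pre.simps append_Nil)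
next
  case (Cons b pre)
  show ?case
  proof (cases "s r")
    case 0
    then have "bitval ((b # pre) @ w) (s r) = (if b then 1 else 0)"
      by (simp add: bitval_def)
    moreover have "exec m w B (if b then Inc r else Skip) (s, 0, u) (s(r := if b then 1 else 0), 0, u)"
      using exec_Inc[of r m s B w 0 u] exec_Skip[of m w B "(s, 0, u)"] 0 assms by (auto simp: fun_upd_idem)
    ultimately have "exec m w B (Cond (nz r) (Seq (Dec r) (readbit_pre pre r)) (if b then Inc r else Skip))
        (s, 0, u) (s(r := bitval ((b # pre) @ w) (s r)), 0, u)"
      using 0 assms(1) by (intro exec_Cond_nz) simp_all
    then show ?thesis by (simp only: readbit_pre.simps)
  next
    case (Suc x)
    then have "bitval ((b # pre) @ w) (s r) = bitval (pre @ w) x"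
      by (simp add: bitval_def)
    moreover have "exec m w B (Seq (Dec r) (readbit_pre pre r)) (s, 0, u) (s(r := bitval (pre @ w) x), 0, u)"
    proof (rule exec_Seq)
      show "exec m w B (Dec r) (s, 0, u) (s(r := x), 0, u)"
        by (rule exec_Dec[of r m s x B w 0 u, OF assms(1) Suc Cons.prems])
      show "exec m w B (readbit_pre pre r) (s(r := x), 0, u) (s(r := bitval (pre @ w) x), 0, u)"
        by (rule exec_state, rule Cons.IH) (use Cons.prems Suc in auto)
    qed
    ultimately have "exec m w B (Cond (nz r) (Seq (Dec r) (readbit_pre pre r)) (if b then Inc r else Skip))
        (s, 0, u) (s(r := bitval ((b # pre) @ w) (s r)), 0, u)"
      using Suc assms(1) by (intro exec_Cond_nz) simp_all
    then show ?thesis by (simp only: readbit_pre.simps)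
  qed
qed

definition readlen :: "nat \<Rightarrow> com" where
  "readlen r = Seq (Input Go_Right)
     (Seq (While (reads (\<lambda>c. c \<noteq> Right_End)) (Seq (Inc r) (Input Go_Right))) rewind)"

lemma exec_readlen:
  assumes "r < m" "s r + length w \<le> B"
  shows "exec m w B (readlen r) (s, 0, u) (s(r := s r + length w), 0, u)"
proof -
  let ?c = "While (reads (\<lambda>c. c \<noteq> Right_End)) (Seq (Inc r) (Input Go_Right))"
  have loop: "exec m w B ?c (s(r := s r + (length w - j)), Suc (length w - j), u)
      (s(r := s r + length w), Suc (length w), u)" if "j \<le> length w" for j
    using that
  proof (induction j)
    case 0
    show ?case using exec_While_reads_False[of "\<lambda>c. c \<noteq> Right_End" w "Suc (length w)"]
      by (simp add: input_cell_def)
  next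
    case (Suc j)
    let ?k = "length w - Suc j"
    have k: "length w - j = Suc ?k" "?k < length w" using Suc.prems by auto
    have "exec m w B (Inc r) (s(r := s r + ?k), Suc ?k, u) (s(r := s r + Suc ?k), Suc ?k, u)"
      by (rule exec_state, rule exec_Inc) (use assms k in auto)
    moreover have "exec m w B (Input Go_Right) (s(r := s r + Suc ?k), Suc ?k, u)
        (s(r := s r + Suc ?k), Suc (Suc ?k), u)"
      using exec_Input[of m w B Go_Right "s(r := s r + Suc ?k)" "Suc ?k" u] k by simp
    ultimately have "exec m w B (Seq (Inc r) (Input Go_Right)) (s(r := s r + ?k), Suc ?k, u)
        (s(r := s r + Suc ?k), Suc (Suc ?k), u)"
      by (rule exec_Seq)
    moreover have "exec m w B ?c (s(r := s r + Suc ?k), Suc (Suc ?k), u)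
        (s(r := s r + length w), Suc (length w), u)"
      using Suc.IH[OF Suc_leD[OF Suc.prems]] unfolding k .
    ultimately show ?case
      by (rule exec_While_reads_True[rotated]) (use k in \<open>simp add: input_cell_def\<close>)
  qed
  have "exec m w B (Input Go_Right) (s, 0, u) (s, 1, u)"
    using exec_Input[of m w B Go_Right s 0 u] by simp
  moreover have "exec m w B ?c (s, 1, u) (s(r := s r + length w), Suc (length w), u)"
    using loop[of "length w"] by simp
  moreover have "exec m w B rewind (s(r := s r + length w), Suc (length w), u) (s(r := s r + length w), 0, u)"
    by (rule exec_rewind) simp
  ultimately show ?thesis unfolding readlen_def by (auto intro: exec_Seq)
qed

section \<open>Expressions with saturating iteration\<close>

datatype exp =
    Const nat
  | Var nat
  | Len
  | Bit exp
  | Bin binop exp exp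
  | Iter nat nat exp exp exp

fun iterate :: "nat \<Rightarrow> (nat \<Rightarrow> nat \<Rightarrow> nat) \<Rightarrow> nat \<Rightarrow> nat" where
  "iterate 0 f a = a"
| "iterate (Suc n) f a = f n (iterate n f a)"

text \<open>\<open>Iter x y c i b\<close> iterates \<open>b\<close> with counter \<open>x\<close> and accumulator \<open>y\<close>. The accumulator saturates
  beyond the input length, so the values of every fixed expression are polynomially bounded.\<close>

primrec eval :: "exp \<Rightarrow> bool list \<Rightarrow> (nat \<Rightarrow> nat) \<Rightarrow> nat" where
  "eval (Const n) w s = n"
| "eval (Var x) w s = s x"
| "eval Len w s = length w"
| "eval (Bit e) w s = bitval w (eval e w s)"
| "eval (Bin f a b) w s = appop f (eval a w s) (eval b w s)"
| "eval (Iter x y c i b) w s =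
     iterate (eval c w s) (\<lambda>t a. min (eval b w (s(x := t, y := a))) (Suc (length w))) (eval i w s)"

primrec binders :: "exp \<Rightarrow> nat set" where
  "binders (Const n) = {}"
| "binders (Var x) = {}"
| "binders Len = {}"
| "binders (Bit e) = binders e"
| "binders (Bin f a b) = binders a \<union> binders b"
| "binders (Iter x y c i b) = {x, y} \<union> binders c \<union> binders i \<union> binders b"

text \<open>Variables live in registers below \<open>v\<close>, temporaries from \<open>v\<close>
  on. A loop variable must not be bound again in the body, where its register is in use. Disjoint
  loops may share variables because every loop leaves its own at zero.\<close>

primrec wf_exp :: "nat \<Rightarrow> exp \<Rightarrow> bool" where
  "wf_exp v (Const n) \<longleftrightarrow> True"
| "wf_exp v (Var x) \<longleftrightarrow> x < v"
| "wf_exp v Len \<longleftrightarrow> True"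
| "wf_exp v (Bit e) \<longleftrightarrow> wf_exp v e"
| "wf_exp v (Bin f a b) \<longleftrightarrow> wf_exp v a \<and> wf_exp v b"
| "wf_exp v (Iter x y c i b) \<longleftrightarrow> x < v \<and> y < v \<and> x \<noteq> y \<and> x \<notin> binders b \<and> y \<notin> binders b \<and>
     wf_exp v c \<and> wf_exp v i \<and> wf_exp v b"

primrec room :: "exp \<Rightarrow> nat" where
  "room (Const n) = 1"
| "room (Var x) = 2"
| "room Len = 1"
| "room (Bit e) = room e"
| "room (Bin f a b) = max (room a) (max (Suc (room b)) 4)"
| "room (Iter x y c i b) = max (room c) (max (Suc (room i)) (max (Suc (room b)) 5))"

text \<open>An exponent: if all registers, and the input length plus two, are at most
  \<open>M\<close>, then values are at most \<open>M ^ deg e\<close>. Degrees multiply because the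
  second operand is computed while the first occupies a register, so its bound starts from
  \<open>M ^ deg a\<close> instead of \<open>M\<close>.\<close>

primrec deg :: "exp \<Rightarrow> nat" where
  "deg (Const n) = Suc n"
| "deg (Var x) = 1"
| "deg Len = 1"
| "deg (Bit e) = deg e"
| "deg (Bin f a b) = deg a * Suc (deg b)"
| "deg (Iter x y c i b) = deg c * deg i * deg b"

text \<open>In \<open>Iter\<close>, register \<open>v\<close> counts the rounds down while
  \<open>x\<close> counts them up. The truncation bound, one more than the length of the prefixed
  word, is recomputed in \<open>v + 2\<close> in each round.\<close>

primrec compile :: "bool list \<Rightarrow> exp \<Rightarrow> nat \<Rightarrow> com" where
  "compile pre (Const n) v = incs n v"
| "compile pre (Var x) v = addcopy x v (Suc v)"
| "compile pre Len v = Seq (readlen v) (incs (length pre) v)"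
| "compile pre (Bit e) v = Seq (compile pre e v) (readbit_pre pre v)"
| "compile pre (Bin f a b) v = Seq (compile pre a v) (Seq (compile pre b (Suc v)) (opcom f v))"
| "compile pre (Iter x y c i b) v =
     Seq (compile pre c v) (Seq (compile pre i (Suc v)) (Seq (move (Suc v) y)
       (Seq (loop v (Seq (compile pre b (Suc v)) (Seq (readlen (v + 2)) (Seq (incs (Suc (length pre)) (v + 2))
          (Seq (opcom Min (Suc v)) (Seq (clear y) (Seq (move (Suc v) y) (Inc x))))))))
       (Seq (clear x) (move y v)))))"

lemma wf_exp_binders: "wf_exp v e \<Longrightarrow> r \<in> binders e \<Longrightarrow> r < v"
  by (induction e) auto

lemma wf_exp_mono: "wf_exp v e \<Longrightarrow> v \<le> v' \<Longrightarrow> wf_exp v' e"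
  by (induction e) auto

lemma eval_cong: "wf_exp v e \<Longrightarrow> \<forall>r<v. s r = s' r \<Longrightarrow> eval e w s = eval e w s'"
proof (induction e arbitrary: s s')
  case (Iter x y c i b)
  have "eval b w (s(x := t, y := a)) = eval b w (s'(x := t, y := a))" for t a
    by (rule Iter.IH(3)) (use Iter.prems in auto)
  moreover have "eval c w s = eval c w s'" "eval i w s = eval i w s'"
    using Iter.IH(1,2)[OF _ Iter.prems(2)] Iter.prems(1) by auto
  ultimately show ?case by simp
next
  case (Bit e)
  show ?case using Bit.IH[OF _ Bit.prems(2)] Bit.prems(1) by simp
next
  case (Bin f a b)
  show ?case using Bin.IH[OF _ Bin.prems(2)] Bin.prems(1) by simp
qed auto

lemma deg_pos: "0 < deg e"
  by (induction e) auto

lemma room_pos: "0 < room e"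
  by (induction e) auto


lemma iterate_le:
  assumes "\<And>t a. t < n \<Longrightarrow> f t a \<le> K" "a \<le> K"
  shows "j \<le> n \<Longrightarrow> iterate j f a \<le> K"
  using assms by (induction j) auto

lemma appop_le:
  assumes "x \<le> P" "y \<le> Q" "2 \<le> P" "2 \<le> Q"
  shows "appop f x y \<le> P * (Q :: nat)"
proof -
  have "P \<le> P * Q" using assms by simp
  moreover have "x * y \<le> P * Q" using assms by (intro mult_mono) auto
  moreover have "x + y \<le> P * Q"
  proof -
    obtain p q where "P = p + 2" "Q = q + 2" using assms by (metis le_add_diff_inverse2)
    then show ?thesis using assms by (simp add: algebra_simps)
  qed
  ultimately show ?thesis using assms by (cases f) (auto intro: order_trans)
qed

definition assigns :: "nat \<Rightarrow> bool list \<Rightarrow> nat \<Rightarrow> com \<Rightarrow> (nat \<Rightarrow> nat) \<Rightarrow> nat \<Rightarrow> nat \<Rightarrow> bool" where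
  "assigns m w B c s v x \<longleftrightarrow> (\<forall>u. exec m w B c (s, 0, u) (s(v := x), 0, u))"

lemma assigns_exec:
  "assigns m w B c s v x \<Longrightarrow> exec m w B c (s, 0, u) (s(v := x), 0, u)"
  by (simp add: assigns_def)

text \<open>Value and space are bounded in one induction: the result of a subexpression is a
  register content for the next one, so the induction hypothesis is used with a larger
  \<open>M\<close>, and only the last power has to fit under \<open>B\<close>.\<close>

lemma assigns_comp:
  assumes "wf_exp v e" "v + room e \<le> m" "\<forall>r. s r \<le> M" "length (pre @ w) + 2 \<le> M"
    and "\<forall>r\<in>binders e. s r = 0" "\<forall>r\<ge>v. s r = 0" "M ^ deg e \<le> B"
  shows "assigns m w B (compile pre e v) s v (eval e (pre @ w) s) \<and> eval e (pre @ w) s \<le> M ^ deg e"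
  using assms
proof (induction e arbitrary: v s M B)
  case (Const n)
  \<comment> \<open>This inequality and \<open>2 \<le> M\<close> are the origin of the degree
    \<open>Suc n\<close> of a constant.\<close>
  have "n < 2 ^ n" by (rule less_exp)
  also have "2 ^ n \<le> M ^ n" using Const by (intro power_mono) auto
  also have "M ^ n \<le> M ^ Suc n" using Const by (intro power_increasing) auto
  finally have n: "n \<le> M ^ Suc n" by simp
  then have "exec m w B (incs n v) (s, 0, u) (s(v := s v + n), 0, u)" for u
    using Const by (intro exec_incs) auto
  then show ?case using Const n by (simp add: assigns_def)
next
  case (Var x)
  then have "exec m w B (addcopy x v (Suc v)) (s, 0, u) (s(v := s v + s x), 0, u)" for u
    by (intro exec_addcopy) (auto intro: order_trans)
  then show ?case using Var by (simp add: assigns_def)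
next
  case Len
  have "exec m w B (Seq (readlen v) (incs (length pre) v)) (s, 0, u) (s(v := length (pre @ w)), 0, u)" for u
    by (rule exec_Seq[OF exec_readlen], (use Len in auto)[2],
        rule exec_state, rule exec_incs) (use Len in auto)
  then show ?case using Len by (simp add: assigns_def)
next
  case (Bit e)
  have M: "1 \<le> M ^ deg e" using Bit.prems by (intro one_le_power) auto
  have "1 \<le> B" using order_trans[OF M Bit.prems(7)[unfolded deg.simps]] .
  have e: "assigns m w B (compile pre e v) s v (eval e (pre @ w) s)"
    "eval e (pre @ w) s \<le> M ^ deg e"
    using Bit.IH[of v s M B] Bit.prems by auto
  have "exec m w B (readbit_pre pre v) (s(v := eval e (pre @ w) s), 0, u)
    (s(v := eval (Bit e) (pre @ w) s), 0, u)" for u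
    by (rule exec_state, rule exec_readbit_pre) (use Bit.prems e \<open>1 \<le> B\<close> room_pos[of e] in auto)
  then have "exec m w B (compile pre (Bit e) v) (s, 0, u) (s(v := eval (Bit e) (pre @ w) s), 0, u)" for u
    unfolding compile.simps by (intro exec_Seq[OF assigns_exec[OF e(1)]])
  then show ?case using M by (simp add: assigns_def bitval_def)
next
  case (Bin f a b)
  let ?w = "pre @ w"
  let ?x = "eval a ?w s" and ?y = "eval b ?w s"
  let ?P = "M ^ deg a" and ?Q = "(M ^ deg a) ^ deg b"
  have M: "2 \<le> M" using Bin.prems by auto
  have P: "M \<le> ?P" "?P \<le> ?Q"
    using M deg_pos[of a] deg_pos[of b] by (auto intro!: self_le_power)
  have PQ: "?P * ?Q \<le> B"
    using Bin.prems(7) by (simp add: power_add power_mult)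
  have PQ': "?P \<le> ?P * ?Q" "?Q \<le> ?P * ?Q" using P M by auto
  have QB: "?Q \<le> B" using PQ PQ' by linarith
  have a: "assigns m w B (compile pre a v) s v ?x" "?x \<le> ?P"
    using Bin.IH(1)[of v s M B] Bin.prems PQ PQ' by auto
  have yeq: "eval b ?w (s(v := ?x)) = ?y"
    by (rule eval_cong[of v]) (use Bin.prems in auto)
  have "\<forall>r. (s(v := ?x)) r \<le> ?P" using a(2) Bin.prems(3) P by (auto intro: order_trans)
  moreover have "wf_exp (Suc v) b" using Bin.prems(1) by (auto intro: wf_exp_mono)
  moreover have "\<forall>r\<in>binders b. (s(v := ?x)) r = 0"
    using Bin.prems(1,5) wf_exp_binders[of v b] by auto
  ultimately have "assigns m w B (compile pre b (Suc v)) (s(v := ?x)) (Suc v) ?y \<and> ?y \<le> ?Q"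
    by (intro Bin.IH(2)[of "Suc v" "s(v := ?x)" ?P B, unfolded yeq]) (use Bin.prems QB P in auto)
  then have b: "assigns m w B (compile pre b (Suc v)) (s(v := ?x)) (Suc v) ?y" "?y \<le> ?Q" by auto
  have le: "appop f ?x ?y \<le> ?P * ?Q"
    using a b P M by (intro appop_le) auto
  have "exec m w B (opcom f v) (s(v := ?x, Suc v := ?y), 0, u) (s(v := appop f ?x ?y), 0, u)" for u
    by (rule exec_state, rule exec_opcom) (use Bin.prems a b le PQ QB P in \<open>auto simp: fun_eq_iff\<close>)
  then have "exec m w B (compile pre (Bin f a b) v) (s, 0, u) (s(v := appop f ?x ?y), 0, u)" for u
    unfolding compile.simps
    by (intro exec_Seq[OF assigns_exec[OF a(1)]] exec_Seq[OF assigns_exec[OF b(1)]])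
  then show ?case using le by (simp add: assigns_def power_add power_mult)
next
  case (Iter x y c i b)
  let ?w = "pre @ w"
  let ?C = "eval c ?w s" and ?I = "eval i ?w s"
  let ?P = "M ^ deg c" and ?Q = "(M ^ deg c) ^ deg i"
  let ?F = "\<lambda>t a. min (eval b ?w (s(x := t, y := a))) (Suc (length ?w))"
  let ?acc = "\<lambda>j. iterate j ?F ?I"
  have wf: "x < v" "y < v" "x \<noteq> y" "x \<notin> binders b" "y \<notin> binders b" "wf_exp v c" "wf_exp v i" "wf_exp v b"
    using Iter.prems(1) by auto
  have room: "v + room c \<le> m" "Suc v + room i \<le> m" "Suc v + room b \<le> m" "v + 5 \<le> m"
    using Iter.prems(2) by auto
  have M: "2 \<le> M" using Iter.prems by auto
  have P: "M \<le> ?P" using M deg_pos[of c] by (auto intro!: self_le_power)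
  have Q: "?P \<le> ?Q" using M deg_pos[of i] by (auto intro!: self_le_power)
  have R: "?Q \<le> ?Q ^ deg b" using M deg_pos[of b] by (auto intro!: self_le_power)
  have B: "?Q ^ deg b \<le> B" using Iter.prems(7) by (simp add: power_mult)
  have len: "length pre + length w + 2 \<le> M" using Iter.prems(4) by simp
  have zero: "\<forall>r\<ge>v. s r = 0" "s x = 0" "s y = 0" using Iter.prems by auto
  have c: "assigns m w B (compile pre c v) s v ?C" "?C \<le> ?P"
    using Iter.IH(1)[of v s M B] Iter.prems P Q R B by auto
  have ieq: "eval i ?w (s(v := ?C)) = ?I"
    by (rule eval_cong[of v]) (use wf in auto)
  have "\<forall>r. (s(v := ?C)) r \<le> ?P" using c(2) Iter.prems(3) P by (auto intro: order_trans)
  moreover have "wf_exp (Suc v) i" using wf by (auto intro: wf_exp_mono)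
  moreover have "\<forall>r\<in>binders i. (s(v := ?C)) r = 0"
    using Iter.prems(5) wf wf_exp_binders[of v i] by auto
  ultimately have "assigns m w B (compile pre i (Suc v)) (s(v := ?C)) (Suc v) ?I \<and> ?I \<le> ?Q"
    by (intro Iter.IH(2)[of "Suc v" "s(v := ?C)" ?P B, unfolded ieq])
      (use room zero Iter.prems(4) Q R B P in auto)
  then have i: "assigns m w B (compile pre i (Suc v)) (s(v := ?C)) (Suc v) ?I" "?I \<le> ?Q" by auto
  \<comment> \<open>Thanks to truncation the bound does not depend on the number of rounds.\<close>
  have acc: "?acc j \<le> ?Q" for j
    by (rule iterate_le[of j _ _ _ j]) (use i(2) P Q len in auto)
  let ?f = "\<lambda>j. s(x := j, y := ?acc j)"
  let ?body = "Seq (compile pre b (Suc v)) (Seq (readlen (v + 2)) (Seq (incs (Suc (length pre)) (v + 2))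
          (Seq (opcom Min (Suc v)) (Seq (clear y) (Seq (move (Suc v) y) (Inc x))))))"
  have body: "exec m w B ?body ((?f j)(v := ?C - Suc j), 0, u) ((?f (Suc j))(v := ?C - Suc j), 0, u)"
    if j: "j < ?C" for j u
  proof -
    let ?s = "(?f j)(v := ?C - Suc j)"
    let ?E = "eval b ?w (?f j)" and ?n = "length ?w"
    have Eeq: "eval b ?w ?s = ?E"
      by (rule eval_cong[of v]) (use wf in auto)
    have s: "\<forall>r. ?s r \<le> ?Q"
      using Iter.prems(3) c(2) j acc P Q by (auto intro: order_trans)
    have "\<forall>r\<in>binders b. ?s r = 0"
      using Iter.prems(5) wf wf_exp_binders[of v b] by auto
    moreover have "wf_exp (Suc v) b" using wf by (auto intro: wf_exp_mono)
    ultimately have "assigns m w B (compile pre b (Suc v)) ?s (Suc v) ?E \<and> ?E \<le> ?Q ^ deg b"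
      by (intro Iter.IH(3)[of "Suc v" ?s ?Q B, unfolded Eeq] s)
        (use room wf zero Iter.prems(4) Q B P in auto)
    then have E: "assigns m w B (compile pre b (Suc v)) ?s (Suc v) ?E" "?E \<le> ?Q ^ deg b" by auto
    have "exec m w B (readlen (v + 2)) (?s(Suc v := ?E), 0, u) (?s(Suc v := ?E, v + 2 := length w), 0, u)"
      by (rule exec_state, rule exec_readlen) (use room zero wf len P Q R B in auto)
    moreover have "exec m w B (incs (Suc (length pre)) (v + 2)) (?s(Suc v := ?E, v + 2 := length w), 0, u)
        (?s(Suc v := ?E, v + 2 := Suc ?n), 0, u)"
      by (rule exec_state, rule exec_incs) (use room zero wf len P Q R B in auto)
    moreover have "exec m w B (opcom Min (Suc v)) (?s(Suc v := ?E, v + 2 := Suc ?n), 0, u)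
        (?s(Suc v := ?acc (Suc j)), 0, u)"
      by (rule exec_state, rule exec_opcom) (use room zero wf len P Q R B E in \<open>auto simp: fun_eq_iff\<close>)
    moreover have "exec m w B (clear y) (?s(Suc v := ?acc (Suc j)), 0, u) (?s(Suc v := ?acc (Suc j), y := 0), 0, u)"
      by (rule exec_state, rule exec_clear) (use room zero wf acc[of j] R B in auto)
    moreover have "exec m w B (move (Suc v) y) (?s(Suc v := ?acc (Suc j), y := 0), 0, u)
        (?s(y := ?acc (Suc j)), 0, u)"
      by (rule exec_state, rule exec_move) (use room zero wf acc[of "Suc j"] R B in \<open>auto simp: fun_eq_iff\<close>)
    moreover have "exec m w B (Inc x) (?s(y := ?acc (Suc j)), 0, u) ((?f (Suc j))(v := ?C - Suc j), 0, u)"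
      by (rule exec_state, rule exec_Inc) (use room zero wf c(2) Q R B j in \<open>auto simp: fun_eq_iff\<close>)
    ultimately show ?thesis
      using assigns_exec[OF E(1), of u] by (meson exec_Seq)
  qed
  have "exec m w B (compile pre (Iter x y c i b) v) (s, 0, u) (s(v := ?acc ?C), 0, u)" for u
  proof -
    have "exec m w B (move (Suc v) y) (s(v := ?C, Suc v := ?I), 0, u) ((?f 0)(v := ?C), 0, u)"
      by (rule exec_state, rule exec_move) (use room zero wf i(2) R B in \<open>auto simp: fun_eq_iff\<close>)
    moreover have "exec m w B (loop v ?body) ((?f 0)(v := ?C), 0, u) ((?f ?C)(v := 0), 0, u)"
    proof (rule exec_loop[where f = ?f and p = "\<lambda>_. 0" and g = "\<lambda>_. u", OF _ _ body])
      show "v < m" "?C \<le> B" using room c(2) Q R B by auto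
    qed
    moreover have "exec m w B (clear x) ((?f ?C)(v := 0), 0, u) (s(y := ?acc ?C), 0, u)"
      by (rule exec_state, rule exec_clear) (use room zero wf c(2) Q R B in \<open>auto simp: fun_eq_iff\<close>)
    moreover have "exec m w B (move y v) (s(y := ?acc ?C), 0, u) (s(v := ?acc ?C), 0, u)"
      by (rule exec_state, rule exec_move) (use room zero wf acc[of ?C] R B in \<open>auto simp: fun_eq_iff\<close>)
    ultimately show ?thesis
      using assigns_exec[OF c(1), of u] assigns_exec[OF i(1), of u] unfolding compile.simps by (meson exec_Seq)
  qed
  then show ?case using order_trans[OF acc R] by (simp add: assigns_def power_mult)
qed

section \<open>Programs that write output\<close>

datatype out =
    Emit nat
  | Cat out out
  | For nat exp out
  | Let nat exp out

primrec oeval :: "out \<Rightarrow> bool list \<Rightarrow> (nat \<Rightarrow> nat) \<Rightarrow> nat list" where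
  "oeval (Emit b) w s = [b]"
| "oeval (Cat p q) w s = oeval p w s @ oeval q w s"
| "oeval (For x e p) w s = concat (map (\<lambda>t. oeval p w (s(x := t))) [0..<eval e w s])"
| "oeval (Let x e p) w s = oeval p w (s(x := eval e w s))"

primrec obinders :: "out \<Rightarrow> nat set" where
  "obinders (Emit b) = {}"
| "obinders (Cat p q) = obinders p \<union> obinders q"
| "obinders (For x e p) = {x} \<union> binders e \<union> obinders p"
| "obinders (Let x e p) = {x} \<union> binders e \<union> obinders p"

primrec wf_out :: "nat \<Rightarrow> out \<Rightarrow> bool" where
  "wf_out v (Emit b) \<longleftrightarrow> True"
| "wf_out v (Cat p q) \<longleftrightarrow> wf_out v p \<and> wf_out v q"
| "wf_out v (For x e p) \<longleftrightarrow> x < v \<and> x \<notin> obinders p \<and> wf_exp v e \<and> wf_out v p"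
| "wf_out v (Let x e p) \<longleftrightarrow> x < v \<and> x \<notin> obinders p \<and> wf_exp v e \<and> wf_out v p"

primrec oroom :: "out \<Rightarrow> nat" where
  "oroom (Emit b) = 0"
| "oroom (Cat p q) = max (oroom p) (oroom q)"
| "oroom (For x e p) = max (room e) (Suc (oroom p))"
| "oroom (Let x e p) = max (Suc (room e)) (oroom p)"

primrec odeg :: "out \<Rightarrow> nat" where
  "odeg (Emit b) = 1"
| "odeg (Cat p q) = odeg p * odeg q"
| "odeg (For x e p) = deg e * odeg p"
| "odeg (Let x e p) = deg e * odeg p"

primrec ocomp :: "bool list \<Rightarrow> out \<Rightarrow> nat \<Rightarrow> com" where
  "ocomp pre (Emit b) v = Out b"
| "ocomp pre (Cat p q) v = Seq (ocomp pre p v) (ocomp pre q v)"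
| "ocomp pre (For x e p) v = Seq (compile pre e v)
     (Seq (loop v (Seq (ocomp pre p (Suc v)) (Inc x))) (clear x))"
| "ocomp pre (Let x e p) v = Seq (compile pre e v) (Seq (move v x) (Seq (ocomp pre p v) (clear x)))"

lemma wf_out_mono: "wf_out v p \<Longrightarrow> v \<le> v' \<Longrightarrow> wf_out v' p"
  by (induction p) (auto intro: wf_exp_mono)

lemma oeval_cong: "wf_out v p \<Longrightarrow> \<forall>r<v. s r = s' r \<Longrightarrow> oeval p w s = oeval p w s'"
proof (induction p arbitrary: s s')
  case (Cat p q)
  show ?case using Cat.IH[OF _ Cat.prems(2)] Cat.prems(1) by simp
next
  case (For x e p)
  have "oeval p w (s(x := t)) = oeval p w (s'(x := t))" for t
    by (rule For.IH) (use For.prems in auto)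
  moreover have "eval e w s = eval e w s'"
    using eval_cong[OF _ For.prems(2)] For.prems(1) by auto
  ultimately show ?case by simp
next
  case (Let x e p)
  have "oeval p w (s(x := t)) = oeval p w (s'(x := t))" for t
    by (rule Let.IH) (use Let.prems in auto)
  moreover have "eval e w s = eval e w s'"
    using eval_cong[OF _ Let.prems(2)] Let.prems(1) by auto
  ultimately show ?case by simp
qed auto

lemma odeg_pos: "0 < odeg p"
  by (induction p) (auto simp: deg_pos)


text \<open>Every construct restores the store and merely appends output; hence the body of
  \<open>For\<close> can be repeated and registers can be shared by consecutive programs. Bounds
  propagate as for expressions.\<close>

lemma exec_ocomp:
  assumes "wf_out v p" "v + oroom p \<le> m" "\<forall>r. s r \<le> M" "length (pre @ w) + 2 \<le> M"
    and "\<forall>r\<in>obinders p. s r = 0" "\<forall>r\<ge>v. s r = 0" "M ^ odeg p \<le> B"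
  shows "exec m w B (ocomp pre p v) (s, 0, u) (s, 0, u @ oeval p (pre @ w) s)"
  using assms
proof (induction p arbitrary: v s M B u)
  case (Emit b)
  then show ?case by (simp add: exec_Out)
next
  case (Cat p q)
  have "M ^ odeg p \<le> M ^ odeg (Cat p q)" "M ^ odeg q \<le> M ^ odeg (Cat p q)"
    using Cat.prems(4) odeg_pos[of p] odeg_pos[of q] by (auto intro!: power_increasing)
  then have B: "M ^ odeg p \<le> B" "M ^ odeg q \<le> B" using Cat.prems(7) by auto
  have "exec m w B (ocomp pre p v) (s, 0, u) (s, 0, u @ oeval p (pre @ w) s)"
    by (rule Cat.IH(1)[OF _ _ Cat.prems(3,4) _ Cat.prems(6) B(1)]) (use Cat.prems in auto)
  moreover have "exec m w B (ocomp pre q v) (s, 0, u @ oeval p (pre @ w) s)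
      (s, 0, (u @ oeval p (pre @ w) s) @ oeval q (pre @ w) s)"
    by (rule Cat.IH(2)[OF _ _ Cat.prems(3,4) _ Cat.prems(6) B(2)]) (use Cat.prems in auto)
  ultimately show ?case by (auto intro: exec_Seq)
next
  case (For x e p)
  let ?w = "pre @ w"
  let ?C = "eval e ?w s" and ?P = "M ^ deg e"
  have wf: "x < v" "x \<notin> obinders p" "wf_exp v e" "wf_out v p"
    using For.prems(1) by auto
  have room: "v + room e \<le> m" "Suc v + oroom p \<le> m"
    using For.prems(2) by auto
  have M: "2 \<le> M" using For.prems by auto
  have P: "M \<le> ?P" "?P \<le> ?P ^ odeg p"
    using M deg_pos[of e] odeg_pos[of p] by (auto intro!: self_le_power)
  have B: "?P ^ odeg p \<le> B" using For.prems(7) by (simp add: power_mult)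
  have zero: "\<forall>r\<ge>v. s r = 0" "s x = 0" using For.prems by auto
  have e: "assigns m w B (compile pre e v) s v ?C" "?C \<le> ?P"
    using assigns_comp[of v e m s M pre w B] For.prems room wf P B by auto
  let ?g = "\<lambda>j. u @ concat (map (\<lambda>t. oeval p ?w (s(x := t))) [0..<j])"
  let ?f = "\<lambda>j. s(x := j)"
  let ?body = "Seq (ocomp pre p (Suc v)) (Inc x)"
  have body: "exec m w B ?body ((?f j)(v := ?C - Suc j), 0, ?g j) ((?f (Suc j))(v := ?C - Suc j), 0, ?g (Suc j))"
    if j: "j < ?C" for j
  proof -
    let ?s = "(?f j)(v := ?C - Suc j)"
    have eq: "oeval p ?w ?s = oeval p ?w (?f j)"
      by (rule oeval_cong[of v]) (use wf in auto)
    have s: "\<forall>r. ?s r \<le> ?P"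
      using For.prems(3) e(2) j P by (auto intro: order_trans)
    have "obinders p \<subseteq> {..<v}" using wf(4)
      by (induction p) (auto dest: wf_exp_binders)
    then have bs: "\<forall>r\<in>obinders p. ?s r = 0"
      using For.prems(5) wf by auto
    have "exec m w B (ocomp pre p (Suc v)) (?s, 0, ?g j) (?s, 0, ?g j @ oeval p ?w ?s)"
      by (rule For.IH[OF wf_out_mono[OF wf(4)] room(2) s _ bs _ B])
        (use wf zero For.prems(4) P in auto)
    then have "exec m w B (ocomp pre p (Suc v)) (?s, 0, ?g j) (?s, 0, ?g (Suc j))"
      unfolding eq by simp
    moreover have "exec m w B (Inc x) (?s, 0, ?g (Suc j)) ((?f (Suc j))(v := ?C - Suc j), 0, ?g (Suc j))"
      by (rule exec_state, rule exec_Inc) (use room zero wf e(2) P B j in \<open>auto simp: fun_eq_iff\<close>)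
    ultimately show ?thesis by (rule exec_Seq)
  qed
  have "exec m w B (loop v ?body) ((?f 0)(v := ?C), 0, ?g 0) ((?f ?C)(v := 0), 0, ?g ?C)"
  proof (rule exec_loop[where f = ?f and p = "\<lambda>_. 0" and g = ?g, OF _ _ body])
    show "v < m" using room room_pos[of e] by simp
    show "?C \<le> B" using e(2) P B by simp
  qed
  then have "exec m w B (loop v ?body) (s(v := ?C), 0, u) ((?f ?C)(v := 0), 0, ?g ?C)"
    using zero by (simp add: fun_upd_idem)
  moreover have "exec m w B (clear x) ((?f ?C)(v := 0), 0, ?g ?C) (s, 0, ?g ?C)"
    by (rule exec_state, rule exec_clear) (use room zero wf e(2) P B in \<open>auto simp: fun_eq_iff\<close>)
  ultimately show ?case
    using assigns_exec[OF e(1), of u] unfolding ocomp.simps oeval.simps by (meson exec_Seq)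
next
  case (Let x e p)
  let ?w = "pre @ w"
  let ?C = "eval e ?w s" and ?P = "M ^ deg e"
  have wf: "x < v" "x \<notin> obinders p" "wf_exp v e" "wf_out v p"
    using Let.prems(1) by auto
  have room: "v + room e < m" "v + oroom p \<le> m"
    using Let.prems(2) by auto
  have M: "2 \<le> M" using Let.prems by auto
  have P: "M \<le> ?P" "?P \<le> ?P ^ odeg p"
    using M deg_pos[of e] odeg_pos[of p] by (auto intro!: self_le_power)
  have B: "?P ^ odeg p \<le> B" using Let.prems(7) by (simp add: power_mult)
  have zero: "\<forall>r\<ge>v. s r = 0" "s x = 0" using Let.prems by auto
  have e: "assigns m w B (compile pre e v) s v ?C" "?C \<le> ?P"
    using assigns_comp[of v e m s M pre w B] Let.prems room wf P B by auto
  let ?s = "s(x := ?C)"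
  have "exec m w B (move v x) (s(v := ?C), 0, u) (?s, 0, u)"
    by (rule exec_state, rule exec_move) (use room zero wf e(2) P B in \<open>auto simp: fun_eq_iff\<close>)
  moreover have "exec m w B (ocomp pre p v) (?s, 0, u) (?s, 0, u @ oeval p ?w ?s)"
  proof (rule Let.IH[OF wf(4) room(2) _ _ _ _ B])
    show "\<forall>r. ?s r \<le> ?P" using Let.prems(3) e(2) P by (auto intro: order_trans)
  qed (use wf zero Let.prems(4,5) P in auto)
  moreover have "exec m w B (clear x) (?s, 0, u @ oeval p ?w ?s) (s, 0, u @ oeval p ?w ?s)"
    by (rule exec_state, rule exec_clear) (use room zero wf e(2) P B in \<open>auto simp: fun_eq_iff\<close>)
  ultimately show ?case
    using assigns_exec[OF e(1), of u] unfolding ocomp.simps oeval.simps by (meson exec_Seq)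
qed

fun init_tapes :: "nat \<Rightarrow> com" where
  "init_tapes 0 = Skip"
| "init_tapes (Suc j) = Seq (init_tapes j) (Work j (Some Mark) Go_Right)"

lemma runs_init_tapes:
  assumes "j \<le> m" "1 < S"
  shows "runs w S (init_tapes j) (0, replicate m (\<lambda>_. 0, 0), u)
    (0, replicate j (tape [], 1) @ replicate (m - j) (\<lambda>_. 0, 0), u)"
  using assms(1)
proof (induction j)
  case 0
  then show ?case using assms(2) by (auto intro!: runs_Skip simp: heads_below_def)
next
  case (Suc j)
  let ?ts = "replicate j (tape [], 1 :: nat) @ replicate (m - j) (\<lambda>_. 0, 0)"
  have upd: "?ts[j := (tape [], 1)] = replicate (Suc j) (tape [], 1) @ replicate (m - Suc j) (\<lambda>_. 0, 0)"
    using Suc.prems by (intro nth_equalityI) (auto simp: nth_append nth_list_update nth_Cons')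
  have t: "tape [] = (\<lambda>_. 0)(0 := code Mark)"
    by (auto simp: tape_def fun_eq_iff code.simps)
  have "runs w S (Work j (Some Mark) Go_Right) (0, ?ts, u) (0, ?ts[j := (tape [], move_head Go_Right 0)], u)"
    by (rule runs_Work[where t = "\<lambda>_. 0"])
      (use Suc.prems assms(2) t in \<open>auto simp: heads_below_def nth_append\<close>)
  then have "runs w S (Work j (Some Mark) Go_Right) (0, ?ts, u)
      (0, replicate (Suc j) (tape [], 1) @ replicate (m - Suc j) (\<lambda>_. 0, 0), u)"
    using upd by (simp only: move_head.simps One_nat_def)
  then show ?case
    unfolding init_tapes.simps using Suc assms(2)
    by (intro runs_Seq[where y = "(0, ?ts, u)"]) (auto simp: heads_below_def)
qed

text \<open>For a fixed program all counters stay below a fixed power of the input length, so their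
  words are logarithmically long; the prefix only adds a constant to that length.\<close>

lemma logspace_out:
  assumes "wf_out v p"
  shows "logspace_computable (\<lambda>w. oeval p (pre @ w) (\<lambda>_. 0))"
proof (rule logspace_program)
  define s where "s n = spc ((length pre + n + 2) ^ odeg p)" for n
  define m where "m = v + oroom p"
  fix w :: "bool list"
  let ?B = "(length pre + length w + 2) ^ odeg p"
  have "exec m w ?B (ocomp pre p v) (\<lambda>_. 0, 0, []) (\<lambda>_. 0, 0, [] @ oeval p (pre @ w) (\<lambda>_. 0))"
    by (rule exec_ocomp[OF assms]) (auto simp: m_def)
  moreover have "replicate m (tape [], 1) = rep m (\<lambda>_. 0)"
    by (simp add: rep_def map_replicate_const)
  moreover have "runs w (s (length w)) (init_tapes m) (0, replicate m (\<lambda>_. 0, 0), [])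
      (0, replicate m (tape [], 1), [])"
    using runs_init_tapes[of m m "s (length w)" w "[]"] by (simp add: s_def spc_def)
  ultimately have "runs w (s (length w)) (Seq (init_tapes m) (ocomp pre p v))
      (0, replicate m (\<lambda>_. 0, 0), []) (0, rep m (\<lambda>_. 0), oeval p (pre @ w) (\<lambda>_. 0))"
    by (intro runs_Seq[where y = "(0, rep m (\<lambda>_. 0), [])"])
      (auto simp: exec.simps s_def spc_def heads_below_def)
  then show "\<exists>i ts. runs w (s (length w)) (Seq (init_tapes m) (ocomp pre p v))
      (0, replicate m (\<lambda>_. 0, 0), []) (i, ts, oeval p (pre @ w) (\<lambda>_. 0))"
    by blast
next
  show "(\<lambda>n. real (spc ((length pre + n + 2) ^ odeg p))) \<in> O(\<lambda>n. ln (real n))"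
  proof (rule bigoI)
    \<comment> \<open>The \<open>4\<close> is the \<open>3\<close> of \<open>spc\<close> plus
      \<open>1\<close> for the factor \<open>2\<close> in the bound on \<open>2 ^ ?l\<close>; it is
      absorbed using \<open>1 \<le> ln n\<close>, which holds from \<open>n = 3\<close> on. The
      factor \<open>2\<close> before \<open>odeg p\<close> comes from
      \<open>?N \<le> n ^ 2\<close>.\<close>
    let ?c = "4 + 2 * real (odeg p) / ln 2"
    show "\<forall>\<^sub>F n in sequentially. norm (real (spc ((length pre + n + 2) ^ odeg p))) \<le> ?c * norm (ln (real n))"
      using eventually_ge_at_top[of "length pre + 3"]
    proof eventually_elim
      case (elim n)
      let ?N = "length pre + n + 2"
      let ?l = "length (digits (?N ^ odeg p))"
      have n: "1 \<le> ln (real n)"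
      proof -
        have "exp 1 \<le> (3 :: real)" by (rule exp_le)
        also have "3 \<le> real n" using elim by simp
        finally show ?thesis using elim by (subst ln_ge_iff) auto
      qed
      have "?N \<le> 2 * n" using elim by simp
      also have "2 * n \<le> n * n" using elim by (intro mult_right_mono) auto
      finally have "real ?N \<le> real n ^ 2" by (metis of_nat_le_iff of_nat_mult power2_eq_square)
      then have "ln (real ?N) \<le> ln (real n ^ 2)" by (subst ln_le_cancel_iff) (use elim in auto)
      also have "\<dots> = 2 * ln (real n)" by (simp add: ln_realpow)
      finally have N: "ln (real ?N) \<le> 2 * ln (real n)" .
      have "1 \<le> ?N ^ odeg p" by simp
      then have "2 ^ ?l \<le> 2 * ?N ^ odeg p" using power_length_digits[of "?N ^ odeg p"] by linarith
      then have "real (2 ^ ?l) \<le> real (2 * ?N ^ odeg p)" by (rule of_nat_mono)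
      then have "2 ^ ?l \<le> 2 * real ?N ^ odeg p" by simp
      then have "ln (2 ^ ?l) \<le> ln (2 * real ?N ^ odeg p)" by (subst ln_le_cancel_iff) auto
      then have "real ?l * ln 2 \<le> ln 2 + real (odeg p) * ln (real ?N)"
        by (simp add: ln_realpow ln_mult)
      also have "\<dots> \<le> ln 2 + real (odeg p) * (2 * ln (real n))"
        using N by (intro add_left_mono mult_left_mono) auto
      finally have "real ?l \<le> (ln 2 + real (odeg p) * (2 * ln (real n))) / ln 2"
        by (subst pos_le_divide_eq) auto
      also have "\<dots> = 1 + 2 * real (odeg p) / ln 2 * ln (real n)"
        by (simp add: add_divide_distrib)
      finally have "real (spc (?N ^ odeg p)) \<le> 4 + 2 * real (odeg p) / ln 2 * ln (real n)"
        by (simp add: spc_def)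
      also have "\<dots> \<le> ?c * ln (real n)" using n by (simp add: algebra_simps)
      finally show ?case using n by simp
    qed
  qed
qed

section \<open>A deterministic pushdown automaton evaluating trees\<close>

text \<open>Input letters: \<open>0\<close> and \<open>1\<close> are copied to the stack, \<open>2\<close> starts a table entry, \<open>3\<close> ends a table
  and \<open>4\<close> is the entry that accepts. Stack letters: \<open>0\<close> is the unary digit, \<open>1\<close> separates frames
  and \<open>2\<close> is the bottom. States: \<open>0\<close> looks for the entry whose number is on top of the
  stack, \<open>1\<close> pushes that entry, \<open>2\<close> skips the rest of the table, \<open>3\<close> has found an entry
  with only the bottom left, and \<open>4\<close> has accepted.\<close>

fun etrans :: "nat \<Rightarrow> nat \<Rightarrow> nat \<Rightarrow> (nat \<times> nat list) option" where
  "etrans q x s =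
    (if q = 0 then
       if x = 2 then Some (if s = 0 then (0, []) else if s = 1 then (1, []) else (3, [s]))
       else if x = 3 then None else Some (0, [s])
     else if q = 1 then
       if x \<le> 1 then Some (1, [x, s]) else if x = 2 then Some (2, [s])
       else if x = 3 then Some (0, [s]) else None
     else if q = 2 then Some (if x = 3 then 0 else 2, [s])
     else if q = 3 then if x = 4 then Some (4, [s]) else None
     else Some (4, [s]))"

text \<open>Without silent moves each step consumes one letter, so a run is a partial function of
  the input. The initial state is the pushing one: the head of the input puts the frame of the root
  on the stack as if it were an entry.\<close>

definition evaluator :: "(nat, nat, nat) dpda" where
  "evaluator = \<lparr>dpda_states = {..4}, dpda_input = {..4}, dpda_stack = {..2},
     dpda_trans = (\<lambda>q x s. case x of None \<Rightarrow> None | Some a \<Rightarrow> etrans q a s),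
     dpda_init = 1, dpda_bottom = 2, dpda_final = {4}\<rparr>"

lemma wf_evaluator: "wf_dpda evaluator"
  unfolding wf_dpda_def evaluator_def by (auto split: if_splits)

section \<open>Runs of the automaton as a partial function\<close>

fun dstep :: "nat \<times> nat list \<Rightarrow> nat \<Rightarrow> (nat \<times> nat list) option" where
  "dstep (q, []) x = None"
| "dstep (q, s # \<beta>) x = map_option (\<lambda>(p, \<gamma>). (p, \<gamma> @ \<beta>)) (etrans q x s)"

fun drun :: "nat \<times> nat list \<Rightarrow> nat list \<Rightarrow> (nat \<times> nat list) option" where
  "drun c [] = Some c"
| "drun c (x # w) = Option.bind (dstep c x) (\<lambda>c. drun c w)"

declare etrans.simps [simp del]

lemma dpda_step_evaluator:
  "dpda_step evaluator (q, w, \<beta>) (p, w', \<beta>') \<longleftrightarrow> (\<exists>x. w = x # w' \<and> dstep (q, \<beta>) x = Some (p, \<beta>'))"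
  by (cases \<beta>) (auto simp: dpda_step.simps evaluator_def)

lemma dpda_steps_evaluator:
  "(dpda_step evaluator)\<^sup>*\<^sup>* (q, w, \<beta>) (p, [], \<beta>') \<longleftrightarrow> drun (q, \<beta>) w = Some (p, \<beta>')"
proof (induction w arbitrary: q \<beta>)
  case Nil
  have "c = (q, [], \<beta>)" if "(dpda_step evaluator)\<^sup>*\<^sup>* (q, [], \<beta>) c" for c
    using that by (cases rule: converse_rtranclpE) (metis dpda_step_evaluator list.distinct(1) prod_cases3)+
  then show ?case by auto
next
  case (Cons x w)
  have "(dpda_step evaluator)\<^sup>*\<^sup>* (q, x # w, \<beta>) (p, [], \<beta>') \<longleftrightarrow>
      (\<exists>c. dpda_step evaluator (q, x # w, \<beta>) c \<and> (dpda_step evaluator)\<^sup>*\<^sup>* c (p, [], \<beta>'))"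
  proof
    assume "(dpda_step evaluator)\<^sup>*\<^sup>* (q, x # w, \<beta>) (p, [], \<beta>')"
    then show "\<exists>c. dpda_step evaluator (q, x # w, \<beta>) c \<and> (dpda_step evaluator)\<^sup>*\<^sup>* c (p, [], \<beta>')"
      by (cases rule: converse_rtranclpE) blast+
  qed (blast intro: converse_rtranclp_into_rtranclp)
  also have "\<dots> \<longleftrightarrow> (\<exists>q' \<gamma>. dstep (q, \<beta>) x = Some (q', \<gamma>) \<and> drun (q', \<gamma>) w = Some (p, \<beta>'))"
    using Cons by (auto simp: dpda_step_evaluator)
  also have "\<dots> \<longleftrightarrow> drun (q, \<beta>) (x # w) = Some (p, \<beta>')"
    by (auto simp: bind_eq_Some_conv)
  finally show ?case .
qed

lemma language_evaluator:
  "w \<in> dpda_language evaluator \<longleftrightarrow> set w \<subseteq> {..4} \<and> (\<exists>\<beta>. drun (1, [2]) w = Some (4, \<beta>))"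
  using dpda_steps_evaluator[of 1 w "[2]" 4]
  unfolding dpda_language_def by (auto simp: evaluator_def lists_eq_set)

lemma drun_append: "drun c (u @ v) = Option.bind (drun c u) (\<lambda>c. drun c v)"
  by (induction u arbitrary: c) auto

lemma drun_accept: "\<beta> \<noteq> [] \<Longrightarrow> drun (4, \<beta>) w = Some (4, \<beta>)"
  by (induction w) (auto simp: neq_Nil_conv etrans.simps)

lemma drun_copy: "\<beta> \<noteq> [] \<Longrightarrow> set u \<subseteq> {0, 1} \<Longrightarrow> drun (1, \<beta>) u = Some (1, rev u @ \<beta>)"
  by (induction u arbitrary: \<beta>) (auto simp: neq_Nil_conv etrans.simps)

lemma drun_skip: "\<beta> \<noteq> [] \<Longrightarrow> 3 \<notin> set u \<Longrightarrow> drun (2, \<beta>) u = Some (2, \<beta>)"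
  by (induction u) (auto simp: neq_Nil_conv etrans.simps)

lemma drun_scan: "\<beta> \<noteq> [] \<Longrightarrow> 2 \<notin> set u \<Longrightarrow> 3 \<notin> set u \<Longrightarrow> drun (0, \<beta>) u = Some (0, \<beta>)"
  by (induction u) (auto simp: neq_Nil_conv etrans.simps)

section \<open>One pass over the table\<close>

definition block :: "nat list list \<Rightarrow> nat list" where
  "block es = concat (map ((#) 2) es) @ [3]"

lemma block_simps: "block [] = [3]" "block (e # es) = 2 # e @ block es"
  by (simp_all add: block_def)

definition plain :: "nat list list \<Rightarrow> bool" where
  "plain es \<longleftrightarrow> (\<forall>e\<in>set es. 2 \<notin> set e \<and> 3 \<notin> set e)"

lemma drun_skip_block:
  assumes "\<beta> \<noteq> []" "plain es"
  shows "drun (2, \<beta>) (block es) = Some (0, \<beta>)"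
proof -
  have "3 \<notin> set (concat (map ((#) 2) es))" using assms(2) by (auto simp: plain_def)
  then show ?thesis
    using assms(1) by (auto simp: block_def drun_append drun_skip neq_Nil_conv etrans.simps)
qed

lemma drun_end_entry:
  assumes "\<beta> \<noteq> []" "plain es"
  shows "drun (1, \<beta>) (block es) = Some (0, \<beta>)"
proof (cases es)
  case Nil
  then show ?thesis using assms by (auto simp: block_simps neq_Nil_conv etrans.simps)
next
  case (Cons e es')
  have "drun (1, \<beta>) (block es) = drun (2, \<beta>) (block es)"
    using assms(1) by (auto simp: Cons block_simps neq_Nil_conv etrans.simps)
  then show ?thesis using drun_skip_block[OF assms] by simp
qed

text \<open>Each marker \<open>2\<close> removes one digit; the marker of entry \<open>n\<close>
  meets the separator and removes it as well, so the entry replaces the whole number. Pushing letter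
  by letter reverses it.\<close>

lemma drun_block:
  assumes "plain es" "n < length es" "set (es ! n) \<subseteq> {0, 1}" "\<beta> \<noteq> []"
  shows "drun (0, replicate n 0 @ 1 # \<beta>) (block es) = Some (0, rev (es ! n) @ \<beta>)"
  using assms
proof (induction n arbitrary: es)
  case 0
  then obtain e es' where es: "es = e # es'" by (cases es) auto
  then have "plain es'" using 0 by (auto simp: plain_def)
  then show ?case
    using 0 drun_copy[of \<beta> e] drun_end_entry[of "rev e @ \<beta>" es'] by (simp add: es block_simps etrans.simps drun_append)
next
  case (Suc n)
  then obtain e es' where es: "es = e # es'" by (cases es) auto
  then have "plain es'" "2 \<notin> set e" "3 \<notin> set e" using Suc by (auto simp: plain_def)
  then show ?case
    using Suc by (simp add: es block_simps etrans.simps drun_append drun_scan)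
qed

lemma drun_block_accept:
  assumes "plain es" "n < length es" "es ! n = [4]"
  shows "drun (0, replicate n 0 @ [2]) (block es) = Some (4, [2])"
  using assms
proof (induction n arbitrary: es)
  case 0
  then obtain es' where es: "es = [4] # es'" by (cases es) auto
  show ?case by (simp add: es block_simps etrans.simps drun_accept)
next
  case (Suc n)
  then obtain e es' where es: "es = e # es'" by (cases es) auto
  then have "plain es'" "2 \<notin> set e" "3 \<notin> set e" using Suc by (auto simp: plain_def)
  then show ?case
    using Suc by (simp add: es block_simps etrans.simps drun_append drun_scan)
qed

text \<open>The automaton gets stuck: a number beyond the table meets the final \<open>3\<close> in
  state \<open>0\<close>, and in state \<open>3\<close> there is no move on the letter after the
  marker, which is not \<open>4\<close>. For an empty entry that letter is the next marker or the
  end of the table.\<close>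

lemma drun_block_reject:
  assumes "plain es" "n < length es \<Longrightarrow> 4 \<notin> set (es ! n)"
  shows "drun (0, replicate n 0 @ [2]) (block es) = None"
  using assms
proof (induction n arbitrary: es)
  case 0
  show ?case
  proof (cases es)
    case Nil
    then show ?thesis by (simp add: block_simps etrans.simps)
  next
    case (Cons e es')
    then have "4 \<notin> set e" using 0 by auto
    then obtain x u where "e @ block es' = x # u" "x \<noteq> 4"
      by (cases e; cases es') (auto simp: block_simps)
    then show ?thesis by (simp add: Cons block_simps etrans.simps)
  qed
next
  case (Suc n)
  show ?case
  proof (cases es)
    case Nil
    then show ?thesis by (simp add: block_simps etrans.simps)
  next
    case (Cons e es')
    then have "plain es'" "2 \<notin> set e" "3 \<notin> set e" using Suc by (auto simp: plain_def)
    then show ?thesis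
      using Suc by (simp add: Cons block_simps etrans.simps drun_append drun_scan)
  qed
qed

section \<open>Arithmetic of entry numbers\<close>

lemma length_concat_const:
  "(\<And>i. i < n \<Longrightarrow> length (f i) = c) \<Longrightarrow> length (concat (map f [0..<n])) = n * c"
  by (induction n) auto

lemma nth_concat_const:
  assumes "\<And>i. i < n \<Longrightarrow> length (f i) = c" "i < n" "j < c"
  shows "concat (map f [0..<n]) ! (i * c + j) = f i ! j"
  using assms
proof (induction n)
  case (Suc n)
  have len: "length (concat (map f [0..<n])) = n * c"
    using Suc.prems by (intro length_concat_const) auto
  show ?case
  proof (cases "i < n")
    case True
    have "i * c + j < Suc i * c" using Suc.prems by simp
    also have "\<dots> \<le> n * c" using True by (intro mult_le_mono1) simp
    finally show ?thesis using Suc True len by (simp add: nth_append)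
  next
    case False
    then have "i = n" using Suc.prems by simp
    then show ?thesis using Suc.prems len by (simp add: nth_append)
  qed
qed simp

lemma mult_add_less: "i < n \<Longrightarrow> j < c \<Longrightarrow> i * c + j < n * (c :: nat)"
  by (metis add.commute less_le_trans mult_Suc mult_le_mono1 nat_add_left_cancel_less Suc_leI)

text \<open>The tuple, with all components lowered by one, read in base \<open>k\<close>: its rank
  in lexicographic order. In Horner form, the value of one more child is appended by multiplying by
  \<open>k\<close> and adding.\<close>

definition tuple_index :: "nat \<Rightarrow> nat list \<Rightarrow> nat" where
  "tuple_index k xs = foldl (\<lambda>a v. a * k + (v - 1)) 0 xs"

lemma tuple_index_snoc [simp]:
  "tuple_index k [] = 0" "tuple_index k (xs @ [v]) = tuple_index k xs * k + (v - 1)"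
  by (simp_all add: tuple_index_def)

lemma tuple_index_less: "set xs \<subseteq> {1..k} \<Longrightarrow> tuple_index k xs < k ^ length xs"
proof (induction xs rule: rev_induct)
  case (snoc v xs)
  then have "tuple_index k xs * k + (v - 1) < k ^ length xs * k"
    by (intro mult_add_less) auto
  then show ?case by (simp add: mult.commute)
qed simp

text \<open>\<open>E\<close> lists the elements of an instance in the order of the encoding:
  \<open>K\<close> values for each internal node, then the leaves.\<close>

definition table_fun :: "nat \<Rightarrow> nat \<Rightarrow> (nat \<Rightarrow> nat) \<Rightarrow> nat \<Rightarrow> nat list \<Rightarrow> nat" where
  "table_fun k K E i x = E ((i - 1) * K + tuple_index k x)"

definition table_leaf :: "nat \<Rightarrow> nat \<Rightarrow> (nat \<Rightarrow> nat) \<Rightarrow> nat \<Rightarrow> nat" where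
  "table_leaf K I E i = E (I * K + (i - I - 1))"

text \<open>Entry number \<open>(i * (d + 1) + j) * K + y\<close> belongs to the moment when the first \<open>j\<close> children of
  node \<open>i\<close> have been evaluated and \<open>y\<close> is the index of their values. A call pushes the number of the
  next entry of the caller less the value that is to be returned; returning \<open>v\<close> pushes \<open>v\<close>
  digits and thereby completes that number.\<close>

definition entry :: "nat \<Rightarrow> nat \<Rightarrow> nat \<Rightarrow> nat \<Rightarrow> (nat \<Rightarrow> nat) \<Rightarrow> nat \<Rightarrow> nat \<Rightarrow> nat \<Rightarrow> nat list" where
  "entry d k K I E i j y =
    (if i = 0 then if j * K + y = 1 then [4] else []
     else if I < i then replicate (E (I * K + (i - I - 1))) 0
     else if j < d then
       1 # replicate ((i * (d + 1) + (j + 1)) * K + y * k - 1) 0 @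
       1 # replicate (child d i j * (d + 1) * K) 0
     else replicate (E ((i - 1) * K + y)) 0)"

definition table :: "nat \<Rightarrow> nat \<Rightarrow> nat \<Rightarrow> nat \<Rightarrow> nat \<Rightarrow> (nat \<Rightarrow> nat) \<Rightarrow> nat list list" where
  "table d k K I F E = concat (map (\<lambda>i. concat (map (\<lambda>j. map (entry d k K I E i j) [0..<K]) [0..<d + 1]))
     [0..<I + F + 1])"

lemma length_table: "length (table d k K I F E) = (I + F + 1) * ((d + 1) * K)"
  unfolding table_def by (intro length_concat_const) simp_all

lemma nth_table:
  assumes "i < I + F + 1" "j < d + 1" "y < K"
  shows "(i * (d + 1) + j) * K + y < length (table d k K I F E)"
    and "table d k K I F E ! ((i * (d + 1) + j) * K + y) = entry d k K I E i j y"
proof -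
  have eq: "(i * (d + 1) + j) * K + y = i * ((d + 1) * K) + (j * K + y)"
    by (simp add: algebra_simps)
  have less: "j * K + y < (d + 1) * K"
    using assms by (intro mult_add_less)
  show "(i * (d + 1) + j) * K + y < length (table d k K I F E)"
    unfolding eq length_table using assms less by (intro mult_add_less)
  have "table d k K I F E ! (i * ((d + 1) * K) + (j * K + y)) =
      concat (map (\<lambda>j. map (entry d k K I E i j) [0..<K]) [0..<d + 1]) ! (j * K + y)"
    unfolding table_def
    by (intro nth_concat_const length_concat_const) (use assms less in auto)
  also have "\<dots> = map (entry d k K I E i j) [0..<K] ! y"
    by (intro nth_concat_const) (use assms in auto)
  finally show "table d k K I F E ! ((i * (d + 1) + j) * K + y) = entry d k K I E i j y"
    unfolding eq using assms by simp
qed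

lemma table_cases:
  assumes "n < length (table d k K I F E)"
  obtains i j y where "i < I + F + 1" "j < d + 1" "y < K" "n = (i * (d + 1) + j) * K + y"
proof
  have K: "0 < K" using assms by (cases K) (auto simp: length_table)
  have n: "n < (I + F + 1) * ((d + 1) * K)" using assms by (simp add: length_table)
  let ?j = "n div K"
  show "n = (?j div (d + 1) * (d + 1) + ?j mod (d + 1)) * K + n mod K"
    by (simp only: div_mult_mod_eq)
  show "?j mod (d + 1) < d + 1" "n mod K < K" using K by auto
  have "?j < (I + F + 1) * (d + 1)"
    using n by (subst div_less_iff_less_mult[OF K]) (simp only: mult.assoc)
  then show "?j div (d + 1) < I + F + 1"
    by (subst div_less_iff_less_mult) auto
qed

lemma plain_table: "plain (table d k K I F E)"
  unfolding plain_def table_def entry_def by (auto split: if_splits)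

lemma table_no_accept:
  assumes "n < length (table d k K I F E)" "n \<noteq> 1"
  shows "4 \<notin> set (table d k K I F E ! n)"
proof -
  obtain i j y where i: "i < I + F + 1" "j < d + 1" "y < K" "n = (i * (d + 1) + j) * K + y"
    using table_cases[OF assms(1)] .
  have "j * K + y \<noteq> 1" if "i = 0" using assms(2) i(4) that by simp
  then show ?thesis unfolding i(4) nth_table(2)[OF i(1-3)] by (auto simp: entry_def)
qed

lemma table_accept:
  assumes "1 \<le> d" "1 \<le> K"
  shows "1 < length (table d k K I F E)" "table d k K I F E ! 1 = [4]"
proof -
  \<comment> \<open>Entry \<open>1\<close> sits at \<open>j = 1\<close>, \<open>y = 0\<close> if
    \<open>K = 1\<close>, where \<open>1 \<le> d\<close> provides the row, and at
    \<open>j = 0\<close>, \<open>y = 1\<close> otherwise.\<close>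
  have "\<exists>j y. j < d + 1 \<and> y < K \<and> j * K + y = 1"
    using assms by (cases "K = 1") (intro exI[of _ 1] exI[of _ 0], simp, intro exI[of _ 0] exI[of _ 1], simp)
  then obtain j y where "j < d + 1" "y < K" "j * K + y = 1" by blast
  then show "1 < length (table d k K I F E)" "table d k K I F E ! 1 = [4]"
    using nth_table[of 0 I F j d y K k E] by (auto simp: entry_def)
qed

section \<open>Levels of the tree and the number of lookups\<close>

fun steps :: "nat \<Rightarrow> nat \<Rightarrow> nat" where
  "steps d 0 = 1"
| "steps d (Suc m) = d * (1 + steps d m) + 1"

text \<open>In heap numbering the nodes at depth \<open>t\<close> are those \<open>i\<close> with
  \<open>level_start d t < i \<le> level_start d (Suc t)\<close>.\<close>

definition level_start :: "nat \<Rightarrow> nat \<Rightarrow> nat" where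
  "level_start d t = (\<Sum>l<t. d ^ l)"

lemma level_start_simps: "level_start d 0 = 0" "level_start d (Suc t) = 1 + d * level_start d t"
  by (simp_all add: level_start_def sum.lessThan_Suc_shift sum_distrib_left del: sum.lessThan_Suc)

lemma level_start_Suc: "level_start d (Suc t) = level_start d t + d ^ t"
  by (simp add: level_start_def)

text \<open>\<open>steps\<close> counts lookups: an internal node makes one per call of a child and
  one to return, a leaf makes one. So no node makes more than \<open>d + 1\<close>, and the
  right-hand side multiplies this by the number of nodes.\<close>

lemma steps_le: "steps d m \<le> (d + 1) * level_start d (Suc m)"
proof (induction m)
  case (Suc m)
  have "steps d (Suc m) \<le> d * (1 + (d + 1) * level_start d (Suc m)) + 1"
    using Suc by simp
  also have "\<dots> = (d + 1) * level_start d (Suc (Suc m))"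
    by (simp add: level_start_simps(2)[of d "Suc m"] algebra_simps)
  finally show ?case .
qed (simp add: level_start_simps)

lemma child_level:
  assumes "level_start d t < i" "i \<le> level_start d (Suc t)" "j < d"
  shows "level_start d (Suc t) < child d i j" "child d i j \<le> level_start d (Suc (Suc t))"
proof -
  obtain i' where i: "i = Suc i'" using assms(1) by (cases i) auto
  have "d * level_start d t \<le> d * i'" using assms(1) i by (intro mult_left_mono) auto
  then show "level_start d (Suc t) < child d i j"
    by (simp only: child_def i level_start_simps diff_Suc_1)
  have "d * i \<le> d * level_start d (Suc t)" using assms(2) by (intro mult_left_mono) auto
  then show "child d i j \<le> level_start d (Suc (Suc t))"
    using assms(3) by (simp add: child_def i level_start_simps(2)[of d "Suc t"])
qed


text \<open>For a single leaf \<open>K\<close> may be a truncated number, so the equation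
  \<open>K = k ^ d\<close> is a premise only for \<open>2 \<le> h\<close>.\<close>

lemma node_value_range:
  assumes I: "I = level_start d (h - 1)" and h: "1 \<le> h" and K: "2 \<le> h \<Longrightarrow> K = k ^ d"
    and E: "\<And>e. e < I * K + d ^ (h - 1) \<Longrightarrow> E e \<in> {1..k}"
    and m: "m < h" "level_start d (h - 1 - m) < i" "i \<le> level_start d (h - m)"
  shows "node_value d (table_fun k K E) (table_leaf K I E) m i \<in> {1..k}"
  using m
proof (induction m arbitrary: i)
  case 0
  then have "i - I - 1 < d ^ (h - 1)"
    using I h level_start_Suc[of d "h - 1"] by auto
  then show ?case using E by (simp add: table_leaf_def)
next
  case (Suc m)
  let ?v = "\<lambda>j. node_value d (table_fun k K E) (table_leaf K I E) m (child d i j)"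
  have t: "h - m = Suc (h - Suc m)" "h - Suc m = Suc (h - 1 - Suc m)" "h - 1 - m = h - Suc m"
    using Suc.prems by auto
  have "?v j \<in> {1..k}" if "j < d" for j
    using child_level[of d "h - 1 - Suc m" i j] Suc.prems that t
    by (intro Suc.IH) auto
  then have "set (map ?v [0..<d]) \<subseteq> {1..k}" by auto
  then have "tuple_index k (map ?v [0..<d]) < K"
    using tuple_index_less[of "map ?v [0..<d]" k] K Suc.prems by simp
  moreover have "i - 1 < I"
  proof -
    have "level_start d (h - Suc m) \<le> I"
      unfolding I level_start_def using Suc.prems by (intro sum_mono2) auto
    then show ?thesis using Suc.prems by simp
  qed
  ultimately have "(i - 1) * K + tuple_index k (map ?v [0..<d]) < I * K"
    by (rule mult_add_less[rotated])
  then have "E ((i - 1) * K + tuple_index k (map ?v [0..<d])) \<in> {1..k}"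
    by (intro E) simp
  then show ?case by (simp only: node_value.simps table_fun_def[of k K E i])
qed

section \<open>Evaluation of a tree by the automaton\<close>

context
  fixes d h k K I F :: nat and E :: "nat \<Rightarrow> nat"
  assumes d: "1 \<le> d" and h: "1 \<le> h" and K: "1 \<le> K" "2 \<le> h \<Longrightarrow> K = k ^ d"
    and I: "I = level_start d (h - 1)" and F: "F = d ^ (h - 1)"
    and E: "\<And>e. e < I * K + F \<Longrightarrow> E e \<in> {1..k}"
begin

abbreviation "tree_val \<equiv> node_value d (table_fun k K E) (table_leaf K I E)"
abbreviation "entries \<equiv> table d k K I F E"

lemma drun_entry:
  assumes "1 \<le> i" "i \<le> I + F" "j < d + 1" "y < K" "\<beta> \<noteq> []"
  shows "drun (0, replicate ((i * (d + 1) + j) * K + y) 0 @ 1 # \<beta>) (block entries) =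
    Some (0, rev (entry d k K I E i j y) @ \<beta>)"
proof -
  have i: "i < I + F + 1" using assms by simp
  have "set (entry d k K I E i j y) \<subseteq> {0, 1}"
    using assms by (auto simp: entry_def)
  then show ?thesis
    using drun_block[OF plain_table nth_table(1)[OF i assms(3,4)], of k E \<beta>]
      assms(5) nth_table(2)[OF i assms(3,4)] by simp
qed

text \<open>Evaluation replaces the number of a node and its separator by the unary value, on top of
  any \<open>\<beta>\<close>. The generality in \<open>\<beta>\<close> carries the induction: if
  \<open>\<beta>\<close> starts with the unfinished number of a caller, the returned digits complete
  it.\<close>

lemma drun_eval:
  assumes "m < h" "level_start d (h - 1 - m) < i" "i \<le> level_start d (h - m)" "\<beta> \<noteq> []"
  shows "drun (0, replicate (i * (d + 1) * K) 0 @ 1 # \<beta>) (concat (replicate (steps d m) (block entries))) =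
    Some (0, replicate (tree_val m i) 0 @ \<beta>)"
  using assms
proof (induction m arbitrary: i \<beta>)
  case 0
  then have i: "I < i" "i \<le> I + F" "1 \<le> i"
    using I F h level_start_Suc[of d "h - 1"] by auto
  show ?case
    using drun_entry[of i 0 0 \<beta>] i K(1) 0 by (simp add: entry_def table_leaf_def)
next
  case (Suc m)
  note eval = Suc.IH
  let ?B = "\<lambda>n. concat (replicate n (block entries))"
  let ?v = "\<lambda>j. tree_val m (child d i j)"
  let ?y = "\<lambda>j. tuple_index k (map ?v [0..<j])"
  let ?num = "\<lambda>j. (i * (d + 1) + j) * K + ?y j"
  have t: "h - m = Suc (h - Suc m)" "h - Suc m = Suc (h - 1 - Suc m)" "h - 1 - m = h - Suc m"
    using Suc.prems by auto
  have i: "1 \<le> i" "i \<le> I"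
  proof -
    have "level_start d (h - Suc m) \<le> I"
      unfolding I level_start_def using Suc.prems by (intro sum_mono2) auto
    then show "1 \<le> i" "i \<le> I" using Suc.prems by auto
  qed
  have child: "level_start d (h - 1 - m) < child d i j" "child d i j \<le> level_start d (h - m)"
    if "j < d" for j
    using child_level[of d "h - 1 - Suc m" i j] Suc.prems that t by auto
  have v: "?v j \<in> {1..k}" if "j < d" for j
    using child[OF that] Suc.prems E F K(2) I h
    by (intro node_value_range[of I d h K k E]) auto
  have k: "1 \<le> k" using v[of 0] d by auto
  have y: "?y j < K" if "j \<le> d" for j
  proof -
    have "set (map ?v [0..<j]) \<subseteq> {1..k}" using v that by auto
    from tuple_index_less[OF this] have "?y j < k ^ j" by simp
    also have "k ^ j \<le> K" using that K(2) Suc.prems k by (auto intro: power_increasing)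
    finally show ?thesis .
  qed
  \<comment> \<open>One round per child: the call, the evaluation of the child, and then the number
    of the caller's next state on top of the stack.\<close>
  have "drun (0, replicate (?num 0) 0 @ 1 # \<beta>) (?B (j * (1 + steps d m))) =
      Some (0, replicate (?num j) 0 @ 1 # \<beta>)" if "j \<le> d" for j
    using that
  proof (induction j)
    case (Suc j)
    \<comment> \<open>The \<open>- 1\<close> compensates for \<open>tuple_index\<close> adding
      \<open>v - 1\<close> where the return pushes \<open>v\<close> digits; the subtraction is not
      truncated because \<open>K\<close> is positive.\<close>
    let ?base = "(i * (d + 1) + (j + 1)) * K + ?y j * k - 1"
    have "?num (Suc j) = ?base + ?v j"
    proof -
      have "1 \<le> (i * (d + 1) + (j + 1)) * K" using K(1) by simp
      moreover have "1 \<le> ?v j" using v[of j] Suc.prems by auto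
      ultimately show ?thesis by simp
    qed
    then have stack: "replicate (?v j) 0 @ replicate ?base 0 @ 1 # \<beta> = replicate (?num (Suc j)) 0 @ 1 # \<beta>"
      by (simp only: append_assoc[symmetric] replicate_add[symmetric] add.commute)
    have "drun (0, replicate (?num j) 0 @ 1 # \<beta>) (block entries) =
        Some (0, replicate (child d i j * (d + 1) * K) 0 @ 1 # replicate ?base 0 @ 1 # \<beta>)"
      using drun_entry[of i j "?y j" \<beta>] i y[of j] Suc.prems \<open>\<beta> \<noteq> []\<close> by (simp add: entry_def)
    moreover have "drun (0, replicate (child d i j * (d + 1) * K) 0 @ 1 # replicate ?base 0 @ 1 # \<beta>)
        (?B (steps d m)) = Some (0, replicate (?v j) 0 @ replicate ?base 0 @ 1 # \<beta>)"
      using Suc.prems \<open>Suc m < h\<close> child[of j] by (intro eval) auto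
    moreover have "drun (0, replicate (?num 0) 0 @ 1 # \<beta>) (?B (j * (1 + steps d m))) =
      Some (0, replicate (?num j) 0 @ 1 # \<beta>)" using Suc by simp
    moreover have "?B (Suc j * (1 + steps d m)) = ?B (j * (1 + steps d m)) @ block entries @ ?B (steps d m)"
    proof -
      have "Suc j * (1 + steps d m) = j * (1 + steps d m) + Suc (steps d m)" by simp
      then show ?thesis by (simp only: replicate_add concat_append replicate_Suc concat.simps)
    qed
    ultimately show ?case unfolding stack by (simp add: drun_append)
  qed simp
  from this[of d] have "drun (0, replicate (i * (d + 1) * K) 0 @ 1 # \<beta>) (?B (d * (1 + steps d m))) =
      Some (0, replicate (?num d) 0 @ 1 # \<beta>)" by simp
  moreover have "drun (0, replicate (?num d) 0 @ 1 # \<beta>) (block entries) = Some (0, replicate (tree_val (Suc m) i) 0 @ \<beta>)"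
    using drun_entry[of i d "?y d" \<beta>] i y[of d] \<open>\<beta> \<noteq> []\<close> by (simp add: entry_def table_fun_def)
  moreover have "?B (steps d (Suc m)) = ?B (d * (1 + steps d m)) @ block entries"
    by (simp only: steps.simps replicate_add concat_append) simp
  ultimately show ?case by (simp add: drun_append)
qed

text \<open>The root returns onto the bottom symbol, so its value becomes an entry number without
  separator. The lookup of that number needs one copy beyond \<open>steps\<close>, hence the strict
  bound; an accepting run ignores all further copies.\<close>

lemma drun_evaluate:
  assumes "steps d (h - 1) < T"
  shows "(\<exists>\<beta>. drun (1, [2]) (1 # replicate ((d + 1) * K) 0 @ 3 # concat (replicate T (block entries))) = Some (4, \<beta>)) \<longleftrightarrow>
    tree_val (h - 1) 1 = 1"
proof -
  let ?B = "\<lambda>n. concat (replicate n (block entries))"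
  let ?s = "1 # replicate ((d + 1) * K) 0" and ?v = "tree_val (h - 1) 1"
  obtain n where n: "T = steps d (h - 1) + Suc n"
    using assms less_iff_Suc_add by auto
  have "drun (1, [2]) ?s = Some (1, replicate ((d + 1) * K) 0 @ [1, 2])"
    using drun_copy[of "[2]" ?s] by (simp add: set_replicate_conv_if del: drun.simps)
  then have "drun (1, [2]) (?s @ 3 # ?B T) = drun (0, replicate ((d + 1) * K) 0 @ [1, 2]) (?B T)"
    using d K(1) unfolding drun_append by (cases "(d + 1) * K") (auto simp: etrans.simps)
  also have "\<dots> = drun (0, replicate ?v 0 @ [2]) (block entries @ ?B n)"
  proof -
    have "?B T = ?B (steps d (h - 1)) @ block entries @ ?B n"
      by (simp only: n replicate_add concat_append replicate_Suc concat.simps)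
    then show ?thesis
      using drun_eval[of "h - 1" 1 "[2]"] h by (simp add: drun_append level_start_simps)
  qed
  finally have eq: "drun (1, [2]) (?s @ 3 # ?B T) = drun (0, replicate ?v 0 @ [2]) (block entries @ ?B n)" .
  show ?thesis
  proof (cases "?v = 1")
    case True
    have "drun (0, replicate ?v 0 @ [2]) (block entries) = Some (4, [2])"
      unfolding True by (intro drun_block_accept plain_table table_accept d K)
    then show ?thesis using True eq by (simp add: drun_append drun_accept)
  next
    case False
    have "drun (0, replicate ?v 0 @ [2]) (block entries) = None"
      using table_no_accept False by (intro drun_block_reject plain_table) auto
    then show ?thesis using False eq by (simp add: drun_append)
  qed
qed

end

section \<open>Reading encoded trees\<close>

definition num :: "bool list \<Rightarrow> nat" where
  "num bs = foldl (\<lambda>a b. 2 * a + of_bool b) 0 bs"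

lemma num_simps [simp]: "num [] = 0" "num (bs @ [b]) = 2 * num bs + of_bool b"
  by (simp_all add: num_def)

lemma num_less: "num bs < 2 ^ length bs"
  by (induction bs rule: rev_induct) (auto simp: of_bool_def)

lemma num_ge: "2 ^ length bs \<le> num (True # bs)"
proof (induction bs rule: rev_induct)
  case (snoc b bs)
  have "num (True # bs @ [b]) = 2 * num (True # bs) + of_bool b"
    using num_simps(2)[of "True # bs" b] by simp
  then show ?case using snoc by simp
qed (simp add: num_def)

lemma binary_Suc: "binary (Suc e) n = binary e (n div 2) @ [odd n]"
proof -
  have "[0..<Suc e] = 0 # map Suc [0..<e]"
    by (simp add: map_Suc_upt upt_conv_Cons)
  then have "rev [0..<Suc e] = map Suc (rev [0..<e]) @ [0]"
    by (simp add: rev_map)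
  then show ?thesis by (simp add: binary_def bit_0 bit_Suc)
qed

lemma length_binary [simp]: "length (binary e n) = e"
  by (simp add: binary_def)

lemma num_binary: "n < 2 ^ e \<Longrightarrow> num (binary e n) = n"
proof (induction e arbitrary: n)
  case 0
  then show ?case by (simp add: binary_def)
next
  case (Suc e)
  then have "num (binary e (n div 2)) = n div 2" by (intro Suc.IH) auto
  then show ?case by (simp add: binary_Suc)
qed

lemma binary_num: "binary (length bs) (num bs) = bs"
proof (induction bs rule: rev_induct)
  case (snoc b bs)
  have "(2 * num bs + of_bool b) div 2 = num bs" by (cases b) auto
  then show ?case using snoc by (simp add: binary_Suc)
qed (simp add: binary_def)

text \<open>Together with \<open>floorlog_num\<close> this shows that a leading one characterises
  numbers written without leading zeros, so testing one digit checks that a parameter is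
  canonical.\<close>

lemma hd_binary_floorlog:
  assumes "0 < n"
  shows "binary (floorlog 2 n) n ! 0"
proof -
  let ?e = "floorlog 2 n"
  obtain b bs where bs: "binary ?e n = b # bs"
    using assms by (cases "binary ?e n") (auto simp: floorlog_eq_zero_iff dest!: arg_cong[of _ _ length])
  have n: "2 ^ (?e - 1) \<le> n" "n < 2 ^ ?e" using floorlog_bounds[OF assms, of 2] by auto
  have len: "length bs = ?e - 1" using arg_cong[OF bs, of length] by simp
  have "b"
  proof (rule ccontr)
    assume "\<not> b"
    then have "num (b # bs) = num bs" by (simp add: num_def)
    also have "\<dots> < 2 ^ (?e - 1)" using num_less[of bs] len by simp
    finally show False using num_binary[OF n(2)] n(1) bs by simp
  qed
  then show ?thesis by (simp add: bs)
qed

lemma floorlog_num: "floorlog 2 (num (True # bs)) = Suc (length bs)"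
proof (rule antisym)
  show "floorlog 2 (num (True # bs)) \<le> Suc (length bs)"
    using num_less[of "True # bs"] by (intro floorlog_leI) auto
  show "Suc (length bs) \<le> floorlog 2 (num (True # bs))"
    using num_ge[of bs] by (intro floorlog_ge_SucI) auto
qed

section \<open>Saturated reading of parameters\<close>

lemma iterate_cong:
  "(\<And>t a. t < n \<Longrightarrow> f t a = g t a) \<Longrightarrow> iterate n f a = iterate n g a"
  by (induction n) auto

text \<open>If the truncated result of each round depends only on the truncated argument, truncating
  in every round is the same as truncating once at the end.\<close>

lemma iterate_saturate:
  assumes "\<And>t a. min (g t (min a N)) N = min (g t a) N" "a \<le> N"
  shows "iterate n (\<lambda>t a. min (g t a) N) a = min (iterate n g a) N"
  by (induction n) (use assms in auto)

lemma iterate_num: "iterate (length bs) (\<lambda>t a. 2 * a + of_bool (bs ! t)) 0 = num bs"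
proof (induction bs rule: rev_induct)
  case (snoc b bs)
  have "iterate (length bs) (\<lambda>t a. 2 * a + of_bool ((bs @ [b]) ! t)) 0 = num bs"
    unfolding snoc[symmetric] by (rule iterate_cong) (simp add: nth_append)
  then show ?case by simp
qed simp

definition readnum :: "bool list \<Rightarrow> (nat \<Rightarrow> nat) \<Rightarrow> nat \<Rightarrow> nat" where
  "readnum w g e = iterate e (\<lambda>t a. min (2 * a + bitval w (g t)) (Suc (length w))) 0"

lemma readnum_eq:
  assumes "length bs = e" "\<And>t. t < e \<Longrightarrow> g t < length w \<and> w ! g t = bs ! t"
  shows "readnum w g e = min (num bs) (Suc (length w))"
proof -
  have "readnum w g e = min (iterate e (\<lambda>t a. 2 * a + bitval w (g t)) 0) (Suc (length w))"
    unfolding readnum_def by (rule iterate_saturate) (simp_all add: min_def)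
  also have "iterate e (\<lambda>t a. 2 * a + bitval w (g t)) 0 = iterate e (\<lambda>t a. 2 * a + of_bool (bs ! t)) 0"
    by (rule iterate_cong) (use assms(2) in \<open>auto simp: bitval_def\<close>)
  also have "\<dots> = num bs" using iterate_num[of bs] assms(1) by simp
  finally show ?thesis .
qed

text \<open>Every digit of a parameter at position \<open>q\<close> is preceded by \<open>True\<close>; at the final \<open>False\<close> the
  accumulator stops growing.\<close>

definition paramlen :: "bool list \<Rightarrow> nat \<Rightarrow> nat" where
  "paramlen w q = iterate (length w) (\<lambda>t a. min (a + bitval w (q + 2 * a)) (Suc (length w))) 0"

lemma paramlen_eq:
  assumes "\<And>t. t < e \<Longrightarrow> bitval w (q + 2 * t) = 1" "bitval w (q + 2 * e) = 0"
  shows "paramlen w q = e"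
proof -
  have e: "e \<le> length w"
  proof (cases e)
    case (Suc t)
    then show ?thesis using assms(1)[of t] by (auto simp: bitval_def split: if_splits)
  qed simp
  have "iterate j (\<lambda>t a. min (a + bitval w (q + 2 * a)) (Suc (length w))) 0 = min j e" for j
  proof (induction j)
    case (Suc j)
    show ?case
    proof (cases "j < e")
      case True
      then show ?thesis using Suc assms(1)[of j] e by (simp add: min_def)
    next
      case False
      then show ?thesis using Suc assms(2) e by (simp add: min_def)
    qed
  qed simp
  then show ?thesis using e by (simp add: paramlen_def)
qed

text \<open>Holds for arbitrary words: beyond the end \<open>bitval\<close> is \<open>0\<close>, so
  a terminating zero always exists and the least one is found.\<close>

lemma paramlen_bits:
  shows "t < paramlen w q \<Longrightarrow> bitval w (q + 2 * t) = 1" and "bitval w (q + 2 * paramlen w q) = 0"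
proof -
  define e where "e = (LEAST e. bitval w (q + 2 * e) = 0)"
  have "bitval w (q + 2 * length w) = 0" by (simp add: bitval_def)
  then have e: "bitval w (q + 2 * e) = 0" unfolding e_def by (rule LeastI)
  have less: "bitval w (q + 2 * t) = 1" if "t < e" for t
    using not_less_Least[OF that[unfolded e_def]] by (auto simp: bitval_def split: if_splits)
  have "paramlen w q = e" by (rule paramlen_eq[OF less e])
  then show "t < paramlen w q \<Longrightarrow> bitval w (q + 2 * t) = 1" and "bitval w (q + 2 * paramlen w q) = 0"
    using less e by auto
qed

lemma encode_parameter_nth:
  assumes "e = floorlog 2 x"
  shows "length (encode_parameter x) = 2 * e + 1"
    and "t < e \<Longrightarrow> encode_parameter x ! (2 * t)"
    and "t < e \<Longrightarrow> encode_parameter x ! Suc (2 * t) = binary e x ! t"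
    and "\<not> encode_parameter x ! (2 * e)"
proof -
  let ?f = "\<lambda>t. [True, binary e x ! t]"
  have "map (\<lambda>b. [True, b]) (binary e x) = map ?f [0..<e]"
    by (intro nth_equalityI) auto
  then have enc: "encode_parameter x = concat (map ?f [0..<e]) @ [False]"
    by (simp add: encode_parameter_def assms)
  have len: "length (concat (map ?f [0..<e])) = e * 2"
    by (rule length_concat_const) simp
  have nth: "concat (map ?f [0..<e]) ! (t * 2 + j) = ?f t ! j" if "t < e" "j < 2" for t j
    using that by (intro nth_concat_const) auto
  show "length (encode_parameter x) = 2 * e + 1" unfolding enc by (simp add: len)
  show "t < e \<Longrightarrow> encode_parameter x ! (2 * t)"
    unfolding enc using nth[of t 0] by (simp add: nth_append len mult.commute[of t])
  show "t < e \<Longrightarrow> encode_parameter x ! Suc (2 * t) = binary e x ! t"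
    unfolding enc using nth[of t 1] by (simp add: nth_append len mult.commute[of t])
  show "\<not> encode_parameter x ! (2 * e)"
    unfolding enc by (simp add: nth_append len mult.commute[of e])
qed

abbreviation paramval :: "bool list \<Rightarrow> nat \<Rightarrow> nat \<Rightarrow> nat" where
  "paramval w q e \<equiv> readnum w (\<lambda>t. q + 1 + 2 * t) e"

lemma decode_parameter:
  assumes w: "w = u @ encode_parameter x @ v"
  shows "paramlen w (length u) = floorlog 2 x"
    and "paramval w (length u) (floorlog 2 x) = min x (Suc (length w))"
    and "0 < x \<Longrightarrow> bitval w (length u + 1) = 1"
proof -
  let ?e = "floorlog 2 x"
  note enc = encode_parameter_nth[where x = x, OF refl]
  have bit: "length u + j < length w \<and> w ! (length u + j) = encode_parameter x ! j"
    if "j < 2 * ?e + 1" for j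
    using that enc(1) by (simp add: w nth_append)
  show "paramlen w (length u) = ?e"
    by (rule paramlen_eq) (use bit[of "2 * ?e"] bit enc in \<open>auto simp: bitval_def\<close>)
  have x: "num (binary ?e x) = x"
    by (cases "x = 0") (use floorlog_bounds[of x 2] in \<open>auto intro!: num_binary simp: floorlog_eq_zero_iff\<close>)
  have "paramval w (length u) ?e = min (num (binary ?e x)) (Suc (length w))"
  proof (rule readnum_eq)
    fix t assume "t < ?e"
    then show "length u + 1 + 2 * t < length w \<and> w ! (length u + 1 + 2 * t) = binary ?e x ! t"
      using bit[of "Suc (2 * t)"] enc(3)[of t] by simp
  qed simp
  then show "paramval w (length u) ?e = min x (Suc (length w))" by (simp add: x)
  show "bitval w (length u + 1) = 1" if "0 < x"
  proof -
    have "?e \<noteq> 0" using that unfolding floorlog_eq_zero_iff by simp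
    then show ?thesis
      using bit[of 1] enc(3)[of 0] hd_binary_floorlog[OF that] by (simp add: bitval_def)
  qed
qed

text \<open>Converse of decoding: the checks made on an arbitrary word force a canonical parameter
  at position \<open>q\<close>. The witness is the full number spelled by the digits, without
  truncation.\<close>

lemma parse_parameter:
  assumes e: "e = paramlen w q" "0 < e" and one: "bitval w (q + 1) = 1" and q: "q + 2 * e < length w"
  obtains x where "0 < x" "floorlog 2 x = e" "drop q w = encode_parameter x @ drop (q + 2 * e + 1) w"
proof
  let ?bs = "map (\<lambda>t. w ! (q + 1 + 2 * t)) [0..<e]"
  have hd: "?bs = True # tl ?bs"
    using one e(2) by (cases e) (auto simp: bitval_def upt_conv_Cons simp del: upt_Suc split: if_splits)
  have pos: "2 ^ length (tl ?bs) \<le> num ?bs"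
    using num_ge[of "tl ?bs"] hd by simp
  show "0 < num ?bs" by (rule less_le_trans[OF _ pos]) simp
  show fl: "floorlog 2 (num ?bs) = e"
    using floorlog_num[of "tl ?bs"] hd e(2) by simp
  have bits: "w ! (q + 2 * t)" if "t < e" for t
    using paramlen_bits(1)[of t w q] that e by (auto simp: bitval_def split: if_splits)
  have last: "\<not> w ! (q + 2 * e)"
    using paramlen_bits(2)[of w q] q e by (auto simp: bitval_def split: if_splits)
  note enc = encode_parameter_nth[OF fl[symmetric]]
  have "take (2 * e + 1) (drop q w) = encode_parameter (num ?bs)"
  proof (rule nth_equalityI)
    show "length (take (2 * e + 1) (drop q w)) = length (encode_parameter (num ?bs))"
      using q enc(1) by simp
    fix j assume "j < length (take (2 * e + 1) (drop q w))"
    then have j: "j < 2 * e + 1" by simp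
    then have "take (2 * e + 1) (drop q w) ! j = w ! (q + j)" using q by simp
    also have "\<dots> = encode_parameter (num ?bs) ! j"
    proof (cases "j = 2 * e")
      case True
      then show ?thesis using last enc(4) by simp
    next
      case False
      define t where "t = j div 2"
      have t: "t < e" using j False by (simp add: t_def)
      have "binary e (num ?bs) ! t = w ! (q + 1 + 2 * t)"
        using binary_num[of ?bs] t by simp
      moreover have "j = 2 * t \<or> j = Suc (2 * t)" by (auto simp: t_def)
      ultimately show ?thesis using bits[OF t] enc(2,3)[OF t] by auto
    qed
    finally show "take (2 * e + 1) (drop q w) ! j = encode_parameter (num ?bs) ! j" .
  qed
  then show "drop q w = encode_parameter (num ?bs) @ drop (q + 2 * e + 1) w"
    by (metis append_take_drop_id drop_drop add.assoc add.commute)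
qed

section \<open>The list of elements\<close>

abbreviation element :: "bool list \<Rightarrow> nat \<Rightarrow> nat \<Rightarrow> nat \<Rightarrow> nat" where
  "element w p b t \<equiv> readnum w (\<lambda>x. p + t * b + x) b"

lemma decode_element:
  assumes w: "w = u @ concat (map (\<lambda>t. binary b (E t)) [0..<n])" and "t < n" "E t < 2 ^ b"
  shows "element w (length u) b t = min (E t) (Suc (length w))"
proof -
  have "element w (length u) b t = min (num (binary b (E t))) (Suc (length w))"
  proof (rule readnum_eq)
    fix x assume x: "x < b"
    let ?f = "\<lambda>t. binary b (E t)"
    have "length (concat (map ?f [0..<n])) = n * b" by (rule length_concat_const) simp
    moreover have "concat (map ?f [0..<n]) ! (t * b + x) = ?f t ! x"
      using assms x by (intro nth_concat_const) auto
    moreover have "t * b + x < n * b" using assms x by (intro mult_add_less)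
    ultimately show "length u + t * b + x < length w \<and> w ! (length u + t * b + x) = binary b (E t) ! x"
      by (simp add: w nth_append add.assoc)
  qed simp
  then show ?thesis using num_binary assms by simp
qed

text \<open>Any word of the right length splits into elements, but only with the bound
  \<open>2 ^ b\<close>; membership in \<open>{1..k}\<close> has to be tested separately.\<close>

lemma parse_elements:
  assumes "length v = n * b"
  obtains E where "v = concat (map (\<lambda>t. binary b (E t)) [0..<n])" "\<And>t. t < n \<Longrightarrow> E t < 2 ^ b"
proof
  let ?c = "\<lambda>t. take b (drop (t * b) v)"
  have len: "length (?c t) = b" if "t < n" for t
    using mult_le_mono1[of "Suc t" n b] that assms by simp
  have "take (j * b) v = concat (map (\<lambda>t. binary b (num (?c t))) [0..<j])" if "j \<le> n" for j
    using that
  proof (induction j)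
    case (Suc j)
    have "binary b (num (?c j)) = ?c j"
      using binary_num[of "?c j"] len[of j] Suc.prems by simp
    moreover have "take (Suc j * b) v = take (j * b) v @ ?c j"
      by (simp add: take_add add.commute[of b])
    ultimately show ?case using Suc by simp
  qed simp
  from this[of n] show "v = concat (map (\<lambda>t. binary b (num (?c t))) [0..<n])" using assms by simp
  show "num (?c t) < 2 ^ b" if "t < n" for t using num_less[of "?c t"] len[OF that] by simp
qed

lemma concat_map_mult:
  "concat (map (\<lambda>i. concat (map (\<lambda>t. f (i * c + t)) [0..<c])) [0..<n]) = concat (map f [0..<n * c])"
proof (induction n)
  case (Suc n)
  have "[0..<Suc n * c] = [0..<n * c] @ map (\<lambda>t. n * c + t) [0..<c]"
    using upt_add_eq_append[of 0 "n * c" c] map_add_upt[of "n * c" c] by (simp add: add.commute)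
  then show ?case using Suc by (simp add: comp_def)
qed simp

section \<open>Lexicographic rank of tuples\<close>

lemma tuple_index_Cons: "tuple_index k (x # xs) = (x - 1) * k ^ length xs + tuple_index k xs"
  by (induction xs rule: rev_induct)
    (simp_all add: tuple_index_def algebra_simps)

lemma set_tuples: "set (tuples d k) = {xs. length xs = d \<and> set xs \<subseteq> {1..k}}"
proof -
  have "list_all2 P xs (replicate d y) \<longleftrightarrow> length xs = d \<and> (\<forall>x\<in>set xs. P x y)"
    for P :: "nat \<Rightarrow> nat list \<Rightarrow> bool" and xs y
    by (auto simp: list_all2_conv_all_nth all_set_conv_all_nth)
  then show ?thesis unfolding tuples_def product_lists_set by (auto simp del: upt_Suc)
qed

text \<open>Rank and list position coincide, so the tables of node functions can be addressed by
  arithmetic alone.\<close>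

lemma map_tuple_index: "map (tuple_index k) (tuples d k) = [0..<k ^ d]"
proof (induction d)
  case 0
  then show ?case by (simp add: tuples_def)
next
  case (Suc d)
  have len: "length xs = d" if "xs \<in> set (tuples d k)" for xs
    using that by (simp add: set_tuples)
  have "map (tuple_index k) (tuples (Suc d) k) =
      concat (map (\<lambda>x. map (\<lambda>xs. tuple_index k (x # xs)) (tuples d k)) [1..<k + 1])"
    by (simp add: tuples_def map_concat comp_def del: upt_Suc)
  also have "\<dots> = concat (map (\<lambda>x. map (\<lambda>t. (x - 1) * k ^ d + t) (map (tuple_index k) (tuples d k))) [1..<k + 1])"
    by (intro arg_cong[of _ _ concat] map_cong refl) (simp add: tuple_index_Cons len)
  also have "\<dots> = concat (map (\<lambda>x. map (\<lambda>t. x * k ^ d + t) [0..<k ^ d]) [0..<k])"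
    unfolding Suc by (simp add: map_Suc_upt[symmetric] comp_def del: upt_Suc)
  also have "\<dots> = [0..<k * k ^ d]"
    using concat_map_mult[of "\<lambda>t. [t]" "k ^ d" k] by simp
  finally show ?case by simp
qed


lemma tuples_nth:
  assumes "t < k ^ d"
  shows "tuples d k ! t \<in> set (tuples d k)" "tuple_index k (tuples d k ! t) = t"
proof -
  have len: "length (tuples d k) = k ^ d"
    using arg_cong[OF map_tuple_index[of k d], of length] by simp
  then show "tuples d k ! t \<in> set (tuples d k)" using assms by simp
  have "map (tuple_index k) (tuples d k) ! t = [0..<k ^ d] ! t" by (simp add: map_tuple_index)
  then show "tuple_index k (tuples d k ! t) = t" using assms len by simp
qed

lemma tuples_index:
  assumes "xs \<in> set (tuples d k)"
  shows "tuple_index k xs < k ^ d" "tuples d k ! tuple_index k xs = xs"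
proof -
  have "length (tuples d k) = k ^ d"
    using arg_cong[OF map_tuple_index[of k d], of length] by simp
  then obtain t where t: "t < k ^ d" "xs = tuples d k ! t"
    using assms by (metis in_set_conv_nth)
  then show "tuple_index k xs < k ^ d" "tuples d k ! tuple_index k xs = xs"
    using tuples_nth[OF t(1)] by auto
qed

section \<open>Encoded trees as flat lists of elements\<close>

lemma num_internal_eq: "num_internal d h = level_start d (h - 1)"
  by (simp add: num_internal_def level_start_def)

definition header :: "nat \<Rightarrow> nat \<Rightarrow> nat \<Rightarrow> bool list" where
  "header d h k = encode_parameter d @ encode_parameter h @ encode_parameter k"

definition num_elements :: "nat \<Rightarrow> nat \<Rightarrow> nat \<Rightarrow> nat" where
  "num_elements d h k = level_start d (h - 1) * k ^ d + d ^ (h - 1)"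

definition tree_word :: "nat \<Rightarrow> nat \<Rightarrow> nat \<Rightarrow> (nat \<Rightarrow> nat) \<Rightarrow> bool list" where
  "tree_word d h k E = header d h k @ concat (map (\<lambda>t. binary (floorlog 2 k) (E t)) [0..<num_elements d h k])"

abbreviation tree_value :: "nat \<Rightarrow> nat \<Rightarrow> nat \<Rightarrow> (nat \<Rightarrow> nat) \<Rightarrow> nat" where
  "tree_value d h k E \<equiv>
     node_value d (table_fun k (k ^ d) E) (table_leaf (k ^ d) (level_start d (h - 1)) E) (h - 1) 1"

text \<open>Relates an instance to a flat list \<open>E\<close>, only at the arguments recorded by
  the encoding; elsewhere the functions may differ.\<close>

definition agrees :: "nat \<Rightarrow> nat \<Rightarrow> nat \<Rightarrow> (nat \<Rightarrow> nat list \<Rightarrow> nat) \<Rightarrow> (nat \<Rightarrow> nat) \<Rightarrow> (nat \<Rightarrow> nat) \<Rightarrow> bool" where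
  "agrees d h k f leaf E \<longleftrightarrow>
     (\<forall>i\<in>set (internal_nodes d h). \<forall>x\<in>set (tuples d k). f i x = table_fun k (k ^ d) E i x) \<and>
     (\<forall>i\<in>set (leaves d h). leaf i = table_leaf (k ^ d) (level_start d (h - 1)) E i)"

lemma encode_tree_eq:
  assumes "agrees d h k f leaf E"
  shows "encode_parameter d @ encode_tree d h k f leaf = tree_word d h k E"
proof -
  let ?I = "level_start d (h - 1)" and ?K = "k ^ d" and ?F = "d ^ (h - 1)"
  let ?g = "\<lambda>t. binary (floorlog 2 k) (E t)"
  have "concat (map (\<lambda>x. encode_element k (f i x)) (tuples d k)) =
      concat (map (\<lambda>t. ?g ((i - 1) * ?K + t)) [0..<?K])" if "i \<in> set (internal_nodes d h)" for i
  proof -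
    have "map (\<lambda>x. encode_element k (f i x)) (tuples d k) =
        map (\<lambda>t. ?g ((i - 1) * ?K + t)) (map (tuple_index k) (tuples d k))"
      using assms that by (auto simp: agrees_def table_fun_def encode_element_def)
    then show ?thesis by (simp only: map_tuple_index)
  qed
  then have "concat (map (\<lambda>i. concat (map (\<lambda>x. encode_element k (f i x)) (tuples d k))) (internal_nodes d h)) =
      concat (map (\<lambda>i. concat (map (\<lambda>t. ?g ((i - 1) * ?K + t)) [0..<?K])) (internal_nodes d h))"
    by (rule arg_cong[of _ _ concat, OF map_cong[OF refl]])
  also have "\<dots> = concat (map ?g [0..<?I * ?K])"
  proof -
    have "internal_nodes d h = map Suc [0..<?I]"
      by (simp add: internal_nodes_def num_internal_eq map_Suc_upt)
    then show ?thesis using concat_map_mult[of ?g ?K ?I] by (simp add: o_def)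
  qed
  finally have int: "concat (map (\<lambda>i. concat (map (\<lambda>x. encode_element k (f i x)) (tuples d k)))
      (internal_nodes d h)) = concat (map ?g [0..<?I * ?K])" .
  have leaves: "leaves d h = map (\<lambda>t. t + (?I + 1)) [0..<?F]"
    using map_add_upt[of "?I + 1" ?F] by (simp add: leaves_def num_internal_eq add.commute)
  have "map (\<lambda>i. encode_element k (leaf i)) (leaves d h) =
      map (\<lambda>i. ?g (?I * ?K + (i - ?I - 1))) (leaves d h)"
    using assms by (auto simp: agrees_def table_leaf_def encode_element_def)
  also have "\<dots> = map ?g (map (\<lambda>t. t + ?I * ?K) [0..<?F])"
    unfolding leaves by (simp add: o_def add.commute)
  also have "\<dots> = map ?g [?I * ?K..<?I * ?K + ?F]"
    using map_add_upt[of "?I * ?K" ?F] by (simp add: add.commute)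
  finally have leaf: "map (\<lambda>i. encode_element k (leaf i)) (leaves d h) = map ?g [?I * ?K..<?I * ?K + ?F]" .
  have "[0..<num_elements d h k] = [0..<?I * ?K] @ [?I * ?K..<?I * ?K + ?F]"
    using upt_add_eq_append[of 0 "?I * ?K" ?F] by (simp add: num_elements_def)
  then show ?thesis
    by (simp add: encode_tree_def tree_word_def header_def int leaf)
qed

text \<open>As agreement is limited to tuples over \<open>[k]\<close>, the children must be known to
  have values in \<open>{1..k}\<close>; this is where the range of \<open>E\<close> enters.\<close>

lemma node_value_agrees:
  assumes agr: "agrees d h k f leaf E" and h: "1 \<le> h"
    and E: "\<And>e. e < num_elements d h k \<Longrightarrow> E e \<in> {1..k}"
    and m: "m < h" "level_start d (h - 1 - m) < i" "i \<le> level_start d (h - m)"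
  shows "node_value d f leaf m i =
    node_value d (table_fun k (k ^ d) E) (table_leaf (k ^ d) (level_start d (h - 1)) E) m i"
  using m
proof (induction m arbitrary: i)
  case 0
  then have "i \<in> set (leaves d h)"
    using h level_start_Suc[of d "h - 1"] by (auto simp: leaves_def num_internal_eq)
  then show ?case using agr by (simp add: agrees_def)
next
  case (Suc m)
  let ?v = "\<lambda>j. node_value d (table_fun k (k ^ d) E) (table_leaf (k ^ d) (level_start d (h - 1)) E) m (child d i j)"
  have t: "h - m = Suc (h - Suc m)" "h - Suc m = Suc (h - 1 - Suc m)" "h - 1 - m = h - Suc m"
    using Suc.prems by auto
  have child: "level_start d (h - 1 - m) < child d i j" "child d i j \<le> level_start d (h - m)"
    if "j < d" for j
    using child_level[of d "h - 1 - Suc m" i j] Suc.prems that t by auto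
  have "?v j \<in> {1..k}" if "j < d" for j
    using child[OF that] Suc.prems E h
    by (intro node_value_range[OF refl]) (auto simp: num_elements_def)
  then have "map ?v [0..<d] \<in> set (tuples d k)" by (auto simp: set_tuples)
  moreover have "i \<in> set (internal_nodes d h)"
  proof -
    have "level_start d (h - Suc m) \<le> level_start d (h - 1)"
      unfolding level_start_def using Suc.prems by (intro sum_mono2) auto
    then show ?thesis using Suc.prems by (auto simp: internal_nodes_def num_internal_eq)
  qed
  moreover have "map (\<lambda>j. node_value d f leaf m (child d i j)) [0..<d] = map ?v [0..<d]"
  proof (rule map_cong[OF refl])
    fix j assume "j \<in> set [0..<d]"
    then show "node_value d f leaf m (child d i j) = ?v j"
      using child Suc.prems by (intro Suc.IH) auto
  qed
  ultimately show ?case using agr by (simp only: node_value.simps agrees_def)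
qed

lemma root_value_agrees:
  assumes "agrees d h k f leaf E" "1 \<le> h" "\<And>e. e < num_elements d h k \<Longrightarrow> E e \<in> {1..k}"
  shows "root_value d h f leaf = tree_value d h k E"
  unfolding root_value_def
  by (rule node_value_agrees[OF assms]) (use assms(2) in \<open>auto simp: level_start_simps\<close>)

lemma BT_degree_iff:
  "w \<in> BT_degree \<longleftrightarrow> (\<exists>d h k E. 2 \<le> d \<and> 1 \<le> h \<and> 1 \<le> k \<and> w = tree_word d h k E \<and>
     (\<forall>e<num_elements d h k. E e \<in> {1..k}) \<and> tree_value d h k E = 1)"
proof
  assume "w \<in> BT_degree"
  then obtain d h k f leaf where w: "w = encode_parameter d @ encode_tree d h k f leaf" "2 \<le> d"
    and inst: "tree_instance d h k f leaf" and root: "root_value d h f leaf = 1"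
    unfolding BT_degree_def by blast
  let ?I = "level_start d (h - 1)" and ?K = "k ^ d" and ?F = "d ^ (h - 1)"
  have h: "1 \<le> h" "1 \<le> k" using inst by (auto simp: tree_instance_def)
  \<comment> \<open>Inverts the indexing of \<open>table_fun\<close> and \<open>table_leaf\<close>:
    \<open>div\<close> recovers the node and \<open>mod\<close> the rank of the tuple.\<close>
  define E where "E e = (if e < ?I * ?K then f (e div ?K + 1) (tuples d k ! (e mod ?K))
    else leaf (e - ?I * ?K + ?I + 1))" for e
  have agr: "agrees d h k f leaf E"
    unfolding agrees_def
  proof (intro conjI ballI)
    fix i x assume i: "i \<in> set (internal_nodes d h)" and x: "x \<in> set (tuples d k)"
    have "i - 1 < ?I" "i \<ge> 1" using i by (auto simp: internal_nodes_def num_internal_eq)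
    moreover have t: "tuple_index k x < ?K" "tuples d k ! tuple_index k x = x"
      using tuples_index[OF x] by auto
    ultimately have "(i - 1) * ?K + tuple_index k x < ?I * ?K" by (intro mult_add_less)
    moreover have "((i - 1) * ?K + tuple_index k x) div ?K = i - 1"
      using t(1) h(2) by (subst div_mult_self3) auto
    ultimately show "f i x = table_fun k ?K E i x"
      using t \<open>i \<ge> 1\<close> by (simp add: table_fun_def E_def)
  next
    fix i assume "i \<in> set (leaves d h)"
    then have "?I + 1 \<le> i" by (auto simp: leaves_def num_internal_eq)
    then have "?I * ?K + (i - ?I - 1) - ?I * ?K + ?I + 1 = i" by simp
    then show "leaf i = table_leaf ?K ?I E i"
      unfolding table_leaf_def E_def by (simp only: not_add_less1 if_False)
  qed
  have range: "E e \<in> {1..k}" if e: "e < num_elements d h k" for e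
  proof (cases "e < ?I * ?K")
    case True
    have K: "0 < ?K" using h by simp
    have "e div ?K < ?I" using True K by (simp add: div_less_iff_less_mult)
    then have "e div ?K + 1 \<in> set (internal_nodes d h)"
      by (auto simp: internal_nodes_def num_internal_eq)
    moreover have "tuples d k ! (e mod ?K) \<in> set (tuples d k)"
      using K by (intro tuples_nth) simp
    ultimately show ?thesis using inst True by (simp add: tree_instance_def E_def)
  next
    case False
    have "e - ?I * ?K < ?F" using False e by (simp add: num_elements_def)
    then have "e - ?I * ?K + ?I + 1 \<in> set (leaves d h)"
      unfolding leaves_def num_internal_eq set_upt by simp
    then show ?thesis using inst False by (simp add: tree_instance_def E_def)
  qed
  show "\<exists>d h k E. 2 \<le> d \<and> 1 \<le> h \<and> 1 \<le> k \<and> w = tree_word d h k E \<and>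
     (\<forall>e<num_elements d h k. E e \<in> {1..k}) \<and> tree_value d h k E = 1"
    using encode_tree_eq[OF agr] root_value_agrees[OF agr h(1) range] range w h root by metis
next
  assume "\<exists>d h k E. 2 \<le> d \<and> 1 \<le> h \<and> 1 \<le> k \<and> w = tree_word d h k E \<and>
     (\<forall>e<num_elements d h k. E e \<in> {1..k}) \<and> tree_value d h k E = 1"
  then obtain d h k E where *: "2 \<le> d" "1 \<le> h" "1 \<le> k" "w = tree_word d h k E"
    "\<And>e. e < num_elements d h k \<Longrightarrow> E e \<in> {1..k}" "tree_value d h k E = 1" by blast
  let ?I = "level_start d (h - 1)" and ?K = "k ^ d" and ?F = "d ^ (h - 1)"
  let ?f = "table_fun k ?K E" and ?leaf = "table_leaf ?K ?I E"
  have agr: "agrees d h k ?f ?leaf E" by (simp add: agrees_def)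
  have "tree_instance d h k ?f ?leaf"
    unfolding tree_instance_def
  proof (intro conjI ballI *)
    fix i x assume i: "i \<in> set (internal_nodes d h)" and x: "x \<in> set (tuples d k)"
    have "i - 1 < ?I" using i by (auto simp: internal_nodes_def num_internal_eq)
    then have "(i - 1) * ?K + tuple_index k x < ?I * ?K"
      using tuples_index[OF x] by (intro mult_add_less)
    then show "?f i x \<in> {1..k}"
      unfolding table_fun_def by (intro *(5)) (simp add: num_elements_def)
  next
    fix i assume "i \<in> set (leaves d h)"
    then show "?leaf i \<in> {1..k}"
      unfolding table_leaf_def by (intro *(5)) (auto simp: leaves_def num_internal_eq num_elements_def)
  qed
  moreover have "w = encode_parameter d @ encode_tree d h k ?f ?leaf"
    using encode_tree_eq[OF agr] *(4) by simp
  moreover have "root_value d h ?f ?leaf = 1"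
    using root_value_agrees[OF agr *(2,5)] *(6) by simp
  ultimately show "w \<in> BT_degree"
    unfolding BT_degree_def using *(1) by blast
qed


section \<open>Saturated sizes\<close>

lemma iterate_power: "iterate n (\<lambda>t a. a * b) 1 = b ^ n"
  by (induction n) auto

lemma iterate_level_start: "iterate n (\<lambda>t a. a * d + 1) 0 = level_start d n"
  by (induction n) (auto simp: level_start_simps)

text \<open>If \<open>a\<close> exceeds \<open>N\<close> and \<open>b\<close> is positive, both
  sides are already \<open>N\<close>; otherwise truncating \<open>a\<close> changes nothing, or
  \<open>b = 0\<close> removes it.\<close>

lemma min_mult_add: "min (min a N * b + c) N = min (a * b + c) (N :: nat)" if "0 < b \<or> c \<le> N"
proof (cases "a \<le> N \<or> b = 0")
  case False
  then have "N \<le> N * b" "N * b \<le> a * b" by auto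
  then have "N \<le> N * b + c" "N \<le> a * b + c" by linarith+
  moreover have "min a N = N" using False by simp
  ultimately show ?thesis by simp
qed auto

lemma iterate_min_power:
  assumes "1 \<le> N"
  shows "iterate n (\<lambda>t a. min (a * b) N) 1 = min (b ^ n) N"
  unfolding iterate_power[symmetric]
  by (rule iterate_saturate) (use min_mult_add[of b 0 N] assms in auto)

lemma iterate_min_level_start:
  "iterate n (\<lambda>t a. min (a * d + 1) N) 0 = min (level_start d n) N"
  unfolding iterate_level_start[symmetric]
proof (rule iterate_saturate)
  show "min (min a N * d + 1) N = min (a * d + 1) N" for a
    using min_mult_add[of d 1 N a] by (cases "d = 0") auto
qed simp

text \<open>The algorithm computes the saturated sizes \<open>min _ N\<close>; they are exact if the instance has an
  internal node and fits into the input.\<close>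

lemma sizes_exact:
  assumes "2 \<le> d" "2 \<le> h" "1 \<le> k" and "num_elements d h k < N"
  shows "d < N" "h < N" "k < N" "k ^ d < N" "level_start d (h - 1) < N" "d ^ (h - 1) < N"
proof -
  obtain t where t: "h - 1 = Suc t" using assms(2) by (cases "h - 1") auto
  have I: "1 \<le> level_start d (h - 1)" unfolding t by (simp add: level_start_simps)
  have K: "1 \<le> k ^ d" using assms by simp
  have IK: "k ^ d \<le> level_start d (h - 1) * k ^ d" "level_start d (h - 1) \<le> level_start d (h - 1) * k ^ d"
    using I K by simp_all
  then show "k ^ d < N" "level_start d (h - 1) < N" "d ^ (h - 1) < N"
    using assms(4) unfolding num_elements_def by linarith+
  moreover have "k \<le> k ^ d" using assms by (intro self_le_power) auto
  moreover have "d \<le> d ^ (h - 1)" using assms by (intro self_le_power) auto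
  moreover have "h \<le> d ^ (h - 1)"
  proof -
    have "h - 1 < 2 ^ (h - 1)" by (rule less_exp)
    also have "\<dots> \<le> d ^ (h - 1)" using assms by (intro power_mono) auto
    finally show ?thesis by simp
  qed
  ultimately show "d < N" "h < N" "k < N" by auto
qed

text \<open>A total below \<open>N\<close> shows that none of the three sizes was truncated. Then
  \<open>sizes_exact\<close>, applied to the truncated parameters themselves, puts these below
  \<open>N\<close>, so they were not truncated either.\<close>

lemma saturated_sizes_exact:
  assumes "2 \<le> d" "2 \<le> h" "1 \<le> k" "2 \<le> N"
    and d': "d' = min d N" and h': "h' = min h N" and k': "k' = min k N"
    and less: "min (level_start d' (h' - 1)) N * min (k' ^ d') N + min (d' ^ (h' - 1)) N < N"
  shows "d' = d" "h' = h" "k' = k" "num_elements d h k < N"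
proof -
  have *: "2 \<le> d'" "2 \<le> h'" "1 \<le> k'" using assms by auto
  obtain t where t: "h' - 1 = Suc t" using *(2) by (cases "h' - 1") auto
  have I: "1 \<le> level_start d' (h' - 1)" unfolding t by (simp add: level_start_simps)
  have K: "1 \<le> k' ^ d'" using * by simp
  let ?I = "min (level_start d' (h' - 1)) N" and ?K = "min (k' ^ d') N"
  have "1 \<le> ?I" "1 \<le> ?K" using I K assms(4) by auto
  then have "?K \<le> ?I * ?K" "?I \<le> ?I * ?K" by simp_all
  then have "?I < N" "?K < N" "min (d' ^ (h' - 1)) N < N" using less by linarith+
  then have "num_elements d' h' k' < N"
    using less by (simp add: num_elements_def min_def split: if_splits)
  moreover from this have "d' < N" "h' < N" "k' < N" using sizes_exact[OF *] by auto
  ultimately show "d' = d" "h' = h" "k' = k" "num_elements d h k < N"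
    using d' h' k' by (auto simp: min_def split: if_splits)
qed

section \<open>The reduction and its correctness\<close>

definition answer :: "nat \<Rightarrow> nat \<Rightarrow> nat \<Rightarrow> nat \<Rightarrow> nat \<Rightarrow> (nat \<Rightarrow> nat) \<Rightarrow> nat list" where
  "answer d k K I F E = 1 # replicate ((d + 1) * K) 0 @ 3 #
     concat (replicate ((I + F + 1) * ((d + 1) * K)) (block (table d k K I F E)))"

text \<open>Degree at least two is tested as \<open>2 \<le> e1\<close>, on the number of digits,
  which is never truncated. The three \<open>bitval\<close> tests exclude leading zeros.\<close>

definition reduce :: "bool list \<Rightarrow> nat list" where
  "reduce w =
    (let e1 = paramlen w 0; q1 = 2 * e1 + 1;
         e2 = paramlen w q1; q2 = q1 + 2 * e2 + 1;
         b = paramlen w q2; p = q2 + 2 * b + 1;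
         N = Suc (length w);
         d = paramval w 0 e1; h = paramval w q1 e2; k = paramval w q2 b;
         K = min (k ^ d) N; I = min (level_start d (h - 1)) N; F = min (d ^ (h - 1)) N
     in if 2 \<le> e1 \<and> 1 \<le> e2 \<and> 1 \<le> b \<and> bitval w 1 = 1 \<and> bitval w (q1 + 1) = 1 \<and> bitval w (q2 + 1) = 1 \<and>
          p + (I * K + F) * b = length w \<and>
          (\<forall>t<I * K + F. 1 \<le> element w p b t \<and> element w p b t \<le> k)
        then answer d k K I F (element w p b) else [])"

lemma tree_value_cong:
  assumes "num_elements d h k \<le> n" "\<And>t. t < n \<Longrightarrow> E t = E' t" "1 \<le> h" "\<And>t. t < num_elements d h k \<Longrightarrow> E' t \<in> {1..k}"
  shows "tree_value d h k E = tree_value d h k E'"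
proof -
  have "agrees d h k (table_fun k (k ^ d) E) (table_leaf (k ^ d) (level_start d (h - 1)) E) E'"
    unfolding agrees_def
  proof (intro conjI ballI)
    fix i x assume i: "i \<in> set (internal_nodes d h)" and x: "x \<in> set (tuples d k)"
    have "i - 1 < level_start d (h - 1)" using i by (auto simp: internal_nodes_def num_internal_eq)
    then have "(i - 1) * k ^ d + tuple_index k x < level_start d (h - 1) * k ^ d"
      using tuples_index[OF x] by (intro mult_add_less)
    then show "table_fun k (k ^ d) E i x = table_fun k (k ^ d) E' i x"
      unfolding table_fun_def using assms(1) by (intro assms(2)) (simp add: num_elements_def)
  next
    fix i assume "i \<in> set (leaves d h)"
    then show "table_leaf (k ^ d) (level_start d (h - 1)) E i = table_leaf (k ^ d) (level_start d (h - 1)) E' i"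
      unfolding table_leaf_def using assms(1)
      by (intro assms(2)) (auto simp: leaves_def num_internal_eq num_elements_def)
  qed
  then show ?thesis
    using root_value_agrees[of d h k _ _ E'] assms unfolding root_value_def by blast
qed

lemma set_answer: "set (answer d k K I F E) \<subseteq> {..4}"
proof -
  have "set (entry d k K I E i j y) \<subseteq> {0, 1, 4}" for i j y
    by (auto simp: entry_def)
  then have "x \<le> 4" if "e \<in> set (table d k K I F E)" "x \<in> set e" for e x
    using that unfolding table_def by fastforce
  then have "set (block (table d k K I F E)) \<subseteq> {..4}"
    by (auto simp: block_def)
  then have c: "set (concat (replicate n (block (table d k K I F E)))) \<subseteq> {..4}" for n
    by (induction n) auto
  have *: "set (1 # u @ 3 # v) \<subseteq> {..4}" if "set v \<subseteq> {..4}" "set u \<subseteq> {0}" for u v :: "nat list"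
    using that by auto
  show ?thesis unfolding answer_def by (rule *[OF c]) auto
qed

lemma answer_accepts:
  assumes "1 \<le> d" "1 \<le> h" "1 \<le> K" "2 \<le> h \<Longrightarrow> K = k ^ d" "I = level_start d (h - 1)" "F = d ^ (h - 1)"
    and "\<And>e. e < I * K + F \<Longrightarrow> E e \<in> {1..k}"
  shows "answer d k K I F E \<in> dpda_language evaluator \<longleftrightarrow>
    node_value d (table_fun k K E) (table_leaf K I E) (h - 1) 1 = 1"
proof -
  \<comment> \<open>\<open>answer\<close> contains as many copies of the table as the table has
    entries: a number that is easy to compute and exceeds the number of lookups.\<close>
  have "steps d (h - 1) \<le> (d + 1) * (I + F)"
    using steps_le[of d "h - 1"] level_start_Suc[of d "h - 1"] assms(5,6) by simp
  also have "\<dots> < (d + 1) * (I + F + 1)" by simp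
  also have "\<dots> \<le> (d + 1) * (I + F + 1) * K"
    using mult_le_mono2[OF assms(3), of "(d + 1) * (I + F + 1)"] by (simp only: mult_1_right)
  also have "\<dots> = (I + F + 1) * ((d + 1) * K)" by (simp only: ac_simps)
  finally have "steps d (h - 1) < (I + F + 1) * ((d + 1) * K)" .
  from drun_evaluate[of d h K k I F E, OF assms this] show ?thesis
    unfolding language_evaluator answer_def[symmetric] using set_answer by blast
qed

lemma length_encode_parameter: "length (encode_parameter x) = 2 * floorlog 2 x + 1"
  using encode_parameter_nth(1)[OF refl] .

lemma length_header:
  "length (header d h k) = 2 * floorlog 2 d + 1 + 2 * floorlog 2 h + 1 + 2 * floorlog 2 k + 1"
  by (simp add: header_def length_encode_parameter)

lemma reduce_header:
  fixes v :: "bool list"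
  assumes w: "w = header d h k @ v" and pos: "1 \<le> d" "1 \<le> h" "1 \<le> k"
    and N: "N = Suc (length w)" and d': "d' = min d N" and h': "h' = min h N" and k': "k' = min k N"
    and K: "K = min (k' ^ d') N" and I: "I = min (level_start d' (h' - 1)) N" and F: "F = min (d' ^ (h' - 1)) N"
  shows "reduce w = (if 2 \<le> d \<and> (I * K + F) * floorlog 2 k = length v \<and>
      (\<forall>t<I * K + F. element w (length (header d h k)) (floorlog 2 k) t \<in> {1..k'})
    then answer d' k' K I F (element w (length (header d h k)) (floorlog 2 k)) else [])"
proof -
  define e1 q1 e2 q2 b p where defs: "e1 = floorlog 2 d" "q1 = 2 * e1 + 1" "e2 = floorlog 2 h"
    "q2 = q1 + 2 * e2 + 1" "b = floorlog 2 k" "p = q2 + 2 * b + 1"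
  have p: "length (header d h k) = p" by (simp add: length_header defs)
  have 1: "w = [] @ encode_parameter d @ (encode_parameter h @ encode_parameter k @ v)"
    by (simp add: w header_def)
  have 2: "w = encode_parameter d @ encode_parameter h @ (encode_parameter k @ v)"
    by (simp add: w header_def)
  have 3: "w = (encode_parameter d @ encode_parameter h) @ encode_parameter k @ v"
    by (simp add: w header_def)
  have len: "length (encode_parameter d) = q1" "q1 + length (encode_parameter h) = q2"
    by (simp_all add: length_encode_parameter defs)
  have dec: "paramlen w 0 = e1" "paramval w 0 e1 = d'" "bitval w 1 = 1"
    "paramlen w q1 = e2" "paramval w q1 e2 = h'" "bitval w (q1 + 1) = 1"
    "paramlen w q2 = b" "paramval w q2 b = k'" "bitval w (q2 + 1) = 1"
    using decode_parameter[OF 1] decode_parameter[OF 2] decode_parameter[OF 3] pos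
    by (simp_all add: len defs(1,3,5)[symmetric] d' h' k' N)
  have pos': "1 \<le> e2" "1 \<le> b"
    using pos floorlog_eq_zero_iff[of 2 h] floorlog_eq_zero_iff[of 2 k] by (auto simp: defs(3,5))
  have two: "2 \<le> e1 \<longleftrightarrow> 2 \<le> d"
    using floorlog_geD[of 2 2 d] floorlog_ge_SucI[of 2 1 d] by (auto simp: defs(1) numeral_2_eq_2)
  have "p + (I * K + F) * b = length w \<longleftrightarrow> (I * K + F) * b = length v"
    using p by (simp add: w)
  then show ?thesis
    unfolding reduce_def Let_def dec(1) defs(2)[symmetric] dec(2,4) defs(4)[symmetric] dec(5,7)
      defs(6)[symmetric] dec(8) p defs(5)[symmetric] N[symmetric] K[symmetric] I[symmetric] F[symmetric]
      dec(3,6,9) two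
    using pos' by simp
qed

text \<open>Here \<open>d\<close>, \<open>h\<close>, \<open>k\<close> are the true parameters and
  the primed ones are truncated. With an internal node the length test guarantees that both agree; a
  single leaf is treated apart.\<close>

lemma reduce_core:
  fixes v :: "bool list"
  assumes w: "w = header d h k @ v" and pos: "1 \<le> d" "1 \<le> h" "1 \<le> k"
  shows "reduce w \<in> dpda_language evaluator \<longleftrightarrow>
    2 \<le> d \<and> (\<exists>E. w = tree_word d h k E \<and> (\<forall>e<num_elements d h k. E e \<in> {1..k}) \<and> tree_value d h k E = 1)"
proof (cases "2 \<le> d")
  case d: True
  define N where "N = Suc (length w)"
  define d' h' k' where dhk: "d' = min d N" "h' = min h N" "k' = min k N"
  define K I F where KIF: "K = min (k' ^ d') N" "I = min (level_start d' (h' - 1)) N" "F = min (d' ^ (h' - 1)) N"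
  define b where "b = floorlog 2 k"
  define X where "X = element w (length (header d h k)) b"
  have red: "reduce w = (if (I * K + F) * b = length v \<and> (\<forall>t<I * K + F. X t \<in> {1..k'})
      then answer d' k' K I F X else [])"
    using reduce_header[OF w pos N_def dhk KIF] d unfolding X_def b_def by (simp only: simp_thms)
  have N: "2 \<le> N" "length v < N" using w by (auto simp: N_def length_header)
  have b: "1 \<le> b" using pos floorlog_eq_zero_iff[of 2 k] by (auto simp: b_def)
  have kb: "k < 2 ^ b" using floorlog_bounds[of k 2] pos by (simp add: b_def)
  have nil: "[] \<notin> dpda_language evaluator" by (simp add: language_evaluator)
  have elem: "X t = min (E t) N" if "v = concat (map (\<lambda>t. binary b (E t)) [0..<n])" "t < n" "E t < 2 ^ b" for E t n
    unfolding X_def N_def by (rule decode_element) (use w that in auto)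
  have word: "w = tree_word d h k E \<longleftrightarrow> v = concat (map (\<lambda>t. binary b (E t)) [0..<num_elements d h k])" for E
    by (simp add: w tree_word_def b_def)
  have lenv: "length v = n * b" if "v = concat (map (\<lambda>t. binary b (E t)) [0..<n])" for E n
    unfolding that by (rule length_concat_const) simp
  have d'2: "2 \<le> d'" "1 \<le> k'" using d pos N by (auto simp: dhk)
  have K1: "1 \<le> K" using d'2 N by (simp add: KIF)
  show ?thesis
  proof (cases "2 \<le> h")
    case h: True
    have exact: "d' = d" "h' = h" "k' = k" "K = k ^ d" "I = level_start d (h - 1)" "F = d ^ (h - 1)"
      "k < N" "I * K + F = num_elements d h k"
      if "num_elements d h k < N"
      using sizes_exact[OF d h pos(3) that] by (auto simp: dhk KIF num_elements_def)
    show ?thesis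
    proof
      assume acc: "reduce w \<in> dpda_language evaluator"
      then have cond: "(I * K + F) * b = length v" "\<And>t. t < I * K + F \<Longrightarrow> X t \<in> {1..k'}"
        and ans: "answer d' k' K I F X \<in> dpda_language evaluator"
        using nil unfolding red by (auto split: if_splits)
      \<comment> \<open>Every element takes at least one bit, so a word that passes the length test
        has fewer than \<open>N\<close> elements.\<close>
      have "I * K + F \<le> (I * K + F) * b" using b by simp
      then have "I * K + F < N" using cond(1) N by linarith
      then have "num_elements d h k < N"
        using saturated_sizes_exact(4)[OF d h pos(3) N(1) dhk] by (simp add: KIF)
      note exact = exact[OF this]
      obtain E where E: "v = concat (map (\<lambda>t. binary b (E t)) [0..<num_elements d h k])"
        "\<And>t. t < num_elements d h k \<Longrightarrow> E t < 2 ^ b"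
        using parse_elements[of v "num_elements d h k" b] cond(1) exact(8) by metis
      have EX: "E t = X t" if "t < num_elements d h k" for t
        using elem[OF E(1) that E(2)[OF that]] cond(2)[of t] that exact by (auto simp: min_def split: if_splits)
      have range: "\<And>e. e < num_elements d h k \<Longrightarrow> X e \<in> {1..k}"
        using cond(2) exact by simp
      have "tree_value d h k X = 1"
        using ans answer_accepts[of d h K k I F X] range pos exact K1 by simp
      then have "tree_value d h k E = 1"
        using tree_value_cong[of d h k _ E X, OF order_refl EX pos(2) range] by simp
      then show "2 \<le> d \<and> (\<exists>E. w = tree_word d h k E \<and> (\<forall>e<num_elements d h k. E e \<in> {1..k}) \<and> tree_value d h k E = 1)"
        using d E(1) word EX range by auto
    next
      assume "2 \<le> d \<and> (\<exists>E. w = tree_word d h k E \<and> (\<forall>e<num_elements d h k. E e \<in> {1..k}) \<and> tree_value d h k E = 1)"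
      then obtain E where E: "v = concat (map (\<lambda>t. binary b (E t)) [0..<num_elements d h k])"
        "\<And>e. e < num_elements d h k \<Longrightarrow> E e \<in> {1..k}" "tree_value d h k E = 1"
        using word by auto
      have "num_elements d h k \<le> num_elements d h k * b" using b by simp
      then have "num_elements d h k < N" using lenv[OF E(1)] N by linarith
      note exact = exact[OF this]
      have XE: "X t = E t" if "t < num_elements d h k" for t
        using elem[OF E(1) that] E(2)[OF that] kb exact(7) by auto
      have "tree_value d h k X = 1"
        using tree_value_cong[of d h k _ X E, OF order_refl XE pos(2) E(2)] E(3) by simp
      then have "answer d k K I F X \<in> dpda_language evaluator"
        using answer_accepts[of d h K k I F X] XE E(2) pos exact K1 by simp
      then show "reduce w \<in> dpda_language evaluator"
        unfolding red using lenv[OF E(1)] XE E(2) exact by simp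
    qed
  next
    case False
    then have h: "h = 1" using pos by simp
    \<comment> \<open>A single leaf: the length test involves only the exact digit count
      \<open>b\<close>, and since \<open>2 \<le> N\<close>, the truncated element equals
      \<open>1\<close> exactly if the true one does.\<close>
    have h': "h' = 1" "I = 0" "F = 1" using N by (auto simp: dhk KIF h level_start_simps)
    have one: "num_elements d h k = 1" by (simp add: num_elements_def h level_start_simps)
    have val: "node_value d (table_fun k K E) (table_leaf K 0 E) (h - 1) 1 = E 0" for d k K E
      by (simp add: h table_leaf_def)
    have tval: "tree_value d h k E = E 0" for E
      by (simp add: h table_leaf_def level_start_simps)
    show ?thesis
    proof
      assume acc: "reduce w \<in> dpda_language evaluator"
      then have cond: "b = length v" "X 0 \<in> {1..k'}"
        and ans: "answer d' k' K I F X \<in> dpda_language evaluator"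
        using nil unfolding red h' by (auto split: if_splits)
      obtain E where E: "v = concat (map (\<lambda>t. binary b (E t)) [0..<1])" "\<And>t. t < 1 \<Longrightarrow> E t < 2 ^ b"
        using parse_elements[of v 1 b] cond(1) by auto
      have "X 0 = 1"
        using ans answer_accepts[of d' 1 K k' I F X] cond(2) d'2 K1 val[of d' k' K X]
        by (simp add: h' h level_start_simps)
      then have "E 0 = 1" using elem[OF E(1), of 0] E(2)[of 0] N by (auto simp: min_def split: if_splits)
      then show "2 \<le> d \<and> (\<exists>E. w = tree_word d h k E \<and> (\<forall>e<num_elements d h k. E e \<in> {1..k}) \<and> tree_value d h k E = 1)"
        using d E(1) pos(3) tval[of E] unfolding word one by (intro conjI exI[of _ E]) simp_all
    next
      assume "2 \<le> d \<and> (\<exists>E. w = tree_word d h k E \<and> (\<forall>e<num_elements d h k. E e \<in> {1..k}) \<and> tree_value d h k E = 1)"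
      then obtain E where E: "v = concat (map (\<lambda>t. binary b (E t)) [0..<1])" "E 0 = 1"
        using word one tval by auto
      have "X 0 = 1" using elem[OF E(1), of 0] E(2) kb pos N by (simp add: min_def)
      then have "answer d' k' K I F X \<in> dpda_language evaluator"
        using answer_accepts[of d' 1 K k' I F X] d'2 K1 val[of d' k' K X]
        by (simp add: h' h level_start_simps)
      then show "reduce w \<in> dpda_language evaluator"
        unfolding red h' using lenv[OF E(1)] \<open>X 0 = 1\<close> d'2 h' by simp
    qed
  qed
next
  case False
  have "[] \<notin> dpda_language evaluator" by (simp add: language_evaluator)
  then show ?thesis using reduce_header[OF w pos refl refl refl refl refl refl refl] False by simp
qed

lemma header_of_reduce:
  assumes "reduce w \<noteq> []"
  obtains d h k v where "w = header d h k @ v" "1 \<le> d" "1 \<le> h" "1 \<le> k"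
proof -
  define e1 where "e1 = paramlen w 0"
  define q1 where "q1 = 2 * e1 + 1"
  define e2 where "e2 = paramlen w q1"
  define q2 where "q2 = q1 + 2 * e2 + 1"
  define b where "b = paramlen w q2"
  define p where "p = q2 + 2 * b + 1"
  have *: "2 \<le> e1" "1 \<le> e2" "1 \<le> b" "bitval w 1 = 1" "bitval w (q1 + 1) = 1" "bitval w (q2 + 1) = 1" "p \<le> length w"
    using assms unfolding reduce_def Let_def e1_def[symmetric] q1_def[symmetric] e2_def[symmetric]
      q2_def[symmetric] b_def[symmetric] p_def[symmetric] by (auto split: if_splits)
  have q: "0 + 2 * e1 < length w" "q1 + 2 * e2 < length w" "q2 + 2 * b < length w"
    using *(7) by (auto simp: p_def q2_def q1_def)
  obtain d where d: "0 < d" "drop 0 w = encode_parameter d @ drop (0 + 2 * e1 + 1) w"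
    using parse_parameter[of e1 w 0] * q e1_def by auto
  obtain h where h: "0 < h" "drop q1 w = encode_parameter h @ drop (q1 + 2 * e2 + 1) w"
    using parse_parameter[of e2 w q1] * q e2_def by auto
  obtain k where k: "0 < k" "drop q2 w = encode_parameter k @ drop (q2 + 2 * b + 1) w"
    using parse_parameter[of b w q2] * q b_def by auto
  have "w = header d h k @ drop (q2 + 2 * b + 1) w"
    using d(2) h(2) k(2) by (simp add: header_def q1_def q2_def)
  then show ?thesis using that d(1) h(1) k(1) by auto
qed

lemma reduce_correct: "w \<in> BT_degree \<longleftrightarrow> reduce w \<in> dpda_language evaluator"
proof
  assume "w \<in> BT_degree"
  then obtain d h k E where *: "2 \<le> d" "1 \<le> h" "1 \<le> k" "w = tree_word d h k E"
     "\<forall>e<num_elements d h k. E e \<in> {1..k}" "tree_value d h k E = 1"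
    unfolding BT_degree_iff by blast
  then show "reduce w \<in> dpda_language evaluator"
    using reduce_core[of w d h k] unfolding tree_word_def by auto
next
  assume acc: "reduce w \<in> dpda_language evaluator"
  have "[] \<notin> dpda_language evaluator" by (simp add: language_evaluator)
  then have "reduce w \<noteq> []" using acc by metis
  then obtain d h k v where *: "w = header d h k @ v" "1 \<le> d" "1 \<le> h" "1 \<le> k"
    by (rule header_of_reduce)
  then show "w \<in> BT_degree"
    unfolding BT_degree_iff using reduce_core[OF *] acc by (intro exI[of _ d] exI[of _ h] exI[of _ k]) simp
qed

section \<open>The reduction as a program\<close>

definition LeqE :: "exp \<Rightarrow> exp \<Rightarrow> exp" where
  "LeqE a b = Bin Minus (Const 1) (Bin Minus a b)"

definition EqE :: "exp \<Rightarrow> exp \<Rightarrow> exp" where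
  "EqE a b = Bin Times (LeqE a b) (LeqE b a)"

lemma eval_LeqE [simp]: "eval (LeqE a b) w s = of_bool (eval a w s \<le> eval b w s)"
  by (simp add: LeqE_def)

lemma eval_EqE [simp]: "eval (EqE a b) w s = of_bool (eval a w s = eval b w s)"
  by (auto simp: EqE_def)

definition AndE :: "exp list \<Rightarrow> exp" where
  "AndE es = foldr (Bin Times) es (Const 1)"

text \<open>Variables \<open>0\<close> to \<open>11\<close> hold the numbers that \<open>reduce\<close> computes (without \<open>N\<close>), in the order
  \<open>e1, q1, e2, q2, b, p, d, h, k, K, I, F\<close>.\<close>

definition ParamlenE :: "exp \<Rightarrow> exp" where
  "ParamlenE q = Iter 20 21 Len (Const 0)
     (Bin Plus (Var 21) (Bit (Bin Plus q (Bin Times (Const 2) (Var 21)))))"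

definition ReadnumE :: "exp \<Rightarrow> exp \<Rightarrow> exp" where
  "ReadnumE g e = Iter 20 21 e (Const 0) (Bin Plus (Bin Times (Const 2) (Var 21)) (Bit g))"

definition ParamvalE :: "exp \<Rightarrow> exp \<Rightarrow> exp" where
  "ParamvalE q e = ReadnumE (Bin Plus (Bin Plus q (Const 1)) (Bin Times (Const 2) (Var 20))) e"

definition ElementE :: "exp \<Rightarrow> exp" where
  "ElementE t = ReadnumE (Bin Plus (Bin Plus (Var 5) (Bin Times t (Var 4))) (Var 20)) (Var 4)"

text \<open>Arguments are evaluated inside the loop, where registers \<open>20\<close> and
  \<open>21\<close> are rebound, and must not notice it.\<close>

definition independent :: "exp \<Rightarrow> bool" where
  "independent e \<longleftrightarrow> (\<forall>w s t a. eval e w (s(20 := t, 21 := a)) = eval e w s)"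

lemma eval_ParamlenE:
  assumes "independent q"
  shows "eval (ParamlenE q) w s = paramlen w (eval q w s)"
  using assms by (simp add: ParamlenE_def paramlen_def independent_def)

lemma eval_ParamvalE:
  assumes "independent q"
  shows "eval (ParamvalE q e) w s = paramval w (eval q w s) (eval e w s)"
  using assms by (simp add: ParamvalE_def ReadnumE_def readnum_def independent_def)

lemma eval_ElementE:
  assumes "independent t"
  shows "eval (ElementE t) w s = element w (s 5) (s 4) (eval t w s)"
  using assms by (simp add: ElementE_def ReadnumE_def readnum_def independent_def)

definition PowerE :: "nat \<Rightarrow> exp \<Rightarrow> exp" where
  "PowerE x e = Iter 20 21 e (Const 1) (Bin Times (Var 21) (Var x))"

definition LevelE :: "nat \<Rightarrow> exp \<Rightarrow> exp" where
  "LevelE x e = Iter 20 21 e (Const 0) (Bin Plus (Bin Times (Var 21) (Var x)) (Const 1))"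

lemma eval_PowerE:
  "x < 20 \<Longrightarrow> eval (PowerE x e) w s = min (s x ^ eval e w s) (Suc (length w))"
  using iterate_min_power[of "Suc (length w)" "eval e w s" "s x"] by (simp add: PowerE_def)

lemma eval_LevelE:
  "x < 20 \<Longrightarrow> eval (LevelE x e) w s = min (level_start (s x) (eval e w s)) (Suc (length w))"
  using iterate_min_level_start[of "eval e w s" "s x" "Suc (length w)"] by (simp add: LevelE_def)

text \<open>Bounded universal quantification as a product of truth values; truncation never affects
  \<open>0\<close> and \<open>1\<close>.\<close>

lemma iterate_all:
  "iterate n (\<lambda>t a. min (a * of_bool (P t)) (Suc N)) 1 = of_bool (\<forall>t<n. P t)"
proof (induction n)
  case (Suc n)
  then show ?case by (simp add: less_Suc_eq) blast
qed simp

definition AllElementsE :: exp where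
  "AllElementsE = Iter 22 23 (Bin Plus (Bin Times (Var 10) (Var 9)) (Var 11)) (Const 1)
     (Bin Times (Var 23) (AndE [LeqE (Const 1) (ElementE (Var 22)), LeqE (ElementE (Var 22)) (Var 8)]))"

lemma eval_AllElementsE:
  "eval AllElementsE w s = of_bool (\<forall>t<s 10 * s 9 + s 11. 1 \<le> element w (s 5) (s 4) t \<and> element w (s 5) (s 4) t \<le> s 8)"
proof -
  have "eval (AndE [LeqE (Const 1) (ElementE (Var 22)), LeqE (ElementE (Var 22)) (Var 8)]) w (s(22 := t, 23 := a)) =
      of_bool (1 \<le> element w (s 5) (s 4) t \<and> element w (s 5) (s 4) t \<le> s 8)" for t a
    by (simp add: AndE_def eval_ElementE independent_def)
  then have "eval AllElementsE w s = iterate (s 10 * s 9 + s 11)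
      (\<lambda>t a. min (a * of_bool (1 \<le> element w (s 5) (s 4) t \<and> element w (s 5) (s 4) t \<le> s 8)) (Suc (length w))) 1"
    unfolding AllElementsE_def by (simp del: of_bool_conj)
  then show ?thesis by (simp only: iterate_all)
qed

definition ValidE :: exp where
  "ValidE = AndE [LeqE (Const 2) (Var 0), LeqE (Const 1) (Var 2), LeqE (Const 1) (Var 4),
     EqE (Bit (Const 1)) (Const 1), EqE (Bit (Bin Plus (Var 1) (Const 1))) (Const 1),
     EqE (Bit (Bin Plus (Var 3) (Const 1))) (Const 1),
     EqE (Bin Plus (Var 5) (Bin Times (Bin Plus (Bin Times (Var 10) (Var 9)) (Var 11)) (Var 4))) Len,
     AllElementsE]"

lemma eval_ValidE:
  "eval ValidE w s = of_bool (2 \<le> s 0 \<and> 1 \<le> s 2 \<and> 1 \<le> s 4 \<and> bitval w 1 = 1 \<and> bitval w (s 1 + 1) = 1 \<and>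
     bitval w (s 3 + 1) = 1 \<and> s 5 + (s 10 * s 9 + s 11) * s 4 = length w \<and>
     (\<forall>t<s 10 * s 9 + s 11. 1 \<le> element w (s 5) (s 4) t \<and> element w (s 5) (s 4) t \<le> s 8))"
  unfolding ValidE_def AndE_def by (simp add: eval_AllElementsE of_bool_conj)

text \<open>A loop with zero or one rounds acts as a conditional, provided that \<open>e\<close> is
  a truth value.\<close>

definition When :: "nat \<Rightarrow> exp \<Rightarrow> out \<Rightarrow> out" where
  "When z e p = For z e p"

definition Unary :: "exp \<Rightarrow> out" where
  "Unary e = For 19 e (Emit 0)"

lemma oeval_When: "eval e w s = of_bool P \<Longrightarrow> oeval (When z e p) w s = (if P then oeval p w (s(z := 0)) else [])"
  by (simp add: When_def)

lemma oeval_Unary: "oeval (Unary e) w s = replicate (eval e w s) 0"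
proof -
  have "concat (map (\<lambda>t. [0]) [0..<n]) = replicate n (0 :: nat)" for n
    by (induction n) (auto simp: replicate_append_same)
  then show ?thesis by (simp add: Unary_def)
qed

text \<open>Variables \<open>15\<close>, \<open>16\<close>, \<open>17\<close> hold \<open>i\<close>,
  \<open>j\<close>, \<open>y\<close>. The nested conditional of \<open>entry\<close> becomes a
  sequence of outputs with mutually exclusive guards.\<close>

definition EntryO :: out where
  "EntryO =
    Cat (When 18 (AndE [EqE (Var 15) (Const 0), EqE (Bin Plus (Bin Times (Var 16) (Var 9)) (Var 17)) (Const 1)]) (Emit 4))
   (Cat (When 18 (AndE [LeqE (Const 1) (Var 15), LeqE (Bin Plus (Var 10) (Const 1)) (Var 15)])
      (Unary (ElementE (Bin Plus (Bin Times (Var 10) (Var 9)) (Bin Minus (Bin Minus (Var 15) (Var 10)) (Const 1))))))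
   (Cat (When 18 (AndE [LeqE (Const 1) (Var 15), LeqE (Var 15) (Var 10), LeqE (Bin Plus (Var 16) (Const 1)) (Var 6)])
      (Cat (Emit 1) (Cat
        (Unary (Bin Minus (Bin Plus (Bin Times (Bin Plus (Bin Times (Var 15) (Bin Plus (Var 6) (Const 1)))
           (Bin Plus (Var 16) (Const 1))) (Var 9)) (Bin Times (Var 17) (Var 8))) (Const 1)))
        (Cat (Emit 1)
          (Unary (Bin Times (Bin Times (Bin Plus (Bin Plus (Bin Times (Var 6) (Bin Minus (Var 15) (Const 1)))
             (Const 2)) (Var 16)) (Bin Plus (Var 6) (Const 1))) (Var 9)))))))
     (When 18 (AndE [LeqE (Const 1) (Var 15), LeqE (Var 15) (Var 10), LeqE (Var 6) (Var 16)])
       (Unary (ElementE (Bin Plus (Bin Times (Bin Minus (Var 15) (Const 1)) (Var 9)) (Var 17)))))))"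

lemma oeval_EntryO:
  "oeval EntryO w s = entry (s 6) (s 8) (s 9) (s 10) (element w (s 5) (s 4)) (s 15) (s 16) (s 17)"
proof -
  have "oeval EntryO w s =
    (if s 15 = 0 \<and> s 16 * s 9 + s 17 = 1 then [4] else []) @
    (if 1 \<le> s 15 \<and> s 10 + 1 \<le> s 15 then replicate (element w (s 5) (s 4) (s 10 * s 9 + (s 15 - s 10 - 1))) 0 else []) @
    (if 1 \<le> s 15 \<and> s 15 \<le> s 10 \<and> s 16 + 1 \<le> s 6 then
       [1] @ replicate ((s 15 * (s 6 + 1) + (s 16 + 1)) * s 9 + s 17 * s 8 - 1) 0 @
       [1] @ replicate ((s 6 * (s 15 - 1) + 2 + s 16) * (s 6 + 1) * s 9) 0 else []) @
    (if 1 \<le> s 15 \<and> s 15 \<le> s 10 \<and> s 6 \<le> s 16 then replicate (element w (s 5) (s 4) ((s 15 - 1) * s 9 + s 17)) 0 else [])"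
    unfolding EntryO_def
    by (simp add: oeval_When[where P = "_ \<and> _"] AndE_def When_def oeval_Unary eval_ElementE independent_def)
  then show ?thesis by (simp add: entry_def child_def)
qed

definition SizeE :: exp where
  "SizeE = Bin Plus (Bin Plus (Var 10) (Var 11)) (Const 1)"

definition AnswerO :: out where
  "AnswerO =
    Cat (Emit 1) (Cat (Unary (Bin Times (Bin Plus (Var 6) (Const 1)) (Var 9))) (Cat (Emit 3)
      (For 14 (Bin Times SizeE (Bin Times (Bin Plus (Var 6) (Const 1)) (Var 9)))
        (Cat (For 15 SizeE (For 16 (Bin Plus (Var 6) (Const 1)) (For 17 (Var 9) (Cat (Emit 2) EntryO)))) (Emit 3)))))"

lemma map_concat_map: "concat (map f (concat (map g xs))) = concat (map (\<lambda>x. concat (map f (g x))) xs)"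
  by (induction xs) auto

lemma oeval_AnswerO:
  "oeval AnswerO w s = answer (s 6) (s 8) (s 9) (s 10) (s 11) (element w (s 5) (s 4))"
proof -
  have const: "concat (map (\<lambda>t. b) [0..<n]) = concat (replicate n b)" for n and b :: "nat list"
    by (simp add: map_replicate_const)
  show ?thesis
    unfolding AnswerO_def answer_def block_def table_def
    by (simp add: oeval_Unary oeval_EntryO SizeE_def map_concat_map o_def const del: upt_Suc)
qed

definition reduceO :: out where
  "reduceO =
    Let 0 (ParamlenE (Const 0)) (
    Let 1 (Bin Plus (Bin Times (Const 2) (Var 0)) (Const 1)) (
    Let 2 (ParamlenE (Var 1)) (
    Let 3 (Bin Plus (Bin Plus (Var 1) (Bin Times (Const 2) (Var 2))) (Const 1)) (
    Let 4 (ParamlenE (Var 3)) (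
    Let 5 (Bin Plus (Bin Plus (Var 3) (Bin Times (Const 2) (Var 4))) (Const 1)) (
    Let 6 (ParamvalE (Const 0) (Var 0)) (
    Let 7 (ParamvalE (Var 1) (Var 2)) (
    Let 8 (ParamvalE (Var 3) (Var 4)) (
    Let 9 (PowerE 8 (Var 6)) (
    Let 10 (LevelE 6 (Bin Minus (Var 7) (Const 1))) (
    Let 11 (PowerE 6 (Bin Minus (Var 7) (Const 1))) (
    When 13 ValidE AnswerO))))))))))))"

lemma wf_reduceO: "wf_out 24 reduceO"
  by (simp add: reduceO_def When_def ValidE_def AnswerO_def EntryO_def SizeE_def Unary_def AllElementsE_def
      AndE_def LeqE_def EqE_def ElementE_def ParamvalE_def ParamlenE_def ReadnumE_def
      PowerE_def LevelE_def)

lemma oeval_reduceO: "oeval reduceO w s = reduce w"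
proof -
  define e1 where "e1 = paramlen w 0"
  define q1 where "q1 = 2 * e1 + 1"
  define e2 where "e2 = paramlen w q1"
  define q2 where "q2 = q1 + 2 * e2 + 1"
  define b where "b = paramlen w q2"
  define p where "p = q2 + 2 * b + 1"
  define d where "d = paramval w 0 e1"
  define h where "h = paramval w q1 e2"
  define k where "k = paramval w q2 b"
  define K where "K = min (k ^ d) (Suc (length w))"
  define I where "I = min (level_start d (h - 1)) (Suc (length w))"
  define F where "F = min (d ^ (h - 1)) (Suc (length w))"
  have d': "readnum w (\<lambda>t. 1 + 2 * t) e1 = d" by (simp add: d_def)
  note defs = e1_def q1_def e2_def q2_def b_def p_def d_def h_def k_def K_def I_def F_def
  let ?s = "s(0 := e1, 1 := q1, 2 := e2, 3 := q2, 4 := b, 5 := p, 6 := d, 7 := h, 8 := k, 9 := K, 10 := I, 11 := F)"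
  have "oeval reduceO w s = oeval (When 13 ValidE AnswerO) w ?s"
    by (simp add: reduceO_def eval_ParamlenE eval_ParamvalE eval_PowerE eval_LevelE independent_def
        d' defs[symmetric] del: One_nat_def)
  also have "\<dots> = reduce w"
    unfolding reduce_def Let_def defs[symmetric] oeval_When[OF eval_ValidE] oeval_AnswerO
    by (simp split del: if_split cong: if_cong)
  finally show ?thesis .
qed

lemma logspace_reduce: "logspace_computable (\<lambda>w. reduce (u @ w))"
  using logspace_out[OF wf_reduceO, of u] by (simp add: oeval_reduceO)

text \<open>Parameters are self-delimiting: \<open>paramlen\<close> recovers the length of the
  prefix from the whole word, so the word splits in only one way, and the digits then determine
  \<open>d\<close>.\<close>

lemma BT_prefix:
  assumes "2 \<le> d"
  shows "w \<in> BT d \<longleftrightarrow> encode_parameter d @ w \<in> BT_degree"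
proof
  assume "encode_parameter d @ w \<in> BT_degree"
  then obtain d' h k f leaf where *: "encode_parameter d @ w = encode_parameter d' @ encode_tree d' h k f leaf"
    "tree_instance d' h k f leaf" "root_value d' h f leaf = 1"
    unfolding BT_degree_def by blast
  let ?w = "encode_parameter d @ w"
  have 1: "?w = [] @ encode_parameter d @ w" by simp
  have 2: "?w = [] @ encode_parameter d' @ encode_tree d' h k f leaf" using * by simp
  have fl: "floorlog 2 d = floorlog 2 d'"
    using decode_parameter(1)[OF 1] decode_parameter(1)[OF 2] by simp
  then have "length (encode_parameter d) = length (encode_parameter d')"
    by (simp add: length_encode_parameter)
  then have eq: "encode_parameter d = encode_parameter d'" "w = encode_tree d' h k f leaf"
    using *(1) by auto
  have "binary (floorlog 2 d) d = binary (floorlog 2 d) d'"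
    using eq(1) encode_parameter_nth(3)[OF refl, of _ d] encode_parameter_nth(3)[OF refl, of _ d'] fl
    by (intro nth_equalityI) auto
  moreover have "num (binary (floorlog 2 x) x) = x" for x
    by (cases "x = 0") (use floorlog_bounds[of x 2] in \<open>auto intro!: num_binary simp: floorlog_eq_zero_iff\<close>)
  ultimately have "d = d'" using fl by metis
  then show "w \<in> BT d" unfolding BT_def using * eq by blast
next
  assume "w \<in> BT d"
  then show "encode_parameter d @ w \<in> BT_degree"
    unfolding BT_def BT_degree_def using assms by blast
qed

lemma dcfl_evaluator: "dcfl (dpda_language evaluator)"
  unfolding dcfl_def using wf_evaluator by blast

theorem theorem3p1:
  shows "(\<forall>d\<ge>2. BT d \<in> LogDCFL) \<and> BT_degree \<in> LogDCFL"
proof (intro conjI allI impI)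
  fix d :: nat assume "2 \<le> d"
  then have "w \<in> BT d \<longleftrightarrow> reduce (encode_parameter d @ w) \<in> dpda_language evaluator" for w
    by (simp add: BT_prefix reduce_correct)
  then show "BT d \<in> LogDCFL"
    unfolding LogDCFL_def using dcfl_evaluator logspace_reduce by blast
next
  have "logspace_computable reduce" using logspace_reduce[of "[]"] by simp
  then show "BT_degree \<in> LogDCFL"
    unfolding LogDCFL_def using dcfl_evaluator reduce_correct by blast
qed

end
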